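(* Let $\alpha>0$ and let $X=(X_t)_{t\in\mathbb{R}}$ be a real-valued two-sided Lévy process such that $X_0=0$, $X_t$ is non-degenerate for $t\ne0$, $\mathbb{E}[|X_1|]<\infty$ and $|\mathbb{E}[X_1]|<\alpha$. Let $M$ be the $\alpha$-Lipschitz minorant of $X$ and $\mathcal{Z}=\{t\in\mathbb{R}:M_t=X_t\wedge X_{t-}\}$. Then the random (closed) set $\mathcal{Z}$ is stationary and regenerative.
   Context: A two-sided real-valued Lévy process $X=(X_t)_{t\in\mathbb{R}}$ has càdlàg paths, $X_0=0$, and for $s<t$ the increment $X_t-X_s$ is independent of $\{X_r:r\le s\}$ with the same distribution as $X_{t-s}$. Non-degenerate means not almost surely constant. A function $g:\mathbb{R}\to\mathbb{R}$ is $\alpha$-Lipschitz if $|g(s)-g(t)|\le\alpha|s-t|$ for all $s,t$. The $\alpha$-Lipschitz minorant of $f$ is the greatest $\alpha$-Lipschitz function dominated by $f$; under the stated assumptions it exists almost surely for the paths of $X$. Let $\Omega^0$ be the class of closed subsets of $\mathbb{R}$. For $t\in\mathbb{R}$, $\omega\in\Omega^0$ set $d_t(\omega)=\inf\{s>t:s\in\omega\}$ (with $\inf\emptyset=+\infty$), $r_t(\omega)=d_t(\omega)-t$, and $\tau_t(\omega)=\mathbf{cl}\{s-t:s\in\omega\cap(t,\infty)\}$, where $\mathbf{cl}$ is closure. Let $\mathcal{G}^0=\sigma\{r_s:s\in\mathbb{R}\}$, $\mathcal{G}^0_t=\sigma\{r_s:s\le t\}$ and $\mathcal{G}^0_{t+}=\bigcap_{s>t}\mathcal{G}^0_s$.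 A random set is a measurable map from a measurable space to $(\Omega^0,\mathcal{G}^0)$. A probability measure $\mathbb{Q}$ on $(\Omega^0,\mathcal{G}^0)$ is regenerative with regeneration law $\mathbb{Q}^0$ (a probability measure on $(\Omega^0,\mathcal{G}^0)$) if (i) $\mathbb{Q}\{d_t=+\infty\}=0$ for all $t\in\mathbb{R}$, and (ii) for all $t\in\mathbb{R}$ and all nonnegative $\mathcal{G}^0$-measurable $F$, $\mathbb{Q}[F(\tau_{d_t})\mid\mathcal{G}^0_{t+}]=\mathbb{Q}^0[F]$, where $\mathbb{Q}[\cdot]$ and $\mathbb{Q}^0[\cdot]$ denote expectations. A random set $S$ on a probability space is regenerative if its distribution is a regenerative probability measure (for some regeneration law), and stationary if $u+S$ has the same distribution as $S$ for every $u\in\mathbb{R}$. *)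

theory Defs
  imports "HOL-Probability.Probability"
begin

section \<open>Two-sided Levy processes\<close>

definition cadlag :: "(real \<Rightarrow> real) \<Rightarrow> bool" where
  "cadlag f \<longleftrightarrow> (\<forall>t. continuous (at_right t) f \<and> (\<exists>l. (f \<longlongrightarrow> l) (at_left t)))"

definition left_limit :: "(real \<Rightarrow> real) \<Rightarrow> real \<Rightarrow> real" where
  "left_limit f t = Lim (at_left t) f"

locale two_sided_levy_process = prob_space P
  for P :: "'a measure" +
  fixes X :: "real \<Rightarrow> 'a \<Rightarrow> real"
  assumes random_variable_X: "\<And>t. X t \<in> borel_measurable P"
    and cadlag_paths: "\<And>w. w \<in> space P \<Longrightarrow> cadlag (\<lambda>t. X t w)"
    and X_zero: "\<And>w. w \<in> space P \<Longrightarrow> X 0 w = 0"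
    and indep_increments: "\<And>s t. s < t \<Longrightarrow>
      indep_set
        {(\<lambda>w. X t w - X s w) -` B \<inter> space P | B. B \<in> sets borel}
        (sigma_sets (space P) {X r -` B \<inter> space P | r B. r \<le> s \<and> B \<in> sets borel})"
    and stationary_increments: "\<And>s t. s < t \<Longrightarrow>
      distr P borel (\<lambda>w. X t w - X s w) = distr P borel (X (t - s))"

section \<open>Lipschitz minorants\<close>

definition is_lipschitz_minorant :: "real \<Rightarrow> (real \<Rightarrow> real) \<Rightarrow> (real \<Rightarrow> real) \<Rightarrow> bool" where
  "is_lipschitz_minorant \<alpha> f m \<longleftrightarrow>
     \<alpha>-lipschitz_on UNIV m \<and> (\<forall>t. m t \<le> f t) \<and>
     (\<forall>h. \<alpha>-lipschitz_on UNIV h \<and> (\<forall>t. h t \<le> f t) \<longrightarrow> (\<forall>t. h t \<le> m t))"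

text \<open>
  The minorant is unique when it exists.  For a path without a minorant the contact set is empty
  by convention.  This concerns only a null event for the processes considered, and the convention
  cannot make a random contact set regenerative for free: the first condition
  on the law in \<open>regenerative_with\<close> forces the contact set to be nonempty almost surely.
\<close>

definition contact_set :: "real \<Rightarrow> (real \<Rightarrow> real) \<Rightarrow> real set" where
  "contact_set \<alpha> f =
     {t. \<exists>m. is_lipschitz_minorant \<alpha> f m \<and> m t = min (f t) (left_limit f t)}"

section \<open>Random closed sets and regeneration\<close>

definition next_point :: "real \<Rightarrow> real set \<Rightarrow> ereal" where
  "next_point t S = Inf {ereal s | s. s \<in> S \<and> s > t}"

definition wait :: "real \<Rightarrow> real set \<Rightarrow> ereal" where
  "wait t S = next_point t S - ereal t"

definition shifted_future :: "real \<Rightarrow> real set \<Rightarrow> real set" where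
  "shifted_future t S = closure {s - t | s. s \<in> S \<and> s > t}"

definition closed_sets :: "real set measure" where
  "closed_sets =
     sigma {S. closed S} {{S. closed S \<and> wait s S \<in> B} | s B. B \<in> sets borel}"

definition closed_sets_past :: "real \<Rightarrow> real set measure" where
  "closed_sets_past t =
     sigma {S. closed S} {{S. closed S \<and> wait s S \<in> B} | s B. s \<le> t \<and> B \<in> sets borel}"

definition closed_sets_past_right :: "real \<Rightarrow> real set measure" where
  "closed_sets_past_right t = sigma {S. closed S} (\<Inter>s\<in>{t<..}. sets (closed_sets_past s))"

text \<open>
  The conversion \<open>real_of_ereal\<close> below only matters on the event that the next point is infinite,
  which is null by the condition preceding it.  Since \<open>closed_sets_past_right t\<close> generates from an
  intersection of sigma-algebras, its measurable sets are exactly that intersection.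
\<close>

definition regenerative_with :: "real set measure \<Rightarrow> real set measure \<Rightarrow> bool" where
  "regenerative_with Q Q0 \<longleftrightarrow>
     prob_space Q \<and> sets Q = sets closed_sets \<and>
     prob_space Q0 \<and> sets Q0 = sets closed_sets \<and>
     (\<forall>t. emeasure Q {S \<in> space Q. next_point t S = \<infinity>} = 0) \<and>
     (\<forall>t. \<forall>F :: real set \<Rightarrow> ennreal. F \<in> borel_measurable closed_sets \<longrightarrow>
        (AE S in Q.
           nn_cond_exp Q (closed_sets_past_right t)
             (\<lambda>S. F (shifted_future (real_of_ereal (next_point t S)) S)) S
           = (\<integral>\<^sup>+ S. F S \<partial>Q0)))"

definition random_set :: "'a measure \<Rightarrow> ('a \<Rightarrow> real set) \<Rightarrow> bool" where
  "random_set P S \<longleftrightarrow> S \<in> measurable P closed_sets"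

definition stationary_random_set :: "'a measure \<Rightarrow> ('a \<Rightarrow> real set) \<Rightarrow> bool" where
  "stationary_random_set P S \<longleftrightarrow> random_set P S \<and>
     (\<forall>u. distr P closed_sets (\<lambda>w. (\<lambda>s. u + s) ` S w) = distr P closed_sets S)"

definition regenerative_random_set :: "'a measure \<Rightarrow> ('a \<Rightarrow> real set) \<Rightarrow> bool" where
  "regenerative_random_set P S \<longleftrightarrow> random_set P S \<and>
     (\<exists>Q0. regenerative_with (distr P closed_sets S) Q0)"

end

theory Submission
  imports Defs
begin

text \<open>
  A time \<open>t\<close> is a contact time iff the path lies above the cone of slope \<open>\<alpha>\<close> hanging from
  \<open>min (X t) (X (t-))\<close>, so the minorant itself can be eliminated.

  On a grid the regeneration property is exact.  If \<open>k\<close> is a contact of a random walk, the cone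
  condition transfers through \<open>k\<close>: contacts before \<open>k\<close> are determined by the increments before
  \<open>k\<close>, contacts after \<open>k\<close> by those after \<open>k\<close>.  Summing over the possible values of the first contact
  after a given time, past and future factorise.

  For every path, the contact sets of the skeletons on the grid of mesh \<open>h\<close> with slope \<open>a > \<alpha>\<close>
  converge in the Fell topology to the contact set when first \<open>h\<close> tends to 0 and then \<open>a\<close> decreases
  to \<open>\<alpha>\<close>.  With slope \<open>\<alpha>\<close> itself this fails when several contacts lie on one line of slope
  \<open>\<alpha>\<close> or \<open>-\<alpha>\<close>.  If the starting time also increases to \<open>t\<close>, the first grid
  contact converges to the first contact at or after \<open>t\<close>, and the product formula survives the limit;
  so does shift invariance, which gives stationarity.  The contact set is almost surely nonempty because
  \<open>X t + b * \<bar>t\<bar>\<close> is bounded below for \<open>\<bar>E (X 1)\<bar> < b < \<alpha>\<close> (Hopf's maximal inequality and the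
  zero-one law at integer times, Ottaviani's inequality in between), and then unbounded to the right by
  stationarity.
\<close>

section \<open>Contact sets of cadlag paths and of their grid skeletons\<close>

text \<open>Independence of past and future does not pass to weak limits by itself, and cutting a
  closed set at a point is not continuous in the Fell topology. Both obstacles disappear if the
  statement is an integrated product formula for continuous functionals, and if each approximating
  set is cut at one of its own points; this is why the grid sets are cut at a grid contact. How fine
  the mesh must be depends on the path and on \<open>a - \<alpha>\<close>, so the two limits stay
  nested.

  The limit formula concerns the first contact at or after \<open>t\<close>, whereas regeneration
  concerns the first point strictly after \<open>t\<close> and the sigma-algebra
  \<open>closed_sets_past_right t\<close>. Applying the formula at \<open>t + 1 / Suc n\<close>
  bridges both gaps: events of that sigma-algebra are then read off the piece before the cut, and
  the cuts decrease to the next point.\<close>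

definition lower_value :: "(real \<Rightarrow> real) \<Rightarrow> real \<Rightarrow> real" where
  "lower_value f t = min (f t) (left_limit f t)"

definition touch_set :: "real \<Rightarrow> (real \<Rightarrow> real) \<Rightarrow> real set" where
  "touch_set a f = {t. \<forall>u. lower_value f t \<le> f u + a * \<bar>u - t\<bar>}"

lemma cadlag_tendsto_right: "cadlag f \<Longrightarrow> (f \<longlongrightarrow> f t) (at_right t)"
  by (auto simp: cadlag_def continuous_within)

lemma cadlag_tendsto_left:
  assumes "cadlag f"
  shows "(f \<longlongrightarrow> left_limit f t) (at_left t)"
proof -
  obtain l where l: "(f \<longlongrightarrow> l) (at_left t)"
    using assms by (auto simp: cadlag_def)
  then have "left_limit f t = l"
    unfolding left_limit_def by (intro tendsto_Lim) auto
  with l show ?thesis by simp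
qed

text \<open>The value at \<open>t\<close> and both one-sided limits are at least
  \<open>lower_value f t\<close>, right continuity making the right limit the value.\<close>

lemma eventually_gt_lower_value:
  assumes "cadlag f" "e < lower_value f t"
  shows "\<forall>\<^sub>F u in nhds t. e < f u"
proof -
  have "\<forall>\<^sub>F u in at_right t. e < f u"
    using order_tendstoD(1)[OF cadlag_tendsto_right[OF assms(1)]] assms(2)
    by (auto simp: lower_value_def)
  moreover have "\<forall>\<^sub>F u in at_left t. e < f u"
    using order_tendstoD(1)[OF cadlag_tendsto_left[OF assms(1)]] assms(2)
    by (auto simp: lower_value_def)
  ultimately show ?thesis
    using assms(2) by (auto simp: eventually_nhds_conv_at eventually_at_split lower_value_def)
qed

lemma eventually_lower_value_gt:
  assumes "cadlag f" "e < lower_value f t"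
  shows "\<forall>\<^sub>F u in nhds t. e < lower_value f u"
proof -
  \<comment> \<open>A spare level: a left limit of values above \<open>e'\<close> is only known to
    be at least \<open>e'\<close>.\<close>
  obtain e' where e': "e < e'" "e' < lower_value f t"
    using dense[OF assms(2)] by blast
  have "\<forall>\<^sub>F u in nhds t. \<forall>\<^sub>F v in nhds u. e' < f v"
    using eventually_gt_lower_value[OF assms(1) e'(2)] by (simp add: eventually_eventually)
  then show ?thesis
  proof eventually_elim
    case (elim u)
    then have "e' < f u" by (rule eventually_nhds_x_imp_x)
    moreover have "e' \<le> left_limit f u"
    proof (rule tendsto_lowerbound[OF cadlag_tendsto_left[OF assms(1)]])
      show "\<forall>\<^sub>F v in at_left u. e' \<le> f v"
        using elim by (auto simp: eventually_nhds_conv_at eventually_at_split elim: eventually_mono)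
    qed simp
    ultimately show ?case using e' by (simp add: lower_value_def)
  qed
qed

text \<open>The complement is a union of open sets, since \<open>lower_value f\<close> is lower
  semicontinuous and the cone depends continuously on the position of its apex.\<close>

lemma closed_touch_set:
  assumes "cadlag f"
  shows "closed (touch_set a f)"
proof -
  have "open {t. f u + a * \<bar>u - t\<bar> < lower_value f t}" for u
  proof (subst open_subopen, safe)
    fix t assume "f u + a * \<bar>u - t\<bar> < lower_value f t"
    then obtain e where e: "f u + a * \<bar>u - t\<bar> < e" "e < lower_value f t"
      using dense by blast
    have "((\<lambda>s. f u + a * \<bar>u - s\<bar>) \<longlongrightarrow> f u + a * \<bar>u - t\<bar>) (nhds t)"
      by (intro tendsto_intros filterlim_ident)
    then have "\<forall>\<^sub>F s in nhds t. f u + a * \<bar>u - s\<bar> < e"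
      using e(1) by (rule order_tendstoD)
    with eventually_lower_value_gt[OF assms e(2)]
    have "\<forall>\<^sub>F s in nhds t. f u + a * \<bar>u - s\<bar> < lower_value f s"
      by eventually_elim auto
    then show "\<exists>T. open T \<and> t \<in> T \<and> T \<subseteq> {t. f u + a * \<bar>u - t\<bar> < lower_value f t}"
      by (auto simp: eventually_nhds)
  qed
  then have "open (\<Union>u. {t. f u + a * \<bar>u - t\<bar> < lower_value f t})" by blast
  moreover have "- touch_set a f = (\<Union>u. {t. f u + a * \<bar>u - t\<bar> < lower_value f t})"
    unfolding touch_set_def by (fastforce simp: not_le[symmetric])
  ultimately show ?thesis by (simp add: closed_def)
qed

text \<open>The minorant is the infimal convolution of \<open>f\<close> with the cone of slope
  \<open>a\<close>. One cone below \<open>f\<close> bounds all these infima from below.\<close>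

lemma ex_lipschitz_minorant:
  assumes "a \<ge> 0" and bnd: "\<And>u. l - a * \<bar>u - t\<bar> \<le> f u"
  shows "\<exists>m. is_lipschitz_minorant a f m \<and> l \<le> m t"
proof -
  define m where "m s = (INF u. f u + a * \<bar>u - s\<bar>)" for s
  have bdd: "bdd_below (range (\<lambda>u. f u + a * \<bar>u - s\<bar>))" for s
  proof (rule bdd_belowI2)
    fix u
    have "a * \<bar>u - t\<bar> \<le> a * (\<bar>u - s\<bar> + \<bar>s - t\<bar>)"
      using assms(1) by (intro mult_left_mono) auto
    then show "l - a * \<bar>s - t\<bar> \<le> f u + a * \<bar>u - s\<bar>"
      using bnd[of u] by (simp add: algebra_simps)
  qed
  have le: "m s \<le> f u + a * \<bar>u - s\<bar>" for s u
    unfolding m_def by (rule cINF_lower[OF bdd]) simp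
  have step: "m s \<le> m s' + a * \<bar>s - s'\<bar>" for s s'
  proof -
    have "m s - a * \<bar>s - s'\<bar> \<le> m s'"
      unfolding m_def[of s']
    proof (rule cINF_greatest)
      fix u
      have "a * \<bar>u - s\<bar> \<le> a * (\<bar>u - s'\<bar> + \<bar>s - s'\<bar>)"
        using assms(1) by (intro mult_left_mono) auto
      then show "m s - a * \<bar>s - s'\<bar> \<le> f u + a * \<bar>u - s'\<bar>"
        using le[of s u] by (simp add: algebra_simps)
    qed simp
    then show ?thesis by simp
  qed
  have "is_lipschitz_minorant a f m"
    unfolding is_lipschitz_minorant_def
  proof (intro conjI allI impI)
    show "a-lipschitz_on UNIV m"
    proof (rule lipschitz_onI)
      fix x y
      show "dist (m x) (m y) \<le> a * dist x y"
        using step[of x y] step[of y x] by (auto simp: dist_real_def abs_minus_commute)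
    qed (use assms in auto)
    show "m s \<le> f s" for s using le[of s s] by simp
    fix g s assume g: "a-lipschitz_on UNIV g \<and> (\<forall>t. g t \<le> f t)"
    show "g s \<le> m s"
      unfolding m_def
    proof (rule cINF_greatest)
      fix u
      have "dist (g s) (g u) \<le> a * dist s u" using g by (auto intro: lipschitz_onD)
      then show "g s \<le> f u + a * \<bar>u - s\<bar>"
        using g[THEN conjunct2, rule_format, of u]
        by (simp add: dist_real_def abs_minus_commute)
    qed simp
  qed
  moreover have "l \<le> m t"
    unfolding m_def using bnd by (intro cINF_greatest) (auto simp: algebra_simps)
  ultimately show ?thesis by blast
qed

text \<open>The Lipschitz property spreads the value of the minorant at a contact into a cone below
  \<open>f\<close>. Conversely such a cone lies below the minorant, which continuity keeps below the
  left limit as well.\<close>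

lemma contact_set_eq_touch_set:
  assumes "cadlag f" "a \<ge> 0"
  shows "contact_set a f = touch_set a f"
proof (intro equalityI subsetI)
  fix t assume "t \<in> contact_set a f"
  then obtain m where m: "is_lipschitz_minorant a f m" "m t = lower_value f t"
    by (auto simp: contact_set_def lower_value_def)
  have "lower_value f t \<le> f u + a * \<bar>u - t\<bar>" for u
  proof -
    have "dist (m t) (m u) \<le> a * dist t u"
      using m(1) unfolding is_lipschitz_minorant_def by (blast intro: lipschitz_onD)
    moreover have "m u \<le> f u" using m by (auto simp: is_lipschitz_minorant_def)
    ultimately show ?thesis using m(2) by (auto simp: dist_real_def abs_minus_commute)
  qed
  then show "t \<in> touch_set a f" by (simp add: touch_set_def)
next
  fix t assume t: "t \<in> touch_set a f"
  then obtain m where m: "is_lipschitz_minorant a f m" "lower_value f t \<le> m t"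
    using ex_lipschitz_minorant[OF assms(2), of "lower_value f t" t f]
    by (auto simp: touch_set_def algebra_simps)
  have le: "m s \<le> f s" for s using m by (auto simp: is_lipschitz_minorant_def)
  have "continuous_on UNIV m"
    using m by (auto simp: is_lipschitz_minorant_def intro: lipschitz_on_continuous_on)
  then have "(m \<longlongrightarrow> m t) (at_left t)"
    by (auto simp: continuous_on_eq_continuous_within continuous_within intro: tendsto_within_subset)
  then have "m t \<le> left_limit f t"
    by (intro tendsto_le[OF _ cadlag_tendsto_left[OF assms(1)]]) (use le in auto)
  then have "m t = lower_value f t" using m(2) le[of t] by (simp add: lower_value_def)
  then show "t \<in> contact_set a f" using m by (auto simp: contact_set_def lower_value_def)
qed

section \<open>Contacts of the skeleton on a grid\<close>

definition grid_contacts :: "real \<Rightarrow> (int \<Rightarrow> real) \<Rightarrow> int set" where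
  "grid_contacts b x = {k. \<forall>j. x k \<le> x j + b * \<bar>real_of_int (j - k)\<bar>}"

text \<open>One grid step has length \<open>h\<close>, so the slope per step is
  \<open>a * h\<close>.\<close>

definition grid_set :: "real \<Rightarrow> real \<Rightarrow> (real \<Rightarrow> real) \<Rightarrow> real set" where
  "grid_set a h f = (\<lambda>k. h * of_int k) ` grid_contacts (a * h) (\<lambda>k. f (h * of_int k))"

lemma grid_set_iff:
  assumes "h > 0"
  shows "h * of_int k \<in> grid_set a h f \<longleftrightarrow>
    (\<forall>j. f (h * of_int k) \<le> f (h * of_int j) + a * \<bar>h * of_int j - h * of_int k\<bar>)"
proof -
  have *: "a * h * \<bar>real_of_int (j - k)\<bar> = a * \<bar>h * of_int j - h * of_int k\<bar>" for j k
  proof -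
    have "\<bar>h * of_int j - h * of_int k\<bar> = h * \<bar>real_of_int (j - k)\<bar>"
      using assms by (simp add: abs_mult flip: right_diff_distrib)
    then show ?thesis by simp
  qed
  have "h * of_int k \<in> grid_set a h f \<longleftrightarrow> k \<in> grid_contacts (a * h) (\<lambda>k. f (h * of_int k))"
    using assms by (auto simp: grid_set_def)
  then show ?thesis by (simp only: grid_contacts_def mem_Collect_eq *)
qed

lemma eventually_at_right_0_le: "e > 0 \<Longrightarrow> \<forall>\<^sub>F h in at_right (0::real). 0 < h \<and> h \<le> e"
  by (rule eventually_at_rightI[of 0 e]) auto

lemma eventually_grid_right:
  assumes "cadlag f" "f u < e"
  shows "\<forall>\<^sub>F h in at_right 0. \<exists>k::int. u < h * of_int k \<and> h * of_int k \<le> u + h \<and> f (h * of_int k) < e"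
proof -
  have "\<forall>\<^sub>F v in at_right u. f v < e"
    using order_tendstoD(2)[OF cadlag_tendsto_right[OF assms(1)] assms(2)] .
  then obtain d where d: "d > u" "\<And>v. u < v \<Longrightarrow> v < d \<Longrightarrow> f v < e"
    by (auto simp: eventually_at_right[of u "u + 1"])
  have "\<forall>\<^sub>F h in at_right (0::real). 0 < h \<and> h \<le> (d - u) / 2"
    using d(1) by (intro eventually_at_right_0_le) simp
  then show ?thesis
  proof eventually_elim
    case (elim h)
    let ?k = "\<lfloor>u / h\<rfloor> + 1"
    have "u / h < of_int ?k" "of_int ?k \<le> u / h + 1" by linarith+
    then have k: "u < h * of_int ?k" "h * of_int ?k \<le> u + h"
      using elim by (auto simp: field_simps)
    have "h < d - u" using elim d(1) by auto
    then have "h * of_int ?k < d" using k by linarith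
    with k d(2) show ?case by blast
  qed
qed

lemma eventually_grid_left:
  assumes "cadlag f" "left_limit f u < e"
  shows "\<forall>\<^sub>F h in at_right 0. \<exists>k::int. u - h \<le> h * of_int k \<and> h * of_int k < u \<and> f (h * of_int k) < e"
proof -
  have "\<forall>\<^sub>F v in at_left u. f v < e"
    using order_tendstoD(2)[OF cadlag_tendsto_left[OF assms(1)] assms(2)] .
  then obtain d where d: "d < u" "\<And>v. d < v \<Longrightarrow> v < u \<Longrightarrow> f v < e"
    by (auto simp: eventually_at_left[of "u - 1" u])
  have "\<forall>\<^sub>F h in at_right (0::real). 0 < h \<and> h \<le> (u - d) / 2"
    using d(1) by (intro eventually_at_right_0_le) simp
  then show ?thesis
  proof eventually_elim
    case (elim h)
    \<comment> \<open>The last grid index strictly before \<open>u\<close>; at \<open>u\<close>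
      itself the left limit gives no information.\<close>
    define k where "k = \<lceil>u / h\<rceil> - 1"
    have "of_int k < u / h" "u / h \<le> of_int k + 1" unfolding k_def by linarith+
    then have k: "h * of_int k < u" "u - h \<le> h * of_int k"
      using elim by (auto simp: field_simps)
    have "h < u - d" using elim d(1) by auto
    then have "d < h * of_int k" using k by linarith
    with k d(2) show ?case by blast
  qed
qed

text \<open>The lower value is the value or the left limit, and each is approached along the grid
  from its own side.\<close>

lemma eventually_grid_near:
  assumes "cadlag f" "lower_value f u < e"
  shows "\<forall>\<^sub>F h in at_right 0. \<exists>k::int. \<bar>h * of_int k - u\<bar> \<le> h \<and> f (h * of_int k) < e"
proof (cases "f u < e")
  case True
  show ?thesis
    by (rule eventually_mono[OF eventually_grid_right[OF assms(1) True]]) (force simp: abs_if)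
next
  case False
  then have "left_limit f u < e" using assms(2) by (auto simp: lower_value_def)
  then show ?thesis
    by (intro eventually_mono[OF eventually_grid_left[OF assms(1)]]) (force simp: abs_if)+
qed

text \<open>The strictly larger slope makes the grid minimiser of \<open>v \<mapsto> f v + a' * \<bar>v - z\<bar>\<close>,
  which is a grid contact, close to \<open>z\<close> even when several contacts of \<open>f\<close> lie on one line.\<close>

lemma eventually_grid_set_near:
  assumes f: "cadlag f" and z: "z \<in> touch_set a f" and a: "0 \<le> a" "a < a'" and e: "e > 0"
  shows "\<forall>\<^sub>F h in at_right 0. \<exists>w\<in>grid_set a' h f. \<bar>w - z\<bar> < e"
proof -
  define l where "l = lower_value f z"
  have l: "l - a * \<bar>u - z\<bar> \<le> f u" for u
    using z by (auto simp: touch_set_def l_def algebra_simps)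
  \<comment> \<open>Outside the \<open>e\<close>-ball the excess slope makes \<open>v\<close> at
    least \<open>l + 2 * d\<close>. Inside, \<open>k0\<close> stays below that: one \<open>d\<close>
    pays for the value of \<open>f\<close>, the other for \<open>a' * h\<close>.\<close>
  define d where "d = (a' - a) * e / 2"
  have d: "d > 0" using a e by (simp add: d_def)
  have "\<forall>\<^sub>F h in at_right (0::real). 0 < h \<and> h \<le> min (e/2) (d / a')"
    using a e d by (intro eventually_at_right_0_le) auto
  moreover have "\<forall>\<^sub>F h in at_right 0. \<exists>k::int. \<bar>h * of_int k - z\<bar> \<le> h \<and> f (h * of_int k) < l + d"
    using d by (intro eventually_grid_near f) (simp add: l_def)
  ultimately show ?thesis
  proof eventually_elim
    case (elim h)
    then obtain k0 where k0: "\<bar>h * of_int k0 - z\<bar> \<le> h" "f (h * of_int k0) < l + d" by blast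
    define v where "v k = f (h * of_int k) + a' * \<bar>h * of_int k - z\<bar>" for k :: int
    define J where "J = {k::int. \<bar>h * of_int k - z\<bar> < e}"
    have "J \<subseteq> {\<lfloor>(z - e) / h\<rfloor>..\<lceil>(z + e) / h\<rceil>}"
    proof
      fix k assume "k \<in> J"
      then have "z - e < h * of_int k" "h * of_int k < z + e" by (auto simp: J_def)
      then have "(z - e) / h < of_int k" "of_int k < (z + e) / h"
        using elim by (auto simp: field_simps)
      then show "k \<in> {\<lfloor>(z - e) / h\<rfloor>..\<lceil>(z + e) / h\<rceil>}" by (simp; linarith)
    qed
    then have fin: "finite J" by (rule finite_subset) simp
    have k0J: "k0 \<in> J" using k0 elim e by (auto simp: J_def)
    obtain k where k: "k \<in> J" "\<And>j. j \<in> J \<Longrightarrow> v k \<le> v j"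
      using fin k0J by (metis arg_min_if_finite(1) arg_min_least empty_iff)
    have vk0: "v k0 < l + (a' - a) * e"
    proof -
      have "a' * \<bar>h * of_int k0 - z\<bar> \<le> a' * h" using a k0 by (intro mult_left_mono) auto
      also have "\<dots> \<le> d" using elim a by (auto simp: field_simps)
      finally show ?thesis using k0(2) by (simp add: v_def d_def)
    qed
    have "v k \<le> v j" for j
    proof (cases "j \<in> J")
      case False
      then have "(a' - a) * e \<le> (a' - a) * \<bar>h * of_int j - z\<bar>"
        using a by (intro mult_left_mono) (auto simp: J_def)
      also have "l + \<dots> \<le> v j" using l[of "h * of_int j"] by (simp add: v_def algebra_simps)
      finally have "v k0 \<le> v j" using vk0 by linarith
      with k(2)[OF k0J] show ?thesis by linarith
    qed (use k in auto)
    then have "f (h * of_int k) \<le> f (h * of_int j) + a' * \<bar>h * of_int j - h * of_int k\<bar>" for j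
    proof -
      \<comment> \<open>The triangle inequality moves the apex of the cone from \<open>z\<close> to
        the minimiser.\<close>
      have "a' * \<bar>h * of_int j - z\<bar> \<le> a' * (\<bar>h * of_int j - h * of_int k\<bar> + \<bar>h * of_int k - z\<bar>)"
        using a by (intro mult_left_mono) auto
      with \<open>\<And>j. v k \<le> v j\<close>[of j] show ?thesis by (simp add: v_def algebra_simps)
    qed
    then have "h * of_int k \<in> grid_set a' h f" using elim by (subst grid_set_iff) auto
    then show ?case using k(1) by (auto simp: J_def)
  qed
qed

text \<open>A strict violation of the cone at \<open>z\<close> by some \<open>u\<close> survives
  small changes of slope, of apex and of \<open>u\<close>. The radius and the slope bound
  \<open>b\<close> are fixed before \<open>a'\<close> and the mesh, because the mesh is refined for
  each slope separately.\<close>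

lemma eventually_grid_set_avoids:
  assumes f: "cadlag f" and z: "z \<notin> touch_set a f" and a: "0 \<le> a"
  shows "\<exists>b>a. \<exists>r>0. \<forall>a'. 0 \<le> a' \<and> a' \<le> b \<longrightarrow>
    (\<forall>\<^sub>F h in at_right 0. \<forall>w\<in>grid_set a' h f. r \<le> \<bar>w - z\<bar>)"
proof -
  obtain u where u: "f u + a * \<bar>u - z\<bar> < lower_value f z"
    using z by (auto simp: touch_set_def not_le)
  define D where "D = \<bar>u - z\<bar>"
  \<comment> \<open>The violation in quarters: one for the path near \<open>z\<close>, one for the
    grid value near \<open>u\<close>, one for the steeper slope and the displaced end points, one to
    spare.\<close>
  define e where "e = (lower_value f z - (f u + a * D)) / 4"
  have e: "e > 0" "lower_value f z = f u + a * D + 4 * e" using u by (auto simp: e_def D_def field_simps)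
  have "\<forall>\<^sub>F v in nhds z. lower_value f z - e < f v"
    using e by (intro eventually_gt_lower_value f) auto
  then obtain r1 where r1: "r1 > 0" "\<And>v. \<bar>v - z\<bar> < r1 \<Longrightarrow> lower_value f z - e < f v"
    by (auto simp: eventually_nhds_metric dist_real_def)
  \<comment> \<open>Since \<open>b \<le> a + 1\<close> by the \<open>min 1\<close> in its
    definition, \<open>b * r\<close> is at most a quarter of \<open>e\<close>. The added ones keep
    the denominators positive.\<close>
  define r where "r = min r1 (e / (4 * (a + 1)))"
  define b where "b = a + min 1 (e / (2 * (D + 1)))"
  have D: "D \<ge> 0" by (simp add: D_def)
  have r: "r > 0" "r \<le> r1" using r1 e a by (auto simp: r_def)
  have b: "b > a" using e D by (auto simp: b_def)
  have "b * (D + 2 * r) \<le> a * D + e"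
  proof -
    have "(b - a) * D \<le> (e / (2 * (D + 1))) * D"
      using D by (intro mult_right_mono) (auto simp: b_def)
    also have "\<dots> \<le> e / 2" using D e by (simp add: field_simps)
    finally have 1: "(b - a) * D \<le> e / 2" .
    have "b * r \<le> (a + 1) * (e / (4 * (a + 1)))"
      using a b r by (intro mult_mono) (auto simp: b_def r_def)
    also have "\<dots> = e / 4" using a by (simp add: field_simps)
    finally show ?thesis using 1 by (simp add: algebra_simps)
  qed
  note bD = this
  show ?thesis
  proof (rule exI[of _ b], rule conjI[OF b], rule exI[of _ r], rule conjI[OF r(1)], safe)
    fix a' assume a': "0 \<le> a'" "a' \<le> b"
    have "\<forall>\<^sub>F h in at_right (0::real). 0 < h \<and> h \<le> r"
      using r by (intro eventually_at_right_0_le) auto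
    moreover have "\<forall>\<^sub>F h in at_right 0. \<exists>k::int. u < h * of_int k \<and> h * of_int k \<le> u + h \<and> f (h * of_int k) < f u + e"
      using e by (intro eventually_grid_right f) auto
    ultimately show "\<forall>\<^sub>F h in at_right 0. \<forall>w\<in>grid_set a' h f. r \<le> \<bar>w - z\<bar>"
    proof eventually_elim
      case (elim h)
      then obtain k where k: "u < h * of_int k" "h * of_int k \<le> u + h" "f (h * of_int k) < f u + e"
        by blast
      show ?case
      proof (rule ccontr)
        assume "\<not> (\<forall>w\<in>grid_set a' h f. r \<le> \<bar>w - z\<bar>)"
        then obtain j where j: "h * of_int j \<in> grid_set a' h f" "\<bar>h * of_int j - z\<bar> < r"
          by (auto simp: grid_set_def not_le)
        let ?w = "h * real_of_int j" and ?v = "h * real_of_int k"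
        have "f ?w \<le> f ?v + a' * \<bar>?v - ?w\<bar>" using j(1) elim by (simp add: grid_set_iff)
        also have "a' * \<bar>?v - ?w\<bar> \<le> b * (D + 2 * r)"
          using a' k j elim by (intro mult_mono) (auto simp: D_def)
        finally have "f ?w < f u + e + (a * D + e)" using bD k(3) by linarith
        moreover have "lower_value f z - e < f ?w" using j(2) r by (intro r1) auto
        ultimately show False using e by linarith
      qed
    qed
  qed
qed

text \<open>The gap between \<open>a\<close> and \<open>b\<close> makes
  \<open>f u + b * \<bar>u\<bar>\<close> coercive, so a minimising sequence has a limit point; a
  minimiser is a contact by the triangle inequality.\<close>

lemma touch_set_nonempty:
  assumes f: "cadlag f" and ab: "0 \<le> a" "a < b" and bnd: "\<And>u. l \<le> f u + a * \<bar>u\<bar>"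
  shows "touch_set b f \<noteq> {}"
proof -
  define g where "g u = f u + b * \<bar>u\<bar>" for u
  have g: "l + (b - a) * \<bar>u\<bar> \<le> g u" for u using bnd[of u] by (simp add: g_def algebra_simps)
  have l: "l \<le> g u" for u
    using g[of u] ab mult_nonneg_nonneg[of "b - a" "\<bar>u\<bar>"] by linarith
  have bdd: "bdd_below (range g)" by (rule bdd_belowI2[OF l])
  define m where "m = Inf (range g)"
  have m: "m \<le> g u" for u unfolding m_def using bdd by (intro cInf_lower) auto
  have "\<exists>u. g u < m + 1 / Suc n" for n
  proof -
    have "Inf (range g) < m + 1 / Suc n" by (simp add: m_def)
    then show ?thesis using cInf_lessD by blast
  qed
  then obtain s where s: "g (s n) < m + 1 / Suc n" for n by metis
  have "bounded (range s)"
  proof (rule boundedI)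
    fix x assume "x \<in> range s"
    then obtain n where x: "x = s n" by auto
    have "1 / real (Suc n) \<le> 1" by simp
    then have "(b - a) * \<bar>s n\<bar> \<le> m + 1 - l" using s[of n] g[of "s n"] by linarith
    then show "norm x \<le> (m + 1 - l) / (b - a)" using ab x by (simp add: field_simps)
  qed
  then obtain z q where q: "strict_mono (q :: nat \<Rightarrow> nat)" "(s \<circ> q) \<longlonglongrightarrow> z"
    using bounded_imp_convergent_subsequence by blast
  \<comment> \<open>At a jump the infimum may not be attained by \<open>f\<close>, but it is
    attained by \<open>lower_value f\<close>.\<close>
  have "lower_value f z + b * \<bar>z\<bar> \<le> m"
  proof (rule ccontr)
    assume "\<not> lower_value f z + b * \<bar>z\<bar> \<le> m"
    define e where "e = (lower_value f z + b * \<bar>z\<bar> - m) / 3"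
    have e: "e > 0" "m + 3 * e = lower_value f z + b * \<bar>z\<bar>"
      using \<open>\<not> _\<close> by (auto simp: e_def field_simps)
    have "\<forall>\<^sub>F n in sequentially. lower_value f z - e < f ((s \<circ> q) n)"
      using eventually_compose_filterlim[OF eventually_gt_lower_value[OF f, of "lower_value f z - e" z] q(2)] e
      by simp
    moreover have "((\<lambda>n. b * \<bar>(s \<circ> q) n\<bar>) \<longlongrightarrow> b * \<bar>z\<bar>) sequentially"
      by (intro tendsto_intros q)
    then have "\<forall>\<^sub>F n in sequentially. b * \<bar>z\<bar> - e < b * \<bar>(s \<circ> q) n\<bar>"
      by (rule order_tendstoD) (use e in auto)
    moreover have "(\<lambda>n. 1 / real (Suc n)) \<longlonglongrightarrow> 0" by (rule LIMSEQ_Suc[OF lim_1_over_n])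
    then have "((\<lambda>n. 1 / real (Suc n)) \<circ> q) \<longlonglongrightarrow> 0"
      using q(1) by (rule LIMSEQ_subseq_LIMSEQ)
    then have "\<forall>\<^sub>F n in sequentially. ((\<lambda>n. 1 / real (Suc n)) \<circ> q) n < e"
      by (rule order_tendstoD) (use e in auto)
    ultimately have "\<forall>\<^sub>F n in sequentially. False"
    proof eventually_elim
      case (elim n)
      then show False using s[of "q n"] e by (auto simp: g_def)
    qed
    then show False by simp
  qed
  then have "z \<in> touch_set b f"
    unfolding touch_set_def
  proof (intro CollectI allI)
    fix u
    have "b * \<bar>u\<bar> \<le> b * (\<bar>u - z\<bar> + \<bar>z\<bar>)" using ab by (intro mult_left_mono) auto
    then show "lower_value f z \<le> f u + b * \<bar>u - z\<bar>"
      using m[of u] \<open>lower_value f z + b * \<bar>z\<bar> \<le> m\<close> by (simp add: g_def algebra_simps)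
  qed
  then show ?thesis by blast
qed

section \<open>Iterated limits and Fell convergence\<close>

text \<open>The Fubini product of two sequential filters: the threshold for \<open>n\<close> may
  depend on \<open>m\<close>, unlike in the product filter.\<close>

definition iterated_sequentially :: "(nat \<times> nat) filter" where
  "iterated_sequentially = Abs_filter (\<lambda>P. \<forall>\<^sub>F m in sequentially. \<forall>\<^sub>F n in sequentially. P (m, n))"

lemma eventually_iterated_sequentially:
  "eventually P iterated_sequentially \<longleftrightarrow>
    (\<forall>\<^sub>F m in sequentially. \<forall>\<^sub>F n in sequentially. P (m, n))"
  unfolding iterated_sequentially_def
proof (rule eventually_Abs_filter, rule is_filter.intro)
  fix P Q :: "nat \<times> nat \<Rightarrow> bool"
  assume "\<forall>\<^sub>F m in sequentially. \<forall>\<^sub>F n in sequentially. P (m, n)"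
    "\<forall>\<^sub>F m in sequentially. \<forall>\<^sub>F n in sequentially. Q (m, n)"
  then show "\<forall>\<^sub>F m in sequentially. \<forall>\<^sub>F n in sequentially. P (m, n) \<and> Q (m, n)"
    by eventually_elim (rule eventually_conj)
qed (auto elim!: eventually_mono)

lemma iterated_sequentially_neq_bot [simp]: "iterated_sequentially \<noteq> bot"
  by (simp add: trivial_limit_def eventually_iterated_sequentially)

lemma filterlim_fst_iterated: "filterlim fst sequentially iterated_sequentially"
  unfolding filterlim_iff eventually_iterated_sequentially
  by (auto simp: eventually_sequentially)

lemma filterlim_snd_iterated: "filterlim snd sequentially iterated_sequentially"
  unfolding filterlim_iff eventually_iterated_sequentially
  by (auto simp: eventually_sequentially)

lemma filterlim_inverse_Suc: "filterlim (\<lambda>n. 1 / real (Suc n)) (at_right 0) sequentially"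
  using LIMSEQ_Suc[OF lim_1_over_n[where 'a = real]] by (auto simp: filterlim_at)

text \<open>For families indexed by a general filter, dominated convergence fails; along an iterated
  sequential limit it can be applied twice.\<close>

lemma measurable_iterated_limit:
  fixes f :: "nat \<Rightarrow> nat \<Rightarrow> 'a \<Rightarrow> real"
  assumes [measurable]: "\<And>m n. f m n \<in> borel_measurable M"
    and lim: "\<And>w. w \<in> space M \<Longrightarrow> ((\<lambda>(m, n). f m n w) \<longlongrightarrow> g w) iterated_sequentially"
  shows "g \<in> borel_measurable M"
proof -
  \<comment> \<open>For fixed \<open>m\<close> the sequence in \<open>n\<close> need not converge,
    so its upper limit stands in for the inner limit.\<close>
  define u where "u m w = limsup (\<lambda>n. ereal (f m n w))" for m w
  have [measurable]: "u m \<in> borel_measurable M" for m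
    unfolding u_def by measurable
  have "(\<lambda>w. ereal (g w)) \<in> borel_measurable M"
  proof (rule borel_measurable_LIMSEQ_order)
    fix w assume w: "w \<in> space M"
    show "(\<lambda>m. u m w) \<longlonglongrightarrow> ereal (g w)"
    proof (rule order_tendstoI)
      fix a assume "a < ereal (g w)"
      then obtain r where r: "a < ereal r" "ereal r < ereal (g w)" using ereal_dense2 by blast
      then have "\<forall>\<^sub>F m in sequentially. \<forall>\<^sub>F n in sequentially. r < f m n w"
        using order_tendstoD(1)[OF lim[OF w], of r] by (simp add: eventually_iterated_sequentially)
      then show "\<forall>\<^sub>F m in sequentially. a < u m w"
      proof eventually_elim
        case (elim m)
        then have "\<forall>\<^sub>F n in sequentially. ereal r \<le> ereal (f m n w)" by (auto elim: eventually_mono)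
        then have "ereal r \<le> liminf (\<lambda>n. ereal (f m n w))" by (rule Liminf_bounded)
        also have "\<dots> \<le> u m w" unfolding u_def by (rule Liminf_le_Limsup) simp
        finally show ?case using r by simp
      qed
    next
      fix a assume "ereal (g w) < a"
      then obtain r where r: "ereal (g w) < ereal r" "ereal r < a" using ereal_dense2 by blast
      then have "\<forall>\<^sub>F m in sequentially. \<forall>\<^sub>F n in sequentially. f m n w < r"
        using order_tendstoD(2)[OF lim[OF w], of r] by (simp add: eventually_iterated_sequentially)
      then show "\<forall>\<^sub>F m in sequentially. u m w < a"
      proof eventually_elim
        case (elim m)
        then have "\<forall>\<^sub>F n in sequentially. ereal (f m n w) \<le> ereal r" by (auto elim: eventually_mono)
        then have "u m w \<le> ereal r" unfolding u_def by (rule Limsup_bounded)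
        then show ?case using r by simp
      qed
    qed
  qed measurable
  then show ?thesis by simp
qed

text \<open>The inner sequence need not converge. Reverse Fatou bounds the inner upper limit of the
  integrals of \<open>\<bar>f m n w - g w\<bar>\<close> by the integral of their upper limit, and
  dominated convergence in \<open>m\<close> sends the latter to 0.\<close>

lemma (in finite_measure) iterated_bounded_convergence:
  fixes f :: "nat \<Rightarrow> nat \<Rightarrow> 'a \<Rightarrow> real"
  assumes [measurable]: "\<And>m n. f m n \<in> borel_measurable M" "g \<in> borel_measurable M"
    and bnd: "\<And>m n w. w \<in> space M \<Longrightarrow> \<bar>f m n w\<bar> \<le> B" "\<And>w. w \<in> space M \<Longrightarrow> \<bar>g w\<bar> \<le> B"
    and lim: "AE w in M. ((\<lambda>(m, n). f m n w) \<longlongrightarrow> g w) iterated_sequentially"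
  shows "((\<lambda>(m, n). \<integral>w. f m n w \<partial>M) \<longlongrightarrow> (\<integral>w. g w \<partial>M)) iterated_sequentially"
proof -
  define d where "d m n w = ennreal \<bar>f m n w - g w\<bar>" for m n w
  have [measurable]: "d m n \<in> borel_measurable M" for m n unfolding d_def by measurable
  have dB: "d m n w \<le> ennreal (2 * B)" if "w \<in> space M" for m n w
    using bnd(1)[OF that, of m n] bnd(2)[OF that] unfolding d_def by (intro ennreal_leI) linarith
  have fin: "(\<integral>\<^sup>+ w. ennreal (2 * B) \<partial>M) < \<infinity>"
    by (simp add: ennreal_mult_eq_top_iff less_top[symmetric])
  define b where "b m w = limsup (\<lambda>n. d m n w)" for m w
  have [measurable]: "b m \<in> borel_measurable M" for m unfolding b_def by measurable
  have "(\<lambda>m. \<integral>\<^sup>+ w. b m w \<partial>M) \<longlonglongrightarrow> (\<integral>\<^sup>+ w. 0 \<partial>M)"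
  proof (rule nn_integral_dominated_convergence[OF _ _ _ _ fin])
    show "AE w in M. b m w \<le> ennreal (2 * B)" for m
      unfolding b_def by (intro AE_I2 Limsup_bounded always_eventually allI dB)
    show "AE w in M. (\<lambda>m. b m w) \<longlonglongrightarrow> 0"
      using lim
    proof eventually_elim
      case (elim w)
      show ?case
      proof (rule order_tendstoI)
        fix a :: ennreal assume "0 < a"
        then obtain x where x: "0 < x" "x < a" using dense by blast
        then obtain r where "x = ennreal r" by (cases x) auto
        with x have r: "ennreal r < a" "0 < r" by auto
        have "\<forall>\<^sub>F m in sequentially. \<forall>\<^sub>F n in sequentially. \<bar>f m n w - g w\<bar> < r"
          using tendstoD[OF elim r(2)] by (simp add: eventually_iterated_sequentially dist_real_def)
        then show "\<forall>\<^sub>F m in sequentially. b m w < a"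
        proof eventually_elim
          case (elim m)
          then have "b m w \<le> ennreal r"
            unfolding b_def d_def by (intro Limsup_bounded) (auto elim!: eventually_mono intro: ennreal_leI)
          then show ?case using r by simp
        qed
      qed simp
    qed
  qed auto
  then have B: "(\<lambda>m. \<integral>\<^sup>+ w. b m w \<partial>M) \<longlonglongrightarrow> 0" by simp
  have int: "integrable M (f m n)" "integrable M g" for m n
    by (rule integrable_const_bound[of _ B]; use bnd in auto)+
  show ?thesis
  proof (rule tendstoI)
    fix e :: real assume e: "e > 0"
    have "\<forall>\<^sub>F m in sequentially. (\<integral>\<^sup>+ w. b m w \<partial>M) < ennreal e"
      using order_tendstoD(2)[OF B] e by simp
    then have "\<forall>\<^sub>F m in sequentially. \<forall>\<^sub>F n in sequentially. dist (\<integral>w. f m n w \<partial>M) (\<integral>w. g w \<partial>M) < e"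
    proof eventually_elim
      case (elim m)
      have "limsup (\<lambda>n. \<integral>\<^sup>+ w. d m n w \<partial>M) \<le> (\<integral>\<^sup>+ w. b m w \<partial>M)"
        unfolding b_def by (rule nn_integral_limsup[OF _ _ _ fin]) (use dB in auto)
      then have "limsup (\<lambda>n. \<integral>\<^sup>+ w. d m n w \<partial>M) < ennreal e" using elim by simp
      then have "\<forall>\<^sub>F n in sequentially. (\<integral>\<^sup>+ w. d m n w \<partial>M) < ennreal e" by (rule Limsup_lessD)
      then show ?case
      proof eventually_elim
        case (elim n)
        have "dist (\<integral>w. f m n w \<partial>M) (\<integral>w. g w \<partial>M) = \<bar>\<integral>w. f m n w - g w \<partial>M\<bar>"
          using int by (simp add: dist_real_def)
        also have "\<dots> \<le> (\<integral>w. \<bar>f m n w - g w\<bar> \<partial>M)" by (rule integral_abs_bound)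
        also have "ennreal \<dots> = (\<integral>\<^sup>+ w. d m n w \<partial>M)"
          unfolding d_def using int by (intro nn_integral_eq_integral[symmetric]) auto
        finally have "ennreal (dist (\<integral>w. f m n w \<partial>M) (\<integral>w. g w \<partial>M)) \<le> (\<integral>\<^sup>+ w. d m n w \<partial>M)"
          by (simp add: ennreal_leI)
        also have "\<dots> < ennreal e" by fact
        finally show ?case using e by (simp add: ennreal_less_iff)
      qed
    qed
    then show "\<forall>\<^sub>F p in iterated_sequentially. dist (case p of (m, n) \<Rightarrow> \<integral>w. f m n w \<partial>M) (\<integral>w. g w \<partial>M) < e"
      by (simp add: eventually_iterated_sequentially)
  qed
qed

section \<open>Fell convergence\<close>

definition fell_tendsto :: "('i \<Rightarrow> real set) \<Rightarrow> real set \<Rightarrow> 'i filter \<Rightarrow> bool" where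
  "fell_tendsto S T F \<longleftrightarrow>
    (\<forall>U. open U \<longrightarrow> T \<inter> U \<noteq> {} \<longrightarrow> (\<forall>\<^sub>F i in F. S i \<inter> U \<noteq> {})) \<and>
    (\<forall>K. compact K \<longrightarrow> T \<inter> K = {} \<longrightarrow> (\<forall>\<^sub>F i in F. S i \<inter> K = {}))"

lemma fell_tendsto_hit: "fell_tendsto S T F \<Longrightarrow> open U \<Longrightarrow> T \<inter> U \<noteq> {} \<Longrightarrow> \<forall>\<^sub>F i in F. S i \<inter> U \<noteq> {}"
  by (auto simp: fell_tendsto_def)

lemma fell_tendsto_miss: "fell_tendsto S T F \<Longrightarrow> compact K \<Longrightarrow> T \<inter> K = {} \<Longrightarrow> \<forall>\<^sub>F i in F. S i \<inter> K = {}"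
  by (auto simp: fell_tendsto_def)

text \<open>Compactness turns pointwise exclusion into uniform exclusion: finitely many excluded
  balls cover \<open>K\<close>.\<close>

lemma fell_tendstoI_metric:
  assumes hit: "\<And>z e. z \<in> T \<Longrightarrow> e > 0 \<Longrightarrow> \<forall>\<^sub>F i in F. \<exists>w\<in>S i. \<bar>w - z\<bar> < e"
    and miss: "\<And>z. z \<notin> T \<Longrightarrow> \<exists>r>0. \<forall>\<^sub>F i in F. \<forall>w\<in>S i. r \<le> \<bar>w - z\<bar>"
  shows "fell_tendsto S T F"
  unfolding fell_tendsto_def
proof (intro conjI allI impI)
  fix U assume U: "open U" and "T \<inter> U \<noteq> {}"
  then obtain x where x: "x \<in> T" "x \<in> U" by blast
  obtain e where e: "e > 0" "ball x e \<subseteq> U" using U x(2) by (meson open_contains_ball)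
  show "\<forall>\<^sub>F i in F. S i \<inter> U \<noteq> {}"
    using hit[OF x(1) e(1)]
  proof eventually_elim
    case (elim i)
    then show ?case using e(2) by (force simp: dist_real_def)
  qed
next
  fix K :: "real set" assume K: "compact K" "T \<inter> K = {}"
  have "\<forall>z\<in>K. \<exists>r>0. \<forall>\<^sub>F i in F. \<forall>w\<in>S i. r \<le> \<bar>w - z\<bar>" using miss K(2) by blast
  then obtain r where r: "\<And>z. z \<in> K \<Longrightarrow> r z > 0"
    "\<And>z. z \<in> K \<Longrightarrow> \<forall>\<^sub>F i in F. \<forall>w\<in>S i. r z \<le> \<bar>w - z\<bar>" by metis
  have "K \<subseteq> (\<Union>z\<in>K. ball z (r z))" using r(1) by auto
  then obtain C where C: "C \<subseteq> K" "finite C" "K \<subseteq> (\<Union>z\<in>C. ball z (r z))"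
    by (rule compactE_image[OF K(1) open_ball])
  have "\<forall>\<^sub>F i in F. \<forall>z\<in>C. \<forall>w\<in>S i. r z \<le> \<bar>w - z\<bar>"
    using C r(2) by (intro eventually_ball_finite) auto
  then show "\<forall>\<^sub>F i in F. S i \<inter> K = {}"
  proof eventually_elim
    case (elim i)
    then show ?case using C(3) by (force simp: dist_real_def)
  qed
qed

text \<open>A hit is available for every \<open>m\<close>, but on a mesh that shrinks as the slope
  approaches \<open>a\<close>; a miss needs the slope to be below the bound belonging to the missed
  point. Hence the mesh limit is the inner one.\<close>

lemma fell_tendsto_grid_set:
  assumes f: "cadlag f" and a: "a \<ge> 0"
  shows "fell_tendsto (\<lambda>(m, n). grid_set (a + 1 / Suc m) (1 / Suc n) f) (touch_set a f) iterated_sequentially"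
proof (rule fell_tendstoI_metric)
  note h = filterlim_inverse_Suc
  {
    fix z e :: real assume z: "z \<in> touch_set a f" "e > 0"
    have "\<forall>\<^sub>F n in sequentially. \<exists>w\<in>grid_set (a + 1 / Suc m) (1 / Suc n) f. \<bar>w - z\<bar> < e" for m
      by (rule eventually_compose_filterlim[OF eventually_grid_set_near[OF f z(1) a _ z(2)] h]) simp
    then show "\<forall>\<^sub>F i in iterated_sequentially. \<exists>w\<in>case i of (m, n) \<Rightarrow> grid_set (a + 1 / Suc m) (1 / Suc n) f. \<bar>w - z\<bar> < e"
      by (simp add: eventually_iterated_sequentially)
  next
    fix z assume z: "z \<notin> touch_set a f"
    obtain b r where br: "b > a" "r > 0"
      "\<And>a'. 0 \<le> a' \<and> a' \<le> b \<Longrightarrow> (\<forall>\<^sub>F h in at_right 0. \<forall>w\<in>grid_set a' h f. r \<le> \<bar>w - z\<bar>)"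
      using eventually_grid_set_avoids[OF f z a] by blast
    have "\<forall>\<^sub>F m in sequentially. 1 / real (Suc m) < b - a"
      using order_tendstoD(2)[OF LIMSEQ_Suc[OF lim_1_over_n], of "b - a"] br(1) by simp
    then have "\<forall>\<^sub>F m in sequentially. \<forall>\<^sub>F n in sequentially. \<forall>w\<in>grid_set (a + 1 / Suc m) (1 / Suc n) f. r \<le> \<bar>w - z\<bar>"
    proof eventually_elim
      case (elim m)
      then have "0 \<le> a + 1 / Suc m \<and> a + 1 / Suc m \<le> b" using a by auto
      from eventually_compose_filterlim[OF br(3)[OF this] h] show ?case .
    qed
    then show "\<exists>r>0. \<forall>\<^sub>F i in iterated_sequentially. \<forall>w\<in>case i of (m, n) \<Rightarrow> grid_set (a + 1 / Suc m) (1 / Suc n) f. r \<le> \<bar>w - z\<bar>"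
      using br(2) by (auto simp: eventually_iterated_sequentially)
  }
qed

text \<open>A continuous substitute for the indicator that a closed set misses an open set; the indicator
  itself is not continuous in the Fell topology.\<close>

definition test_function :: "(real \<Rightarrow> real) \<Rightarrow> bool" where
  "test_function c \<longleftrightarrow> continuous_on UNIV c \<and> (\<forall>x. 0 \<le> c x \<and> c x \<le> 1) \<and> (\<exists>R. \<forall>x. R < \<bar>x\<bar> \<longrightarrow> c x = 1)"

text \<open>The inserted 1 only settles the empty set, since test functions are at most 1
  everywhere.\<close>

definition avoidance :: "(real \<Rightarrow> real) \<Rightarrow> real set \<Rightarrow> real" where
  "avoidance c S = Inf (insert 1 (c ` S))"

lemma avoidance_less_iff:
  assumes "test_function c"
  shows "avoidance c S < a \<longleftrightarrow> 1 < a \<or> (\<exists>s\<in>S. c s < a)"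
proof -
  have "bdd_below (insert 1 (c ` S))"
    using assms by (intro bdd_belowI[of _ 0]) (auto simp: test_function_def)
  then show ?thesis unfolding avoidance_def by (subst cInf_less_iff) auto
qed

lemma avoidance_le_1: "test_function c \<Longrightarrow> avoidance c S \<le> 1"
  unfolding avoidance_def
  by (rule cInf_lower) (auto intro!: bdd_belowI[of _ 0] simp: test_function_def)

lemma avoidance_nonneg: "test_function c \<Longrightarrow> 0 \<le> avoidance c S"
  unfolding avoidance_def by (intro cInf_greatest) (auto simp: test_function_def)

text \<open>Hitting an open sublevel set gives the upper estimate. Missing a closed sublevel set
  below level 1 gives the lower one; that set is compact because \<open>c\<close> equals 1 far
  out.\<close>

lemma tendsto_avoidance:
  assumes c: "test_function c" and ST: "fell_tendsto S T F"
  shows "((\<lambda>i. avoidance c (S i)) \<longlongrightarrow> avoidance c T) F"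
proof (rule order_tendstoI)
  have cont: "continuous_on UNIV c" using c by (simp add: test_function_def)
  fix a
  {
    assume "avoidance c T < a"
    then consider "1 < a" | "T \<inter> {s. c s < a} \<noteq> {}" using avoidance_less_iff[OF c] by blast
    then show "\<forall>\<^sub>F i in F. avoidance c (S i) < a"
    proof cases
      case 1 then show ?thesis using avoidance_less_iff[OF c] by simp
    next
      case 2
      have "open {s. c s < a}" using cont by (intro open_Collect_less) auto
      from fell_tendsto_hit[OF ST this 2] show ?thesis
        by eventually_elim (use avoidance_less_iff[OF c] in blast)
    qed
  next
    assume "a < avoidance c T"
    then obtain b where b: "a < b" "b < avoidance c T" using dense by blast
    then have nb: "\<not> avoidance c T < b" by simp
    have b1: "b < 1" using b avoidance_le_1[OF c, of T] by simp
    obtain R where R: "\<And>x. R < \<bar>x\<bar> \<Longrightarrow> c x = 1" using c by (auto simp: test_function_def)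
    \<comment> \<open>Two levels between \<open>a\<close> and the limit: \<open>T\<close> has no
      point with \<open>c\<close> below \<open>b\<close>, and missing \<open>K\<close> only makes
      the infimum at least \<open>a'\<close>.\<close>
    obtain a' where a': "a < a'" "a' < b" using dense[OF b(1)] by blast
    define K where "K = {s. c s \<le> a'}"
    have "closed K" unfolding K_def using cont by (intro closed_Collect_le) auto
    moreover have "bounded K"
      by (rule boundedI[of _ R]) (use R a' b1 in \<open>force simp: K_def not_less[symmetric]\<close>)
    ultimately have "compact K" by (simp add: compact_eq_bounded_closed)
    moreover have "T \<inter> K = {}" using nb a'(2) unfolding avoidance_less_iff[OF c] K_def by force
    ultimately have "\<forall>\<^sub>F i in F. S i \<inter> K = {}" by (rule fell_tendsto_miss[OF ST])
    then show "\<forall>\<^sub>F i in F. a < avoidance c (S i)"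
    proof eventually_elim
      case (elim i)
      then have "\<not> avoidance c (S i) < a'"
        using a' b1 unfolding avoidance_less_iff[OF c] K_def by force
      then show ?case using a'(1) by simp
    qed
  }
qed

section \<open>The sigma-algebra of closed sets\<close>

lemma closed_sets_generators_Pow:
  "{{S. closed S \<and> wait s S \<in> B} | s B. B \<in> sets borel} \<subseteq> Pow {S. closed S}"
  by auto

lemma space_closed_sets [simp]: "space closed_sets = {S. closed S}"
  unfolding closed_sets_def by (rule space_measure_of) auto

lemma sets_closed_sets:
  "sets closed_sets = sigma_sets {S. closed S} {{S. closed S \<and> wait s S \<in> B} | s B. B \<in> sets borel}"
  unfolding closed_sets_def by (rule sets_measure_of) auto

lemma next_point_less_iff: "next_point t S < e \<longleftrightarrow> (\<exists>s\<in>S. t < s \<and> ereal s < e)"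
  by (auto simp: next_point_def Inf_less_iff)

lemma wait_less_iff: "wait t S < e \<longleftrightarrow> (\<exists>s\<in>S. t < s \<and> ereal (s - t) < e)"
proof -
  have "wait t S < e \<longleftrightarrow> next_point t S < e + ereal t"
    unfolding wait_def by (intro ereal_minus_less) auto
  also have "\<dots> \<longleftrightarrow> (\<exists>s\<in>S. t < s \<and> ereal s < e + ereal t)"
    by (rule next_point_less_iff)
  also have "\<dots> \<longleftrightarrow> (\<exists>s\<in>S. t < s \<and> ereal (s - t) < e)"
    by (cases e) (auto simp: algebra_simps)
  finally show ?thesis .
qed

text \<open>Rational window lengths make the event a countable union of hitting events.\<close>

lemma wait_less_iff_rat:
  "wait t S < e \<longleftrightarrow> (\<exists>q\<in>{q\<in>\<rat>. 0 < q \<and> ereal q \<le> e}. S \<inter> {t<..<t + q} \<noteq> {})"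
proof
  assume "wait t S < e"
  then obtain s where s: "s \<in> S" "t < s" "ereal (s - t) < e" by (auto simp: wait_less_iff)
  obtain r where r: "s - t < r" "ereal r \<le> e"
    using s(3) by (cases e) (auto intro: that[of "s - t + 1"])
  obtain q where q: "q \<in> \<rat>" "s - t < q" "q < r" using Rats_dense_in_real[OF r(1)] by blast
  with r have "ereal q \<le> e" by (metis ereal_less_eq(3) less_imp_le order_trans)
  with q s show "\<exists>q\<in>{q\<in>\<rat>. 0 < q \<and> ereal q \<le> e}. S \<inter> {t<..<t + q} \<noteq> {}"
    by (intro bexI[of _ q]) auto
next
  assume "\<exists>q\<in>{q\<in>\<rat>. 0 < q \<and> ereal q \<le> e}. S \<inter> {t<..<t + q} \<noteq> {}"
  then obtain q s where "ereal q \<le> e" "s \<in> S" "t < s" "s < t + q" by auto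
  moreover have "ereal (s - t) < e"
    by (rule order_less_le_trans[of _ "ereal q"]) (use calculation in auto)
  ultimately show "wait t S < e" by (auto simp: wait_less_iff)
qed

lemma hit_interval_iff_wait:
  "a < b \<Longrightarrow> S \<inter> {a<..<b} \<noteq> {} \<longleftrightarrow> wait a S < ereal (b - a)"
  by (auto simp: wait_less_iff)

text \<open>By the rational windows, each waiting time is measurable as soon as the hits of open
  intervals are.\<close>

lemma measurable_closed_setsI:
  assumes cl: "\<And>w. w \<in> space M \<Longrightarrow> closed (f w)"
    and hit: "\<And>a b. a < b \<Longrightarrow> {w \<in> space M. f w \<inter> {a<..<b} \<noteq> {}} \<in> sets M"
  shows "f \<in> measurable M closed_sets"
  unfolding closed_sets_def
proof (rule measurable_measure_of[OF closed_sets_generators_Pow])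
  fix A assume "A \<in> {{S. closed S \<and> wait s S \<in> B} | s B. B \<in> sets borel}"
  then obtain s B where A: "A = {S. closed S \<and> wait s S \<in> B}" and B: "B \<in> sets borel" by auto
  have "(\<lambda>w. wait s (f w)) \<in> borel_measurable M"
    unfolding borel_measurable_ereal_iff_Iio
  proof
    fix e :: ereal
    have "(\<lambda>w. wait s (f w)) -` {..<e} \<inter> space M =
      (\<Union>q\<in>{q\<in>\<rat>. 0 < q \<and> ereal q \<le> e}. {w \<in> space M. f w \<inter> {s<..<s + q} \<noteq> {}})"
      unfolding vimage_def lessThan_iff wait_less_iff_rat by blast
    also have "\<dots> \<in> sets M"
      by (intro sets.countable_UN'') (auto intro: hit countable_subset[OF _ countable_rat])
    finally show "(\<lambda>w. wait s (f w)) -` {..<e} \<inter> space M \<in> sets M" .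
  qed
  from measurable_sets[OF this B] show "f -` A \<inter> space M \<in> sets M"
    using cl by (auto simp: A vimage_def Int_def conj_commute cong: conj_cong)
qed (use cl in auto)

lemma hit_interval_in_closed_sets: "{S. closed S \<and> S \<inter> {a<..<b} \<noteq> {}} \<in> sets closed_sets"
proof (cases "a < b")
  case True
  have "{S. closed S \<and> S \<inter> {a<..<b} \<noteq> {}} = {S. closed S \<and> wait a S \<in> {..<ereal (b - a)}}"
    using hit_interval_iff_wait[OF True] by auto
  also have "\<dots> \<in> sets closed_sets"
    unfolding sets_closed_sets
    by (intro sigma_sets.Basic CollectI exI[of _ a] exI[of _ "{..<ereal (b - a)}"]) auto
  finally show ?thesis .
qed auto

lemma hit_open_in_closed_sets:
  assumes "open U"
  shows "{S. closed S \<and> S \<inter> U \<noteq> {}} \<in> sets closed_sets"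
proof -
  obtain D where D: "countable D" "\<And>X. X \<in> D \<Longrightarrow> \<exists>a b. X = box a b" "\<Union>D = U"
    using open_countable_Union_open_box[OF assms] by metis
  have "{S. closed S \<and> S \<inter> U \<noteq> {}} = (\<Union>X\<in>D. {S. closed S \<and> S \<inter> X \<noteq> {}})"
    using D(3) by auto
  also have "\<dots> \<in> sets closed_sets"
  proof (rule sets.countable_UN''[OF D(1)])
    fix X assume "X \<in> D"
    then obtain a b where "X = {a<..<b}" using D(2)[OF \<open>X \<in> D\<close>] by (auto simp: box_real)
    then show "{S. closed S \<and> S \<inter> X \<noteq> {}} \<in> sets closed_sets"
      using hit_interval_in_closed_sets by simp
  qed
  finally show ?thesis .
qed

lemma miss_open_in_closed_sets:
  assumes "open U"
  shows "{S. closed S \<and> S \<inter> U = {}} \<in> sets closed_sets"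
proof -
  have "{S. closed S \<and> S \<inter> U = {}} = space closed_sets - {S. closed S \<and> S \<inter> U \<noteq> {}}" by auto
  also have "\<dots> \<in> sets closed_sets" by (rule sets.compl_sets[OF hit_open_in_closed_sets[OF assms]])
  finally show ?thesis .
qed

text \<open>Missing \<open>U\<close> and missing \<open>V\<close> is missing
  \<open>U \<union> V\<close>: unlike the waiting time events, these generators are stable under
  intersection, as uniqueness of measures requires.\<close>

lemma sets_closed_sets_miss:
  "sets closed_sets = sigma_sets {S. closed S} {{S. closed S \<and> S \<inter> U = {}} | U. open U \<and> bounded U}"
    (is "_ = sigma_sets _ ?E")
proof
  show "sigma_sets {S. closed S} ?E \<subseteq> sets closed_sets"
    using sets.sigma_sets_subset[of ?E closed_sets] miss_open_in_closed_sets by auto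
  have E: "?E \<subseteq> Pow {S. closed S}" by auto
  define N where "N = sigma {S. closed S} ?E"
  have N: "sets N = sigma_sets {S. closed S} ?E" "space N = {S. closed S}"
    unfolding N_def using E by (simp_all add: space_measure_of sets_measure_of)
  have "(\<lambda>S. S) \<in> measurable N closed_sets"
  proof (rule measurable_closed_setsI)
    fix a b :: real
    have "{S. closed S \<and> S \<inter> {a<..<b} = {}} \<in> sets N"
      unfolding N by (intro sigma_sets.Basic) auto
    then have "space N - {S. closed S \<and> S \<inter> {a<..<b} = {}} \<in> sets N" by (rule sets.compl_sets)
    also have "space N - {S. closed S \<and> S \<inter> {a<..<b} = {}} = {w \<in> space N. w \<inter> {a<..<b} \<noteq> {}}"
      by (auto simp: N)
    finally show "{w \<in> space N. w \<inter> {a<..<b} \<noteq> {}} \<in> sets N" .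
  qed (simp add: N)
  then have "(\<lambda>S. S) -` A \<inter> space N \<in> sets N" if "A \<in> sets closed_sets" for A
    using that by (rule measurable_sets)
  moreover have "A \<subseteq> {S. closed S}" if "A \<in> sets closed_sets" for A
    using sets.sets_into_space[OF that] by simp
  ultimately show "sets closed_sets \<subseteq> sigma_sets {S. closed S} ?E"
    by (auto simp: N vimage_def Int_absorb2)
qed

lemma open_test_less:
  assumes "test_function c"
  shows "open {s. c s < a}"
  using assms by (intro open_Collect_less) (auto simp: test_function_def)

lemma measurable_avoidance [measurable]:
  assumes "test_function c"
  shows "avoidance c \<in> borel_measurable closed_sets"
  unfolding borel_measurable_iff_less
proof
  fix a
  show "{S \<in> space closed_sets. avoidance c S < a} \<in> sets closed_sets"
  proof (cases "1 < a")
    case True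
    then have "{S \<in> space closed_sets. avoidance c S < a} = space closed_sets"
      using avoidance_less_iff[OF assms] by auto
    then show ?thesis using sets.top[of closed_sets] by simp
  next
    case False
    then have "{S \<in> space closed_sets. avoidance c S < a} = {S. closed S \<and> S \<inter> {s. c s < a} \<noteq> {}}"
      using avoidance_less_iff[OF assms] by auto
    then show ?thesis using hit_open_in_closed_sets[OF open_test_less[OF assms]] by simp
  qed
qed

lemma test_functions_separate_open:
  assumes U: "open U" "bounded U"
  obtains c where "\<And>k. test_function (c k)" and
    "\<And>S. (\<lambda>k. avoidance (c k) S) \<longlonglongrightarrow> (if S \<inter> U = {} then 1 else 0)"
proof -
  \<comment> \<open>The distance to an empty set is 0 by convention, which would spoil
    \<open>b0\<close>.\<close>
  have nU: "- U \<noteq> {}"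
  proof
    assume "- U = {}"
    then have "U = UNIV" by auto
    then show False using U(2) not_bounded_UNIV[where 'a = real] by simp
  qed
  define b where "b x = infdist x (- U)" for x
  have b0: "b x = 0 \<longleftrightarrow> x \<notin> U" for x
    using in_closed_iff_infdist_zero[of "- U" x] U nU by (auto simp: b_def)
  have bn: "b x \<ge> 0" for x by (simp add: b_def infdist_nonneg)
  \<comment> \<open>These functions decrease to the indicator of the complement of \<open>U\<close>
    as \<open>k\<close> grows.\<close>
  define c where "c k x = max 0 (1 - real k * b x)" for k :: nat and x
  obtain R where R: "\<And>x. x \<in> U \<Longrightarrow> \<bar>x\<bar> \<le> R" using U(2) by (auto simp: bounded_iff)
  have test: "test_function (c k)" for k
    unfolding test_function_def
  proof (intro conjI allI exI[of _ R] impI)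
    show "continuous_on UNIV (c k)"
      unfolding c_def b_def by (intro continuous_intros)
    show "c k x = 1" if "R < \<bar>x\<bar>" for x
      using R[of x] that b0[of x] by (force simp: c_def)
  qed (use bn in \<open>auto simp: c_def\<close>)
  have "(\<lambda>k. avoidance (c k) S) \<longlonglongrightarrow> (if S \<inter> U = {} then 1 else 0)" for S
  proof (cases "S \<inter> U = {}")
    case True
    then have "insert 1 (c k ` S) = {1}" for k using b0 by (force simp: c_def)
    then have "avoidance (c k) S = 1" for k
      by (simp only: avoidance_def cInf_singleton)
    then show ?thesis using True by simp
  next
    case False
    then obtain s where s: "s \<in> S" "s \<in> U" by blast
    then have bs: "b s > 0" using b0[of s] bn[of s] by linarith
    obtain k0 :: nat where k0: "1 / b s < k0" using reals_Archimedean2 by blast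
    have "avoidance (c k) S = 0" if "k \<ge> k0" for k
    proof -
      have "1 / b s \<le> real k" using k0 that by linarith
      then have "c k s = 0" using bs by (simp add: c_def field_simps)
      moreover have "avoidance (c k) S \<le> c k s"
        unfolding avoidance_def using s
        by (intro cInf_lower) (auto intro!: bdd_belowI[of _ 0] simp: c_def)
      ultimately show ?thesis using avoidance_nonneg[OF test, of k S] by simp
    qed
    then have "(\<lambda>k. avoidance (c k) S) \<longlonglongrightarrow> 0"
      by (intro tendsto_eventually) (auto simp: eventually_sequentially)
    then show ?thesis using False by simp
  qed
  with test show ?thesis by (rule that)
qed

text \<open>One test function at a time suffices: expected avoidances determine the measures of the
  missing events, and these form an intersection-stable generator.\<close>

lemma closed_sets_measure_eqI:
  assumes M: "finite_measure M" "sets M = sets closed_sets"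
    and N: "finite_measure N" "sets N = sets closed_sets"
    and eq: "\<And>c. test_function c \<Longrightarrow> (\<integral>S. avoidance c S \<partial>M) = (\<integral>S. avoidance c S \<partial>N)"
  shows "M = N"
proof (rule measure_eqI_generator_eq[where E = "{{S. closed S \<and> S \<inter> U = {}} | U. open U \<and> bounded U}"
      and \<Omega> = "{S. closed S}" and A = "\<lambda>_. {S. closed S}"])
  interpret M: finite_measure M by fact
  interpret N: finite_measure N by fact
  have spM: "space M = {S. closed S}" "space N = {S. closed S}"
    using sets_eq_imp_space_eq[OF M(2)] sets_eq_imp_space_eq[OF N(2)] by simp_all
  show "Int_stable {{S. closed S \<and> S \<inter> U = {}} | U :: real set. open U \<and> bounded U}"
  proof (rule Int_stableI, safe)
    fix U V :: "real set" assume "open U" "bounded U" "open V" "bounded V"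
    then show "\<exists>W. {S. closed S \<and> S \<inter> U = {}} \<inter> {S. closed S \<and> S \<inter> V = {}} = {S. closed S \<and> S \<inter> W = {}} \<and>
        open W \<and> bounded W"
      by (intro exI[of _ "U \<union> V"]) auto
  qed
  fix X assume "X \<in> {{S :: real set. closed S \<and> S \<inter> U = {}} | U. open U \<and> bounded U}"
  then obtain U where U: "open U" "bounded U" and X: "X = {S. closed S \<and> S \<inter> U = {}}" by auto
  obtain c where c: "\<And>k. test_function (c k)"
    "\<And>S. (\<lambda>k. avoidance (c k) S) \<longlonglongrightarrow> (if S \<inter> U = {} then 1 else 0)"
    using test_functions_separate_open[OF U] by blast
  have *: "(\<lambda>k. \<integral>S. avoidance (c k) S \<partial>L) \<longlonglongrightarrow> measure L X"
    if L: "finite_measure L" "sets L = sets closed_sets" for L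
  proof -
    interpret L: finite_measure L by fact
    have [measurable]: "avoidance (c k) \<in> borel_measurable L" for k
      using measurable_avoidance[OF c(1)] measurable_cong_sets[OF L(2) refl] by blast
    have [measurable]: "X \<in> sets L" using miss_open_in_closed_sets[OF U(1)] by (simp add: X L)
    have "(\<lambda>k. \<integral>S. avoidance (c k) S \<partial>L) \<longlonglongrightarrow> (\<integral>S. indicator X S \<partial>L)"
    proof (rule integral_dominated_convergence[where w = "\<lambda>_. 1"])
      have "indicator X S = (if S \<inter> U = {} then 1 else 0 :: real)" if "S \<in> space L" for S
        using that sets_eq_imp_space_eq[OF L(2)] by (simp add: X indicator_def)
      then show "AE S in L. (\<lambda>k. avoidance (c k) S) \<longlonglongrightarrow> indicator X S"
        using c(2) by (intro AE_I2) metis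
      show "AE S in L. norm (avoidance (c k) S) \<le> 1" for k
        using avoidance_le_1[OF c(1)] avoidance_nonneg[OF c(1)] by auto
    qed auto
    then show ?thesis by simp
  qed
  have "measure M X = measure N X"
    using LIMSEQ_unique[OF *[OF M]] *[OF N] eq[OF c(1)] by simp
  then show "emeasure M X = emeasure N X"
    by (simp add: M.emeasure_eq_measure N.emeasure_eq_measure)
next
  interpret M: finite_measure M by fact
  show "emeasure M {S. closed S} \<noteq> \<infinity>" by simp
  show "range (\<lambda>_. {S. closed S}) \<subseteq> {{S :: real set. closed S \<and> S \<inter> U = {}} | U. open U \<and> bounded U}"
    by (auto intro!: exI[of _ "{}"])
qed (auto simp: assms(2,4) sets_closed_sets_miss)

section \<open>Regeneration for grid contacts\<close>

locale iid_family = prob_space P for P :: "'a measure" +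
  fixes \<xi> :: "'i \<Rightarrow> 'a \<Rightarrow> real"
  assumes indep: "indep_vars (\<lambda>_. borel) \<xi> UNIV"
    and ident: "\<And>i j. distr P borel (\<xi> i) = distr P borel (\<xi> j)"
begin

lemma measurable_xi [measurable]: "\<xi> i \<in> borel_measurable P"
  using indep by (auto simp: indep_vars_def)

lemma measurable_family:
  "(\<lambda>w i. \<xi> (r i) w) \<in> measurable P (PiM UNIV (\<lambda>_. borel))"
  by (rule measurable_PiM_single') auto

lemma distr_family:
  "distr P (PiM UNIV (\<lambda>_. borel)) (\<lambda>w i. \<xi> i w) = PiM UNIV (\<lambda>_. distr P borel (\<xi> k))"
proof -
  have "distr P (PiM UNIV (\<lambda>_. borel)) (\<lambda>w i. \<xi> i w) = PiM UNIV (\<lambda>i. distr P borel (\<xi> i))"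
    using indep_vars_iff_distr_eq_PiM[where I = UNIV and M' = "\<lambda>_. borel" and X = \<xi>] indep by (simp add: restrict_UNIV)
  also have "(\<lambda>i. distr P borel (\<xi> i)) = (\<lambda>_. distr P borel (\<xi> k))" using ident by blast
  finally show ?thesis .
qed

text \<open>Both shift invariance and the passage to one-sided subfamilies come from here.\<close>

lemma distr_reindex:
  assumes r: "inj (r :: 'j \<Rightarrow> 'i)"
  shows "distr P (PiM UNIV (\<lambda>_. borel)) (\<lambda>w i. \<xi> (r i) w) = PiM UNIV (\<lambda>_. distr P borel (\<xi> k))"
proof -
  interpret mu: prob_space "distr P borel (\<xi> k)" by (rule prob_space_distr) simp
  interpret product_prob_space "\<lambda>_::'i. distr P borel (\<xi> k)" UNIV ..
  have [measurable]: "(\<lambda>x i. x (r i)) \<in> measurable (PiM UNIV (\<lambda>_::'i. borel)) (PiM UNIV (\<lambda>_::'j. borel :: real measure))"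
    by (rule measurable_PiM_single') auto
  have "distr P (PiM UNIV (\<lambda>_. borel)) (\<lambda>w i. \<xi> (r i) w) =
      distr (distr P (PiM UNIV (\<lambda>_. borel)) (\<lambda>w i. \<xi> i w)) (PiM UNIV (\<lambda>_. borel)) (\<lambda>x i. x (r i))"
    using measurable_family[of "\<lambda>i. i"] by (subst distr_distr) (auto simp: comp_def)
  also have "\<dots> = distr (PiM UNIV (\<lambda>_::'i. distr P borel (\<xi> k))) (PiM UNIV (\<lambda>_::'j. distr P borel (\<xi> k))) (\<lambda>x. \<lambda>n\<in>UNIV. x (r n))"
    unfolding distr_family[of k] by (intro distr_cong sets_PiM_cong) auto
  also have "\<dots> = PiM UNIV (\<lambda>_::'j. distr P borel (\<xi> k))"
    using r by (intro distr_PiM_reindex mu.prob_space_axioms) auto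
  finally show ?thesis .
qed

lemma nn_integral_reindex:
  fixes F :: "('j \<Rightarrow> real) \<Rightarrow> ennreal"
  assumes r: "inj r" "inj r'" and F: "F \<in> borel_measurable (PiM UNIV (\<lambda>_. borel))"
  shows "(\<integral>\<^sup>+w. F (\<lambda>i. \<xi> (r i) w) \<partial>P) = (\<integral>\<^sup>+w. F (\<lambda>i. \<xi> (r' i) w) \<partial>P)"
proof -
  have "(\<integral>\<^sup>+w. F (\<lambda>i. \<xi> (s i) w) \<partial>P) =
    (\<integral>\<^sup>+x. F x \<partial>distr P (PiM UNIV (\<lambda>_. borel)) (\<lambda>w i. \<xi> (s i) w))" for s
    using F by (subst nn_integral_distr[OF measurable_family]) auto
  then show ?thesis using distr_reindex[OF r(1)] distr_reindex[OF r(2)] by metis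
qed

lemma indep_coordinates:
  fixes F G :: "('i \<Rightarrow> real) \<Rightarrow> ennreal"
  assumes F: "F \<in> borel_measurable (PiM UNIV (\<lambda>_. borel))" "\<And>x y. (\<And>i. i \<in> A \<Longrightarrow> x i = y i) \<Longrightarrow> F x = F y"
    and G: "G \<in> borel_measurable (PiM UNIV (\<lambda>_. borel))" "\<And>x y. (\<And>i. i \<in> B \<Longrightarrow> x i = y i) \<Longrightarrow> G x = G y"
    and AB: "A \<inter> B = {}"
  shows "(\<integral>\<^sup>+w. F (\<lambda>i. \<xi> i w) * G (\<lambda>i. \<xi> i w) \<partial>P) =
    (\<integral>\<^sup>+w. F (\<lambda>i. \<xi> i w) \<partial>P) * (\<integral>\<^sup>+w. G (\<lambda>i. \<xi> i w) \<partial>P)"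
proof -
  \<comment> \<open>Filling with 0 outside \<open>C\<close> recovers the value of a function that
    only looks at \<open>C\<close> from the restriction to \<open>C\<close>.\<close>
  define ext where "ext C x i = (if i \<in> C then x i else 0 :: real)" for C and x :: "'i \<Rightarrow> real" and i
  have ext: "ext C \<in> measurable (PiM C (\<lambda>_. borel)) (PiM UNIV (\<lambda>_. borel))" for C
    unfolding ext_def
  proof (rule measurable_PiM_single')
    fix i show "(\<lambda>x. if i \<in> C then x i else 0) \<in> borel_measurable (PiM C (\<lambda>_. borel))"
      by (cases "i \<in> C") auto
  qed auto
  let ?X = "\<lambda>C w. restrict (\<lambda>i. \<xi> i w) C"
  have "indep_var borel ((F \<circ> ext A) \<circ> ?X A) borel ((G \<circ> ext B) \<circ> ?X B)"
    using AB by (intro indep_var_compose[OF indep_var_restrict[OF indep]] measurable_comp[OF ext] F G) auto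
  also have "(F \<circ> ext A) \<circ> ?X A = (\<lambda>w. F (\<lambda>i. \<xi> i w))"
    by (auto simp: fun_eq_iff ext_def intro!: F(2))
  also have "(G \<circ> ext B) \<circ> ?X B = (\<lambda>w. G (\<lambda>i. \<xi> i w))"
    by (auto simp: fun_eq_iff ext_def intro!: G(2))
  finally have "indep_vars (case_bool borel borel) (case_bool (\<lambda>w. F (\<lambda>i. \<xi> i w)) (\<lambda>w. G (\<lambda>i. \<xi> i w))) UNIV"
    by (simp add: indep_var_def)
  also have "case_bool borel borel = (\<lambda>_. borel :: ennreal measure)"
    by (auto simp: fun_eq_iff split: bool.split)
  finally have "(\<integral>\<^sup>+w. (\<Prod>b\<in>UNIV. case_bool (\<lambda>w. F (\<lambda>i. \<xi> i w)) (\<lambda>w. G (\<lambda>i. \<xi> i w)) b w) \<partial>P) =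
    (\<Prod>b\<in>UNIV. \<integral>\<^sup>+w. case_bool (\<lambda>w. F (\<lambda>i. \<xi> i w)) (\<lambda>w. G (\<lambda>i. \<xi> i w)) b w \<partial>P)"
    by (intro indep_vars_nn_integral) auto
  then show ?thesis by (simp add: UNIV_bool mult.commute)
qed

end

section \<open>Two-sided walks and decoupling at a contact\<close>

definition psum :: "(int \<Rightarrow> real) \<Rightarrow> int \<Rightarrow> real" where
  "psum x k = (\<Sum>i\<in>{0..<k}. x i) - (\<Sum>i\<in>{k..<0}. x i)"

lemma psum_0 [simp]: "psum x 0 = 0" by (simp add: psum_def)

lemma psum_step: "psum x (k + 1) = psum x k + x k"
proof (cases "0 \<le> k")
  case True
  then have "{0..<k + 1} = insert k {0..<k}" "{k + 1..<0} = {}" "{k..<0} = {}" by auto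
  then show ?thesis by (simp add: psum_def)
next
  case False
  then have "{k..<0} = insert k {k + 1..<0}" "{0..<k + 1} = {}" "{0..<k} = {}" by auto
  then show ?thesis by (simp add: psum_def)
qed

lemma psum_unique:
  assumes "y 0 = 0" "\<And>k. y (k + 1) = y k + x k"
  shows "y k = psum x k"
proof (induction k rule: int_induct[where k = 0])
  case (step2 i)
  show ?case using step2 assms(2)[of "i - 1"] psum_step[of x "i - 1"] by simp
qed (use assms psum_step in auto)

lemma psum_shift: "psum (\<lambda>i. x (i + k)) j = psum x (j + k) - psum x k"
proof (rule psum_unique[symmetric])
  show "psum x (j + 1 + k) - psum x k = psum x (j + k) - psum x k + x (j + k)" for j
    using psum_step[of x "j + k"] by (simp add: add_ac)
qed simp

lemma measurable_psum [measurable]: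
  "(\<lambda>x. psum x k) \<in> borel_measurable (PiM UNIV (\<lambda>_. borel))"
  unfolding psum_def by measurable

lemma pred_psum_le [measurable]:
  "Measurable.pred (PiM UNIV (\<lambda>_. borel)) (\<lambda>x. psum x j \<le> psum x i + c)"
  unfolding pred_def by (intro borel_measurable_le borel_measurable_add measurable_psum borel_measurable_const)

definition past_contacts :: "real \<Rightarrow> (int \<Rightarrow> real) \<Rightarrow> int set" where
  "past_contacts b y = {j. j \<le> 0 \<and> (\<forall>i\<le>0. y j \<le> y i + b * \<bar>real_of_int (i - j)\<bar>)}"

definition future_contacts :: "real \<Rightarrow> (int \<Rightarrow> real) \<Rightarrow> int set" where
  "future_contacts b y = {j. 0 \<le> j \<and> (\<forall>i\<ge>0. y j \<le> y i + b * \<bar>real_of_int (i - j)\<bar>)}"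

text \<open>At a contact the two cones merge: the cone through any other contact on one side lies below
  the cone at the origin on the other side, so past and future contacts decouple.\<close>

lemma grid_contacts_split:
  assumes "0 \<in> past_contacts b y" "0 \<in> future_contacts b y"
  shows "grid_contacts b y = past_contacts b y \<union> future_contacts b y"
proof (intro equalityI subsetI)
  fix j assume "j \<in> grid_contacts b y"
  then show "j \<in> past_contacts b y \<union> future_contacts b y"
    by (cases "j \<le> 0") (auto simp: grid_contacts_def past_contacts_def future_contacts_def)
next
  fix j assume j: "j \<in> past_contacts b y \<union> future_contacts b y"
  have "y j \<le> y i + b * \<bar>real_of_int (i - j)\<bar>" for i
  proof (cases "j \<in> past_contacts b y")
    case True
    show ?thesis
    proof (cases "i \<le> 0")
      case False
      then have "y j \<le> y 0 + b * real_of_int (- j)" "y 0 \<le> y i + b * real_of_int i" "j \<le> 0"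
        using True assms(2) by (force simp: past_contacts_def future_contacts_def)+
      moreover have "b * real_of_int (- j) + b * real_of_int i = b * \<bar>real_of_int (i - j)\<bar>"
        using False \<open>j \<le> 0\<close> by (simp add: algebra_simps)
      ultimately show ?thesis by linarith
    qed (use True in \<open>auto simp: past_contacts_def\<close>)
  next
    case False
    then have J: "j \<in> future_contacts b y" using j by blast
    show ?thesis
    proof (cases "i \<ge> 0")
      case False
      then have "y j \<le> y 0 + b * real_of_int j" "y 0 \<le> y i + b * real_of_int (- i)" "0 \<le> j"
        using J assms(1) by (force simp: past_contacts_def future_contacts_def)+
      moreover have "b * real_of_int j + b * real_of_int (- i) = b * \<bar>real_of_int (i - j)\<bar>"
        using False \<open>0 \<le> j\<close> by (simp add: algebra_simps)
      ultimately show ?thesis by linarith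
    qed (use J in \<open>auto simp: future_contacts_def\<close>)
  qed
  then show "j \<in> grid_contacts b y" by (simp add: grid_contacts_def)
qed

lemma zero_in_grid_contacts_iff:
  "0 \<in> grid_contacts b y \<longleftrightarrow> 0 \<in> past_contacts b y \<and> 0 \<in> future_contacts b y"
  unfolding grid_contacts_def past_contacts_def future_contacts_def mem_Collect_eq
  using linear[of "0 :: int"] by blast

lemma grid_contacts_shift:
  "j \<in> grid_contacts b (\<lambda>i. x (i + k) - x k) \<longleftrightarrow> j + k \<in> grid_contacts b x"
proof
  assume L: "j \<in> grid_contacts b (\<lambda>i. x (i + k) - x k)"
  have "x (j + k) \<le> x i + b * \<bar>real_of_int (i - (j + k))\<bar>" for i
    using L[unfolded grid_contacts_def, simplified, rule_format, of "i - k"] by (simp add: algebra_simps)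
  then show "j + k \<in> grid_contacts b x" by (simp add: grid_contacts_def)
next
  assume R: "j + k \<in> grid_contacts b x"
  have "x (j + k) \<le> x (i + k) + b * \<bar>real_of_int (i - j)\<bar>" for i
    using R[unfolded grid_contacts_def, simplified, rule_format, of "i + k"] by simp
  then show "j \<in> grid_contacts b (\<lambda>i. x (i + k) - x k)" by (simp add: grid_contacts_def)
qed

lemma pred_grid_contacts_psum:
  "Measurable.pred (PiM UNIV (\<lambda>_. borel)) (\<lambda>x. k \<in> grid_contacts b (psum x))"
  unfolding grid_contacts_def mem_Collect_eq by measurable

section \<open>Decomposition at the first contact\<close>

definition first_contact :: "int \<Rightarrow> int set \<Rightarrow> int \<Rightarrow> bool" where
  "first_contact k0 K k \<longleftrightarrow> k0 \<le> k \<and> k \<in> K \<and> (\<forall>j\<in>K. k0 \<le> j \<longrightarrow> k \<le> j)"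

lemma ex_first_contact:
  assumes "k \<in> K" "k0 \<le> k"
  shows "\<exists>k. first_contact k0 K k"
proof -
  define n where "n = (LEAST n. k0 + int n \<in> K)"
  have "k0 + int (nat (k - k0)) \<in> K" using assms by simp
  then have n: "k0 + int n \<in> K" unfolding n_def by (rule LeastI)
  have "k0 + int n \<le> j" if "j \<in> K" "k0 \<le> j" for j
  proof -
    have "k0 + int (nat (j - k0)) \<in> K" using that by simp
    then have "n \<le> nat (j - k0)" unfolding n_def by (rule Least_le)
    then show ?thesis using that by linarith
  qed
  with n show ?thesis by (intro exI[of _ "k0 + int n"]) (auto simp: first_contact_def)
qed

text \<open>At most one summand differs from 0; the series form lets expectations be taken term by
  term. The past keeps its absolute position, the future is recentred at the contact, and the value
  without a contact is 0.\<close>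

definition split_at_first :: "int \<Rightarrow> (int set \<Rightarrow> ennreal) \<Rightarrow> (int set \<Rightarrow> ennreal) \<Rightarrow> int set \<Rightarrow> ennreal" where
  "split_at_first k0 f g K = (\<Sum>i. if first_contact k0 K (k0 + int i)
     then f {j\<in>K. j \<le> k0 + int i} * g {j. 0 \<le> j \<and> j + (k0 + int i) \<in> K} else 0)"

lemma split_at_first_eq:
  assumes "first_contact k0 K k"
  shows "split_at_first k0 f g K = f {j\<in>K. j \<le> k} * g {j. 0 \<le> j \<and> j + k \<in> K}"
proof -
  have k: "k = k0 + int (nat (k - k0))" using assms by (simp add: first_contact_def)
  have unique: "i = nat (k - k0)" if "first_contact k0 K (k0 + int i)" for i
    using that assms by (force simp: first_contact_def)
  have "split_at_first k0 f g K = (\<Sum>i\<in>{nat (k - k0)}. if first_contact k0 K (k0 + int i)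
     then f {j\<in>K. j \<le> k0 + int i} * g {j. 0 \<le> j \<and> j + (k0 + int i) \<in> K} else 0)"
    unfolding split_at_first_def by (rule suminf_finite) (use unique in auto)
  then show ?thesis using assms k by simp
qed

lemma split_at_first_none: "(\<And>k. \<not> first_contact k0 K k) \<Longrightarrow> split_at_first k0 f g K = 0"
  by (simp add: split_at_first_def)

text \<open>Sets of integers are identified with their indicator families, which carry a product
  sigma-algebra.\<close>

definition int_set_measurable :: "(int set \<Rightarrow> ennreal) \<Rightarrow> bool" where
  "int_set_measurable f \<longleftrightarrow>
    (\<lambda>p. f {j. p j}) \<in> borel_measurable (PiM (UNIV :: int set) (\<lambda>_. count_space (UNIV :: bool set)))"

lemma int_set_measurableD:
  assumes "int_set_measurable f" "\<And>j. Measurable.pred M (\<lambda>w. j \<in> S w)"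
  shows "(\<lambda>w. f (S w)) \<in> borel_measurable M"
proof -
  have "(\<lambda>w j. j \<in> S w) \<in> measurable M (PiM (UNIV :: int set) (\<lambda>_. count_space (UNIV :: bool set)))"
    by (rule measurable_PiM_single') (use assms(2) in auto)
  from measurable_compose[OF this assms(1)[unfolded int_set_measurable_def]] show ?thesis by simp
qed

lemma int_set_measurable_const: "int_set_measurable (\<lambda>_. c)"
  by (simp add: int_set_measurable_def)

context
  fixes b :: real
begin

text \<open>Everything is seen from the candidate contact \<open>k = k0 + i\<close>, placed at 0.
  The absence of contacts in \<open>[k0, k)\<close> becomes the absence of past contacts in
  \<open>[-i, 0)\<close>, so being first is decided by the past alone.\<close>

definition past_factor :: "nat \<Rightarrow> int \<Rightarrow> (int set \<Rightarrow> ennreal) \<Rightarrow> (int \<Rightarrow> real) \<Rightarrow> ennreal" where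
  "past_factor i k f x =
    (if 0 \<in> past_contacts b (psum x) \<and> (\<forall>j\<in>past_contacts b (psum x). j < 0 \<longrightarrow> j < - int i)
     then f {j. j - k \<in> past_contacts b (psum x)} else 0)"

definition future_factor :: "(int set \<Rightarrow> ennreal) \<Rightarrow> (int \<Rightarrow> real) \<Rightarrow> ennreal" where
  "future_factor g x = (if 0 \<in> future_contacts b (psum x) then g (future_contacts b (psum x)) else 0)"

lemma pred_past_contacts [measurable]:
  "Measurable.pred (PiM UNIV (\<lambda>_. borel)) (\<lambda>x. j \<in> past_contacts b (psum x))"
  unfolding past_contacts_def mem_Collect_eq by measurable

lemma pred_future_contacts [measurable]:
  "Measurable.pred (PiM UNIV (\<lambda>_. borel)) (\<lambda>x. j \<in> future_contacts b (psum x))"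
  unfolding future_contacts_def mem_Collect_eq by measurable

lemma measurable_past_factor:
  assumes "int_set_measurable f"
  shows "past_factor i k f \<in> borel_measurable (PiM UNIV (\<lambda>_. borel))"
proof -
  have [measurable]: "(\<lambda>x. f {j. j - k \<in> past_contacts b (psum x)}) \<in> borel_measurable (PiM UNIV (\<lambda>_. borel))"
    by (rule int_set_measurableD[OF assms]) simp
  have "past_factor i k f = (\<lambda>x. if 0 \<in> past_contacts b (psum x) \<and>
      (\<forall>j. j \<in> past_contacts b (psum x) \<longrightarrow> j < 0 \<longrightarrow> j < - int i)
     then f {j. j - k \<in> past_contacts b (psum x)} else 0)"
    by (auto simp: past_factor_def fun_eq_iff)
  also have "\<dots> \<in> borel_measurable (PiM UNIV (\<lambda>_. borel))" by measurable
  finally show ?thesis .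
qed

lemma measurable_future_factor:
  assumes "int_set_measurable g"
  shows "future_factor g \<in> borel_measurable (PiM UNIV (\<lambda>_. borel))"
proof -
  have [measurable]: "(\<lambda>x. g (future_contacts b (psum x))) \<in> borel_measurable (PiM UNIV (\<lambda>_. borel))"
    by (rule int_set_measurableD[OF assms]) simp
  show ?thesis unfolding future_factor_def[abs_def] by measurable
qed

lemma past_contacts_cong:
  assumes "\<And>i. i < 0 \<Longrightarrow> x i = x' i"
  shows "past_contacts b (psum x) = past_contacts b (psum x')"
proof -
  have "psum x j = psum x' j" if "j \<le> 0" for j using that assms by (auto simp: psum_def)
  then show ?thesis by (auto simp: past_contacts_def)
qed

lemma future_contacts_cong:
  assumes "\<And>i. i \<ge> 0 \<Longrightarrow> x i = x' i"
  shows "future_contacts b (psum x) = future_contacts b (psum x')"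
proof -
  have "psum x j = psum x' j" if "j \<ge> 0" for j using that assms by (auto simp: psum_def)
  then show ?thesis by (auto simp: future_contacts_def)
qed

text \<open>Being a contact splits into a past and a future condition. Being the first one is a past
  condition, because at a contact the past contacts are exactly the contacts up to
  \<open>k\<close>.\<close>

lemma split_term_eq_factors:
  assumes "k = k0 + int i"
  shows "(if first_contact k0 (grid_contacts b (psum x)) k
     then f {j\<in>grid_contacts b (psum x). j \<le> k} * g {j. 0 \<le> j \<and> j + k \<in> grid_contacts b (psum x)} else 0) =
    past_factor i k f (\<lambda>i. x (i + k)) * future_factor g (\<lambda>i. x (i + k))"
proof -
  let ?y = "psum (\<lambda>i. x (i + k))" and ?K = "grid_contacts b (psum x)"
  have K: "j + k \<in> ?K \<longleftrightarrow> j \<in> grid_contacts b ?y" for j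
    unfolding psum_shift by (rule grid_contacts_shift[symmetric])
  have K': "j \<in> ?K \<longleftrightarrow> j - k \<in> grid_contacts b ?y" for j using K[of "j - k"] by simp
  show ?thesis
  proof (cases "k \<in> ?K")
    case False
    then have "\<not> (0 \<in> past_contacts b ?y \<and> 0 \<in> future_contacts b ?y)"
      using K[of 0] zero_in_grid_contacts_iff by simp
    then show ?thesis using False by (auto simp: first_contact_def past_factor_def future_factor_def)
  next
    case True
    then have 0: "0 \<in> past_contacts b ?y" "0 \<in> future_contacts b ?y"
      using K[of 0] zero_in_grid_contacts_iff by auto
    note split = grid_contacts_split[OF 0]
    have le: "j \<le> 0" if "j \<in> past_contacts b ?y" for j using that by (simp add: past_contacts_def)
    have ge: "j \<ge> 0" if "j \<in> future_contacts b ?y" for j using that by (simp add: future_contacts_def)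
    have past: "{j\<in>?K. j \<le> k} = {j. j - k \<in> past_contacts b ?y}"
    proof (intro set_eqI iffI; clarsimp)
      fix j assume "j \<in> ?K" "j \<le> k"
      then show "j - k \<in> past_contacts b ?y"
        using K'[of j] split ge[of "j - k"] 0 by (cases "j = k") auto
    next
      fix j assume "j - k \<in> past_contacts b ?y"
      then show "j \<in> ?K \<and> j \<le> k" using K'[of j] split le[of "j - k"] by auto
    qed
    have future: "{j. 0 \<le> j \<and> j + k \<in> ?K} = future_contacts b ?y"
    proof (intro set_eqI iffI; clarsimp)
      fix j assume "j + k \<in> ?K" "0 \<le> j"
      then show "j \<in> future_contacts b ?y"
        using K[of j] split le[of j] 0 by (cases "j = 0") auto
    next
      fix j assume "j \<in> future_contacts b ?y"
      then show "0 \<le> j \<and> j + k \<in> ?K" using K[of j] split ge[of j] by auto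
    qed
    have "first_contact k0 ?K k \<longleftrightarrow> (\<forall>j\<in>past_contacts b ?y. j < 0 \<longrightarrow> j < - int i)"
    proof
      assume L: "first_contact k0 ?K k"
      show "\<forall>j\<in>past_contacts b ?y. j < 0 \<longrightarrow> j < - int i"
      proof (intro ballI impI)
        fix j assume "j \<in> past_contacts b ?y" "j < 0"
        then have "j + k \<in> ?K" using K split by blast
        moreover have "\<not> k \<le> j + k" using \<open>j < 0\<close> by simp
        ultimately have "\<not> k0 \<le> j + k" using L unfolding first_contact_def by blast
        then show "j < - int i" using assms by linarith
      qed
    next
      assume R: "\<forall>j\<in>past_contacts b ?y. j < 0 \<longrightarrow> j < - int i"
      have "k \<le> j" if "j \<in> ?K" "k0 \<le> j" for j
      proof (rule ccontr)
        assume "\<not> k \<le> j"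
        then have "j \<in> {j\<in>?K. j \<le> k}" using that(1) by simp
        then have "j - k \<in> past_contacts b ?y" unfolding past by simp
        then have "j - k < - int i" using R \<open>\<not> k \<le> j\<close> by auto
        then show False using that(2) assms by linarith
      qed
      then show "first_contact k0 ?K k" using True assms by (auto simp: first_contact_def)
    qed
    then show ?thesis
      using 0 by (simp only: past future past_factor_def future_factor_def) auto
  qed
qed

end

lemma nn_integral_split_at_first:
  fixes \<xi> :: "int \<Rightarrow> 'a \<Rightarrow> real"
  assumes "iid_family P \<xi>" "int_set_measurable f" "int_set_measurable g"
  shows "(\<integral>\<^sup>+w. split_at_first k0 f g (grid_contacts b (psum (\<lambda>i. \<xi> i w))) \<partial>P) =
    (\<Sum>i. \<integral>\<^sup>+w. past_factor b i (k0 + int i) f (\<lambda>i. \<xi> i w) \<partial>P) *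
    (\<integral>\<^sup>+w. future_factor b g (\<lambda>i. \<xi> i w) \<partial>P)"
proof -
  interpret I: iid_family P \<xi> by fact
  note [measurable] = measurable_past_factor[OF assms(2)] measurable_future_factor[OF assms(3)]
  have [measurable]: "(\<lambda>w i. \<xi> (r i) w) \<in> measurable P (PiM UNIV (\<lambda>_. borel))" for r :: "int \<Rightarrow> int"
    by (rule I.measurable_family)
  have "(\<integral>\<^sup>+w. split_at_first k0 f g (grid_contacts b (psum (\<lambda>i. \<xi> i w))) \<partial>P) =
    (\<integral>\<^sup>+w. (\<Sum>i. past_factor b i (k0 + int i) f (\<lambda>j. \<xi> (j + (k0 + int i)) w) *
      future_factor b g (\<lambda>j. \<xi> (j + (k0 + int i)) w)) \<partial>P)"
    unfolding split_at_first_def by (simp only: split_term_eq_factors[OF refl])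
  also have "\<dots> = (\<Sum>i. \<integral>\<^sup>+w. past_factor b i (k0 + int i) f (\<lambda>j. \<xi> (j + (k0 + int i)) w) *
      future_factor b g (\<lambda>j. \<xi> (j + (k0 + int i)) w) \<partial>P)"
    by (rule nn_integral_suminf) measurable
  \<comment> \<open>Shift invariance moves the candidate contact to 0, after which the future factor
    no longer depends on \<open>i\<close>.\<close>
  also have "\<dots> = (\<Sum>i. \<integral>\<^sup>+w. past_factor b i (k0 + int i) f (\<lambda>j. \<xi> j w) * future_factor b g (\<lambda>j. \<xi> j w) \<partial>P)"
  proof (rule suminf_cong)
    fix i
    show "(\<integral>\<^sup>+w. past_factor b i (k0 + int i) f (\<lambda>j. \<xi> (j + (k0 + int i)) w) *
        future_factor b g (\<lambda>j. \<xi> (j + (k0 + int i)) w) \<partial>P) =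
      (\<integral>\<^sup>+w. past_factor b i (k0 + int i) f (\<lambda>j. \<xi> j w) * future_factor b g (\<lambda>j. \<xi> j w) \<partial>P)"
      by (rule I.nn_integral_reindex[where F = "\<lambda>x. past_factor b i (k0 + int i) f x * future_factor b g x"])
        (auto simp: inj_def)
  qed
  also have "\<dots> = (\<Sum>i. (\<integral>\<^sup>+w. past_factor b i (k0 + int i) f (\<lambda>j. \<xi> j w) \<partial>P) *
      (\<integral>\<^sup>+w. future_factor b g (\<lambda>j. \<xi> j w) \<partial>P))"
  \<comment> \<open>Increment \<open>i\<close> leads from position \<open>i\<close> to
    \<open>i + 1\<close>, so negative indices form the past of 0 and index 0 belongs to the
    future.\<close>
  proof (rule suminf_cong, rule I.indep_coordinates[where A = "{..<0}" and B = "{0..}"])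
    show "past_factor b i (k0 + int i) f x = past_factor b i (k0 + int i) f y"
      if "\<And>i. i \<in> {..<0} \<Longrightarrow> x i = y i" for i x y
    proof -
      have "past_contacts b (psum x) = past_contacts b (psum y)"
        by (rule past_contacts_cong) (use that in auto)
      then show ?thesis by (simp only: past_factor_def)
    qed
    show "future_factor b g x = future_factor b g y" if "\<And>i. i \<in> {0..} \<Longrightarrow> x i = y i" for x y
      using future_contacts_cong[of x y] that by (simp add: future_factor_def)
  qed auto
  also have "\<dots> = (\<Sum>i. \<integral>\<^sup>+w. past_factor b i (k0 + int i) f (\<lambda>i. \<xi> i w) \<partial>P) *
    (\<integral>\<^sup>+w. future_factor b g (\<lambda>i. \<xi> i w) \<partial>P)"
    by (rule ennreal_suminf_multc)
  finally show ?thesis .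
qed

text \<open>Stated without dividing by the probability that a contact exists.  Besides the independence of past
  and future, the two starting points \<open>k\<close> and \<open>k'\<close> say that the law of the future does not depend on where
  the search begins.\<close>

lemma discrete_regeneration:
  fixes \<xi> :: "int \<Rightarrow> 'a \<Rightarrow> real" and b :: real
  assumes iid: "iid_family P \<xi>" and f: "int_set_measurable f" and g: "int_set_measurable g"
  defines "I \<equiv> \<lambda>k f g. \<integral>\<^sup>+w. split_at_first k f g (grid_contacts b (psum (\<lambda>i. \<xi> i w))) \<partial>P"
  shows "I k f g * I k' (\<lambda>_. 1) (\<lambda>_. 1) = I k f (\<lambda>_. 1) * I k' (\<lambda>_. 1) g"
  unfolding I_def
  using nn_integral_split_at_first[OF iid] f g int_set_measurable_const[of 1]
  by (simp add: mult_ac)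

section \<open>Lower bounds for random walks\<close>

context iid_family
begin

lemma integral_reindex:
  fixes F :: "('j \<Rightarrow> real) \<Rightarrow> real"
  assumes r: "inj r" "inj r'" and F: "F \<in> borel_measurable (PiM UNIV (\<lambda>_. borel))"
  shows "(\<integral>w. F (\<lambda>i. \<xi> (r i) w) \<partial>P) = (\<integral>w. F (\<lambda>i. \<xi> (r' i) w) \<partial>P)"
proof -
  have "(\<integral>w. F (\<lambda>i. \<xi> (s i) w) \<partial>P) =
    (\<integral>x. F x \<partial>distr P (PiM UNIV (\<lambda>_. borel)) (\<lambda>w i. \<xi> (s i) w))" for s
    by (rule integral_distr[symmetric, OF measurable_family F])
  then show ?thesis using distr_reindex[OF r(1)] distr_reindex[OF r(2)] by metis
qed

lemma iid_family_reindex: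
  assumes r: "inj (r :: 'j \<Rightarrow> 'i)" and g: "g \<in> borel_measurable borel"
  shows "iid_family P (\<lambda>i w. g (\<xi> (r i) w))"
proof
  fix k :: 'i
  have "distr P (PiM UNIV (\<lambda>_. borel)) (\<lambda>w i. \<xi> (r i) w) = PiM UNIV (\<lambda>i. distr P borel (\<xi> (r i)))"
  proof -
    have "(\<lambda>_. distr P borel (\<xi> k)) = (\<lambda>i. distr P borel (\<xi> (r i)))" using ident by blast
    then show ?thesis using distr_reindex[OF r, of k] by simp
  qed
  then have "indep_vars (\<lambda>_. borel) (\<lambda>i. \<xi> (r i)) UNIV"
    by (subst indep_vars_iff_distr_eq_PiM) (auto simp: restrict_UNIV)
  then show "indep_vars (\<lambda>_. borel) (\<lambda>i w. g (\<xi> (r i) w)) UNIV"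
    by (rule indep_vars_compose2) (use g in auto)
  show "distr P borel (\<lambda>w. g (\<xi> (r i) w)) = distr P borel (\<lambda>w. g (\<xi> (r j) w))" for i j
  proof -
    have *: "distr P borel (\<lambda>w. g (\<xi> (r i) w)) = distr (distr P borel (\<xi> (r i))) borel g" for i
      using g by (subst distr_distr) (auto simp: comp_def)
    show ?thesis unfolding * ident[of "r i" "r j"] ..
  qed
qed

lemma integrable_ident:
  assumes "integrable P (\<xi> i)"
  shows "integrable P (\<xi> j)"
proof -
  have "integrable (distr P borel (\<xi> i)) (\<lambda>x. x)" using assms by (subst integrable_distr_eq) auto
  then have "integrable (distr P borel (\<xi> j)) (\<lambda>x. x)" using ident by metis
  then show ?thesis by (subst (asm) integrable_distr_eq) auto
qed

end

text \<open>The minimum of the partial sums up to \<open>n\<close>, the empty one included. The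
  recursion goes through the shifted sequence because that is the sequence with which Hopf's
  inequality compares.\<close>

primrec running_min :: "nat \<Rightarrow> (nat \<Rightarrow> real) \<Rightarrow> real" where
  "running_min 0 x = 0"
| "running_min (Suc n) x = min 0 (x 0 + running_min n (\<lambda>i. x (Suc i)))"

lemma running_min_nonpos: "running_min n x \<le> 0"
  by (cases n) auto

lemma running_min_Suc_le: "running_min (Suc n) x \<le> running_min n x"
proof (induction n arbitrary: x)
  case (Suc n)
  show ?case using Suc[of "\<lambda>i. x (Suc i)"] by (simp only: running_min.simps(2))
qed simp

lemma abs_running_min_le: "\<bar>running_min n x\<bar> \<le> (\<Sum>i<n. \<bar>x i\<bar>)"
proof (induction n arbitrary: x)
  case (Suc n)
  have "\<bar>running_min (Suc n) x\<bar> \<le> \<bar>x 0\<bar> + \<bar>running_min n (\<lambda>i. x (Suc i))\<bar>" by auto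
  also have "\<dots> \<le> \<bar>x 0\<bar> + (\<Sum>i<n. \<bar>x (Suc i)\<bar>)" using Suc by (intro add_left_mono)
  also have "\<dots> = (\<Sum>i<Suc n. \<bar>x i\<bar>)" by (rule sum.lessThan_Suc_shift[symmetric])
  finally show ?case .
qed simp

lemma running_min_neg_iff: "running_min n x < c \<longleftrightarrow> 0 < c \<or> (\<exists>k\<le>n. (\<Sum>i<k. x i) < c)"
proof (induction n arbitrary: x c)
  case (Suc n)
  have "running_min (Suc n) x < c \<longleftrightarrow> 0 < c \<or> running_min n (\<lambda>i. x (Suc i)) < c - x 0"
    by auto
  also have "\<dots> \<longleftrightarrow> 0 < c \<or> (\<exists>k\<le>n. (\<Sum>i<Suc k. x i) < c)"
  proof -
    have "x 0 < c \<Longrightarrow> \<exists>k\<le>n. (\<Sum>i<Suc k. x i) < c" by (intro exI[of _ 0]) simp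
    then show ?thesis
      unfolding Suc by (auto simp: sum.lessThan_Suc_shift algebra_simps simp del: sum.lessThan_Suc)
  qed
  also have "\<dots> \<longleftrightarrow> 0 < c \<or> (\<exists>k\<le>Suc n. (\<Sum>i<k. x i) < c)"
  proof -
    have "(\<exists>k\<le>Suc n. (\<Sum>i<k. x i) < c) \<longleftrightarrow> 0 < c \<or> (\<exists>k\<le>n. (\<Sum>i<Suc k. x i) < c)"
    proof
      assume "\<exists>k\<le>Suc n. (\<Sum>i<k. x i) < c"
      then obtain k where "k \<le> Suc n" "(\<Sum>i<k. x i) < c" by blast
      then show "0 < c \<or> (\<exists>k\<le>n. (\<Sum>i<Suc k. x i) < c)" by (cases k) auto
    qed (use Suc_le_mono in \<open>auto intro: exI[of _ 0]\<close>)
    then show ?thesis by blast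
  qed
  finally show ?case .
qed auto

lemma measurable_running_min:
  "running_min n \<in> borel_measurable (PiM UNIV (\<lambda>_. borel))"
proof (induction n)
  case (Suc n)
  have shift: "(\<lambda>x i. x (Suc i)) \<in> measurable (PiM UNIV (\<lambda>_. borel)) (PiM UNIV (\<lambda>_. borel :: real measure))"
    by (rule measurable_PiM_single') auto
  have [measurable]: "(\<lambda>x. running_min n (\<lambda>i. x (Suc i))) \<in> borel_measurable (PiM UNIV (\<lambda>_. borel))"
    using measurable_compose[OF shift Suc] .
  show ?case unfolding running_min.simps(2)[abs_def] by measurable
qed (simp add: running_min.simps(1)[abs_def])

text \<open>Hopf's maximal inequality: when the running minimum is negative, it exceeds that of the shifted
  sequence by exactly the first increment.\<close>

lemma hopf_maximal:
  fixes \<eta> :: "nat \<Rightarrow> 'a \<Rightarrow> real"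
  assumes iid: "iid_family P \<eta>" and int: "integrable P (\<eta> 0)"
  shows "(\<integral>w. \<eta> 0 w * indicator {w\<in>space P. \<exists>k. (\<Sum>i<k. \<eta> i w) < 0} w \<partial>P) \<le> 0"
proof (rule LIMSEQ_le_const2)
  interpret I: iid_family P \<eta> by (rule iid)
  have [measurable]: "(\<lambda>w. running_min n (\<lambda>i. \<eta> (s i) w)) \<in> borel_measurable P" for n and s :: "nat \<Rightarrow> nat"
    by (rule measurable_compose[OF I.measurable_family measurable_running_min])
  have inti: "integrable P (\<eta> i)" for i using I.integrable_ident[OF int] .
  have intm: "integrable P (\<lambda>w. running_min n (\<lambda>i. \<eta> (s i) w))" for n and s :: "nat \<Rightarrow> nat"
    by (rule Bochner_Integration.integrable_bound[where f = "\<lambda>w. \<Sum>i<n. \<bar>\<eta> (s i) w\<bar>"])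
      (use inti abs_running_min_le in \<open>auto intro!: order_trans[OF _ abs_ge_self]\<close>)
  define A where "A n = {w. running_min (Suc n) (\<lambda>i. \<eta> i w) < 0}" for n
  have A_iff: "w \<in> A n \<longleftrightarrow> (\<exists>k\<le>Suc n. (\<Sum>i<k. \<eta> i w) < 0)" for w n
    unfolding A_def mem_Collect_eq running_min_neg_iff by simp
  have [measurable]: "A n \<inter> space P \<in> sets P" for n
  proof -
    have "A n \<inter> space P = {w\<in>space P. running_min (Suc n) (\<lambda>i. \<eta> (id i) w) < 0}" by (auto simp: A_def)
    also have "\<dots> \<in> sets P" using borel_measurable_integrable[OF intm[of "Suc n" id]] by measurable
    finally show ?thesis .
  qed
  have mA: "(\<lambda>w. \<eta> 0 w * indicator (A n) w) \<in> borel_measurable P" for n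
  proof -
    have "(\<lambda>w. \<eta> 0 w * indicator (A n \<inter> space P) w) \<in> borel_measurable P" by measurable
    then show ?thesis by (subst measurable_cong) (auto simp: indicator_def)
  qed
  show "\<exists>N. \<forall>n\<ge>N. (\<integral>w. \<eta> 0 w * indicator (A n) w \<partial>P) \<le> 0"
  proof (intro exI allI impI)
    fix n
    \<comment> \<open>On \<open>A n\<close> the integrands agree; off it the running minimum is 0
      and that of the shifted sequence is nonpositive.\<close>
    have "(\<integral>w. \<eta> 0 w * indicator (A n) w \<partial>P) \<le>
      (\<integral>w. running_min (Suc n) (\<lambda>i. \<eta> i w) - running_min n (\<lambda>i. \<eta> (Suc i) w) \<partial>P)"
    proof (rule integral_mono)
      show "integrable P (\<lambda>w. \<eta> 0 w * indicator (A n) w)"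
        using mA by (rule Bochner_Integration.integrable_bound[OF int]) (auto simp: indicator_def)
      show "integrable P (\<lambda>w. running_min (Suc n) (\<lambda>i. \<eta> i w) - running_min n (\<lambda>i. \<eta> (Suc i) w))"
        using intm[of "Suc n" id] intm[of n Suc] by simp
      show "\<eta> 0 w * indicator (A n) w \<le> running_min (Suc n) (\<lambda>i. \<eta> i w) - running_min n (\<lambda>i. \<eta> (Suc i) w)" for w
        using running_min_nonpos[of n "\<lambda>i. \<eta> (Suc i) w"] by (auto simp: A_def indicator_def min_def)
    qed
    also have "\<dots> = (\<integral>w. running_min (Suc n) (\<lambda>i. \<eta> i w) \<partial>P) - (\<integral>w. running_min n (\<lambda>i. \<eta> (Suc i) w) \<partial>P)"
      using intm[of "Suc n" id] intm[of n Suc] by simp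
    \<comment> \<open>The shifted sequence has the same law, so only
      \<open>running_min (Suc n)\<close> and \<open>running_min n\<close> of one sequence remain to
      be compared.\<close>
    also have "(\<integral>w. running_min n (\<lambda>i. \<eta> (Suc i) w) \<partial>P) = (\<integral>w. running_min n (\<lambda>i. \<eta> (id i) w) \<partial>P)"
      using I.integral_reindex[of Suc id "running_min n"] measurable_running_min by simp
    also have "(\<integral>w. running_min (Suc n) (\<lambda>i. \<eta> i w) \<partial>P) \<le> (\<integral>w. running_min n (\<lambda>i. \<eta> (id i) w) \<partial>P)"
      using intm[of "Suc n" id] intm[of n id] running_min_Suc_le by (intro integral_mono) auto
    finally show "(\<integral>w. \<eta> 0 w * indicator (A n) w \<partial>P) \<le> 0" by simp
  qed
  show "(\<lambda>n. \<integral>w. \<eta> 0 w * indicator (A n) w \<partial>P) \<longlonglongrightarrow>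
      (\<integral>w. \<eta> 0 w * indicator {w\<in>space P. \<exists>k. (\<Sum>i<k. \<eta> i w) < 0} w \<partial>P)"
  proof (rule integral_dominated_convergence[where w = "\<lambda>w. \<bar>\<eta> 0 w\<bar>"])
    show "(\<lambda>w. \<eta> 0 w * indicator {w\<in>space P. \<exists>k. (\<Sum>i<k. \<eta> i w) < 0} w) \<in> borel_measurable P"
      by measurable
    show "AE w in P. (\<lambda>n. \<eta> 0 w * indicator (A n) w) \<longlonglongrightarrow> \<eta> 0 w * indicator {w\<in>space P. \<exists>k. (\<Sum>i<k. \<eta> i w) < 0} w"
    proof (intro AE_I2 tendsto_mult tendsto_const tendsto_eventually)
      fix w assume w: "w \<in> space P"
      show "\<forall>\<^sub>F n in sequentially. indicator (A n) w = (indicator {w\<in>space P. \<exists>k. (\<Sum>i<k. \<eta> i w) < 0} w :: real)"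
      proof (cases "\<exists>k. (\<Sum>i<k. \<eta> i w) < 0")
        case True
        then obtain k where "(\<Sum>i<k. \<eta> i w) < 0" by blast
        then have "w \<in> A n" if "n \<ge> k" for n using that unfolding A_iff by (intro exI[of _ k]) auto
        then show ?thesis using True w by (intro eventually_sequentiallyI[of k]) (auto simp: indicator_def)
      next
        case False
        then have "w \<notin> A n" for n unfolding A_iff by blast
        with False show ?thesis by (simp add: indicator_def)
      qed
    qed
  qed (use mA int in \<open>auto simp: indicator_def\<close>)
qed

text \<open>Unboundedness below is a tail event. If it had probability one, the indicator in Hopf's
  inequality would be 1 almost surely and the mean would be nonpositive.\<close>

lemma AE_partial_sums_bounded_below:
  fixes \<eta> :: "nat \<Rightarrow> 'a \<Rightarrow> real"
  assumes iid: "iid_family P \<eta>" and int: "integrable P (\<eta> 0)" and pos: "(\<integral>w. \<eta> 0 w \<partial>P) > 0"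
  shows "AE w in P. \<exists>c. \<forall>k. c \<le> (\<Sum>i<k. \<eta> i w)"
proof -
  interpret I: iid_family P \<eta> by (rule iid)
  define B where "B = {w\<in>space P. \<forall>c::nat. \<exists>k. (\<Sum>i<k. \<eta> i w) < - real c}"
  define A where "A i = sigma_sets (space P) {\<eta> i -` C \<inter> space P | C. C \<in> sets borel}" for i
  have A_Pow: "A i \<subseteq> Pow (space P)" for i
  proof
    fix x assume "x \<in> A i"
    then have "x \<subseteq> space P" unfolding A_def by (rule sigma_sets_into_sp[rotated]) auto
    then show "x \<in> Pow (space P)" by simp
  qed
  have "B \<in> I.tail_events A"
    unfolding I.tail_events_def
  proof
    fix n
    define N where "N = sigma (space P) (\<Union> (A ` {n..}))"
    have N: "sets N = sigma_sets (space P) (\<Union> (A ` {n..}))" "space N = space P"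
      unfolding N_def using A_Pow by (auto simp: sets_measure_of_conv space_measure_of_conv)
    have [measurable]: "\<eta> (n + i) \<in> borel_measurable N" for i
    proof (rule measurableI)
      fix C :: "real set" assume "C \<in> sets borel"
      then have "\<eta> (n + i) -` C \<inter> space P \<in> A (n + i)" unfolding A_def by (intro sigma_sets.Basic) auto
      then show "\<eta> (n + i) -` C \<inter> space N \<in> sets N" unfolding N by (intro sigma_sets.Basic) auto
    qed simp
    have "B = {w\<in>space N. \<forall>c::nat. \<exists>k. (\<Sum>i<k. \<eta> (n + i) w) < - real c}"
      unfolding B_def N(2)
    proof (intro Collect_cong conj_cong refl iffI allI)
      fix w c
      \<comment> \<open>The first \<open>n\<close> terms contribute at most \<open>K\<close> in
        absolute value, so they cannot decide unboundedness.\<close>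
      define K where "K = (\<Sum>i<n. \<bar>\<eta> i w\<bar>)"
      have K: "\<bar>\<Sum>i<k. \<eta> i w\<bar> \<le> K" if "k \<le> n" for k
        unfolding K_def using that by (intro order_trans[OF sum_abs] sum_mono2) auto
      obtain c' :: nat where c': "real c + K \<le> real c'" using real_arch_simple by blast
      have K0: "K \<ge> 0" by (simp add: K_def)
      have split: "(\<Sum>i<n + k. \<eta> i w) = (\<Sum>i<n. \<eta> i w) + (\<Sum>i<k. \<eta> (n + i) w)" for k
        by (induction k) auto
      {
        assume "\<forall>c::nat. \<exists>k. (\<Sum>i<k. \<eta> i w) < - real c"
        then obtain k where k: "(\<Sum>i<k. \<eta> i w) < - real c'" by blast
        have "\<not> k \<le> n"
        proof
          assume "k \<le> n"
          then show False using K[of k] k c' by linarith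
        qed
        then obtain l where "k = n + l" using le_Suc_ex nat_le_linear by blast
        then have "(\<Sum>i<l. \<eta> (n + i) w) < - real c" using split[of l] K[of n] k c' by simp
        then show "\<exists>k. (\<Sum>i<k. \<eta> (n + i) w) < - real c" ..
      next
        assume "\<forall>c::nat. \<exists>k. (\<Sum>i<k. \<eta> (n + i) w) < - real c"
        then obtain k where k: "(\<Sum>i<k. \<eta> (n + i) w) < - real c'" by blast
        then have "(\<Sum>i<n + k. \<eta> i w) < - real c" using split[of k] K[of n] c' by simp
        then show "\<exists>k. (\<Sum>i<k. \<eta> i w) < - real c" ..
      }
    qed
    also have "\<dots> \<in> sets N" by measurable
    finally show "B \<in> sigma_sets (space P) (\<Union> (A ` {n..}))" by (simp add: N)
  qed
  moreover have "I.indep_sets A UNIV"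
    unfolding A_def using I.indep by (simp add: I.indep_vars_def)
  moreover have "sigma_algebra (space P) (A i)" for i
    unfolding A_def by (intro sigma_algebra_sigma_sets) auto
  ultimately have "I.prob B = 0 \<or> I.prob B = 1"
    using I.kolmogorov_0_1_law[of A B] by blast
  moreover have "I.prob B \<noteq> 1"
  proof
    assume "I.prob B = 1"
    then have "AE w in P. w \<in> B" by (rule I.prob_eq_1[THEN iffD1, rotated]) (simp add: B_def)
    then have "AE w in P. \<eta> 0 w * indicator {w\<in>space P. \<exists>k. (\<Sum>i<k. \<eta> i w) < 0} w = \<eta> 0 w"
    proof eventually_elim
      case (elim w)
      then have "w \<in> space P" "\<exists>k. (\<Sum>i<k. \<eta> i w) < - real 0" unfolding B_def by blast+
      then show ?case by simp
    qed
    then have "(\<integral>w. \<eta> 0 w * indicator {w\<in>space P. \<exists>k. (\<Sum>i<k. \<eta> i w) < 0} w \<partial>P) = (\<integral>w. \<eta> 0 w \<partial>P)"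
      by (intro integral_cong_AE) auto
    moreover have "(\<integral>w. \<eta> 0 w * indicator {w\<in>space P. \<exists>k. (\<Sum>i<k. \<eta> i w) < 0} w \<partial>P) \<le> 0"
      by (rule hopf_maximal[OF iid int])
    ultimately show False using pos by simp
  qed
  ultimately have "I.prob B = 0" by blast
  then have "AE w in P. w \<notin> B"
    by (intro AE_iff_measurable[THEN iffD2, OF _ refl]) (auto simp: I.emeasure_eq_measure B_def)
  then show ?thesis
    using AE_space
  proof eventually_elim
    case (elim w)
    then obtain c :: nat where "\<And>k. \<not> (\<Sum>i<k. \<eta> i w) < - real c" by (auto simp: B_def)
    then show ?case by (intro exI[of _ "- real c"]) (auto simp: not_less)
  qed
qed

section \<open>Ottaviani's inequality and dyadic times\<close>

lemma nn_integral_if_emeasure: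
  assumes "{w \<in> space M. Q w} \<in> sets M"
  shows "(\<integral>\<^sup>+w. (if Q w then 1 else 0) \<partial>M) = emeasure M {w \<in> space M. Q w}"
  unfolding nn_integral_indicator[OF assms, symmetric]
  by (rule nn_integral_cong) (auto simp: indicator_def)

text \<open>Ottaviani's trick: after the first passage below \<open>c\<close>, the walk stays below \<open>c + L\<close> at the next
  multiple of \<open>N\<close> with probability at least one half.\<close>

lemma ottaviani:
  fixes \<eta> :: "nat \<Rightarrow> 'a \<Rightarrow> real"
  assumes iid: "iid_family P \<eta>" and N: "N > 0"
    and half: "\<And>j. j \<le> N \<Longrightarrow> emeasure P {w \<in> space P. (\<Sum>i<j. \<eta> i w) \<le> L} \<ge> ennreal (1/2)"
  shows "emeasure P {w \<in> space P. \<exists>k. (\<Sum>i<k. \<eta> i w) < c} \<le>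
    2 * emeasure P {w \<in> space P. \<exists>k. (\<Sum>i<k * N. \<eta> i w) < c + L}"
proof -
  interpret I: iid_family P \<eta> by fact
  define H where "H k = {w \<in> space P. (\<Sum>i<k. \<eta> i w) < c \<and> (\<forall>j<k. c \<le> (\<Sum>i<j. \<eta> i w))}" for k
  \<comment> \<open>The number of steps to the next multiple of \<open>N\<close> strictly after
    \<open>k\<close>; it is at most \<open>N\<close>, so \<open>half\<close> applies to it.\<close>
  define d where "d k = N - k mod N" for k
  have d: "d k \<le> N" "\<exists>l. k + d k = l * N" for k
  proof -
    show "d k \<le> N" by (simp add: d_def)
    have "k + d k = N * (k div N) + (k mod N + (N - k mod N))" by (simp add: d_def)
    also have "\<dots> = (k div N + 1) * N" using N by (simp add: less_imp_le)
    finally show "\<exists>l. k + d k = l * N" ..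
  qed
  define R where "R k = {w \<in> space P. (\<Sum>i<d k. \<eta> (i + k) w) \<le> L}" for k
  have [measurable]: "H k \<in> sets P" "R k \<in> sets P" for k unfolding H_def R_def by measurable
  have disj: "disjoint_family H"
    unfolding disjoint_family_on_def
  proof (intro ballI impI)
    fix m n :: nat assume "m \<noteq> n"
    then consider "m < n" | "n < m" by linarith
    then show "H m \<inter> H n = {}" by cases (force simp: H_def)+
  qed
  have HR: "emeasure P (H k) \<le> 2 * emeasure P (H k \<inter> R k)" for k
  proof -
    \<comment> \<open>\<open>F\<close> sees only the steps before \<open>k\<close> and
      \<open>G\<close> only those from \<open>k\<close> on, so the first passage and the later
      displacement are independent.\<close>
    define F :: "(nat \<Rightarrow> real) \<Rightarrow> ennreal" where
      "F x = (if (\<Sum>i<k. x i) < c \<and> (\<forall>j<k. c \<le> (\<Sum>i<j. x i)) then 1 else 0)" for x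
    define G :: "(nat \<Rightarrow> real) \<Rightarrow> ennreal" where
      "G x = (if (\<Sum>i<d k. x (i + k)) \<le> L then 1 else 0)" for x
    define G0 :: "(nat \<Rightarrow> real) \<Rightarrow> ennreal" where
      "G0 x = (if (\<Sum>i<d k. x i) \<le> L then 1 else 0)" for x
    have mF: "F \<in> borel_measurable (PiM UNIV (\<lambda>_. borel))" unfolding F_def[abs_def] by measurable
    have mG: "G \<in> borel_measurable (PiM UNIV (\<lambda>_. borel))" unfolding G_def[abs_def] by measurable
    have mG0: "G0 \<in> borel_measurable (PiM UNIV (\<lambda>_. borel))" unfolding G0_def[abs_def] by measurable
    have "emeasure P (H k \<inter> R k) = (\<integral>\<^sup>+w. (if w \<in> H k \<inter> R k then 1 else 0) \<partial>P)"
      by (subst nn_integral_if_emeasure) (auto simp: H_def intro!: arg_cong[where f = "emeasure P"])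
    also have "\<dots> = (\<integral>\<^sup>+w. F (\<lambda>i. \<eta> i w) * G (\<lambda>i. \<eta> i w) \<partial>P)"
      by (rule nn_integral_cong) (auto simp: F_def G_def H_def R_def)
    also have "\<dots> = (\<integral>\<^sup>+w. F (\<lambda>i. \<eta> i w) \<partial>P) * (\<integral>\<^sup>+w. G (\<lambda>i. \<eta> i w) \<partial>P)"
    proof (rule I.indep_coordinates[where A = "{..<k}" and B = "{k..}"])
      show "F x = F y" if "\<And>i. i \<in> {..<k} \<Longrightarrow> x i = y i" for x y
      proof -
        have "(\<Sum>i<j. x i) = (\<Sum>i<j. y i)" if "j \<le> k" for j
          using that \<open>\<And>i. i \<in> {..<k} \<Longrightarrow> x i = y i\<close> by (intro sum.cong) auto
        then show ?thesis by (simp add: F_def less_imp_le)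
      qed
      show "G x = G y" if "\<And>i. i \<in> {k..} \<Longrightarrow> x i = y i" for x y
        using that by (simp add: G_def)
    qed (use mF mG in auto)
    also have "(\<integral>\<^sup>+w. F (\<lambda>i. \<eta> i w) \<partial>P) = emeasure P (H k)"
      unfolding F_def H_def by (rule nn_integral_if_emeasure) measurable
    also have "(\<integral>\<^sup>+w. G (\<lambda>i. \<eta> i w) \<partial>P) = (\<integral>\<^sup>+w. G0 (\<lambda>i. \<eta> (i + k) w) \<partial>P)"
      by (simp add: G_def G0_def)
    also have "\<dots> = (\<integral>\<^sup>+w. G0 (\<lambda>i. \<eta> i w) \<partial>P)"
      by (rule I.nn_integral_reindex[OF _ _ mG0]) (auto simp: inj_def)
    also have "\<dots> = emeasure P {w \<in> space P. (\<Sum>i<d k. \<eta> i w) \<le> L}"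
      unfolding G0_def by (rule nn_integral_if_emeasure) measurable
    finally have eq: "emeasure P (H k \<inter> R k) = emeasure P (H k) * emeasure P {w \<in> space P. (\<Sum>i<d k. \<eta> i w) \<le> L}" .
    have "1 = ennreal (2 * (1/2))" by simp
    also have "\<dots> = ennreal 2 * ennreal (1/2)" by (rule ennreal_mult) auto
    also have "ennreal 2 = 2" by simp
    finally have "1 = 2 * ennreal (1/2)" .
    also have "\<dots> \<le> 2 * emeasure P {w \<in> space P. (\<Sum>i<d k. \<eta> i w) \<le> L}"
      by (intro mult_left_mono half d) auto
    finally have "emeasure P (H k) * 1 \<le> emeasure P (H k) * (2 * emeasure P {w \<in> space P. (\<Sum>i<d k. \<eta> i w) \<le> L})"
      by (rule mult_left_mono) simp
    then show ?thesis by (simp add: eq mult_ac)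
  qed
  have "{w \<in> space P. \<exists>k. (\<Sum>i<k. \<eta> i w) < c} = (\<Union>k. H k)"
  proof (intro equalityI subsetI)
    fix w assume w: "w \<in> {w \<in> space P. \<exists>k. (\<Sum>i<k. \<eta> i w) < c}"
    define k where "k = (LEAST k. (\<Sum>i<k. \<eta> i w) < c)"
    have "(\<Sum>i<k. \<eta> i w) < c" unfolding k_def using w by (auto intro: LeastI_ex)
    moreover have "c \<le> (\<Sum>i<j. \<eta> i w)" if "j < k" for j
      using not_less_Least[OF that[unfolded k_def]] by simp
    ultimately have "w \<in> H k" using w by (simp add: H_def)
    then show "w \<in> (\<Union>k. H k)" by blast
  qed (auto simp: H_def)
  then have "emeasure P {w \<in> space P. \<exists>k. (\<Sum>i<k. \<eta> i w) < c} = (\<Sum>k. emeasure P (H k))"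
    by (simp add: suminf_emeasure[OF _ disj] image_subset_iff)
  also have "\<dots> \<le> (\<Sum>k. 2 * emeasure P (H k \<inter> R k))" by (intro suminf_le HR) auto
  also have "\<dots> = 2 * (\<Sum>k. emeasure P (H k \<inter> R k))" by (rule ennreal_suminf_cmult)
  also have "(\<Sum>k. emeasure P (H k \<inter> R k)) = emeasure P (\<Union>k. H k \<inter> R k)"
    by (rule suminf_emeasure) (use disj in \<open>auto simp: disjoint_family_on_def\<close>)
  also have "\<dots> \<le> emeasure P {w \<in> space P. \<exists>k. (\<Sum>i<k * N. \<eta> i w) < c + L}"
  proof (rule emeasure_mono)
    show "(\<Union>k. H k \<inter> R k) \<subseteq> {w \<in> space P. \<exists>k. (\<Sum>i<k * N. \<eta> i w) < c + L}"
    proof safe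
      fix w k assume w: "w \<in> H k" "w \<in> R k"
      then show "w \<in> space P" by (simp add: H_def)
      obtain l where l: "k + d k = l * N" using d(2) by blast
      have "(\<Sum>i<k + j. \<eta> i w) = (\<Sum>i<k. \<eta> i w) + (\<Sum>i<j. \<eta> (i + k) w)" for j
        by (induction j) (auto simp: add.commute)
      from this[of "d k"] have "(\<Sum>i<l * N. \<eta> i w) < c + L" using w l by (simp add: H_def R_def)
      then show "\<exists>k. (\<Sum>i<k * N. \<eta> i w) < c + L" ..
    qed
  qed measurable
  finally show ?thesis by (simp add: mult_left_mono)
qed

text \<open>Ottaviani's bound compares the walk on each dyadic grid with its integer skeleton, and
  its constants do not depend on the level \<open>n\<close>: boundedness of the paths on the unit
  interval supplies one threshold for all levels.\<close>

lemma (in prob_space) AE_dyadic_bounded_below: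
  fixes Y :: "real \<Rightarrow> 'a \<Rightarrow> real"
  assumes iid: "\<And>n. iid_family M (\<lambda>i w. Y (real (Suc i) / 2 ^ n) w - Y (real i / 2 ^ n) w)"
    and Y0: "\<And>w. w \<in> space M \<Longrightarrow> Y 0 w = 0"
    and [measurable]: "\<And>t. Y t \<in> borel_measurable M"
    and bounded: "\<And>w. w \<in> space M \<Longrightarrow> \<exists>L. \<forall>t\<in>{0..1}. Y t w \<le> L"
    and int: "integrable M (Y 1)" and pos: "expectation (Y 1) > 0"
  shows "AE w in M. \<exists>c. \<forall>n i. c \<le> Y (real i / 2 ^ n) w"
proof -
  have psum: "(\<Sum>i<k. Y (real (Suc i) / 2 ^ n) w - Y (real i / 2 ^ n) w) = Y (real k / 2 ^ n) w"
    if "w \<in> space M" for k n w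
    using Y0[OF that] by (subst sum_lessThan_telescope) simp
  have first: "integrable M (\<lambda>w. Y (real (Suc 0) / 2 ^ 0) w - Y (real 0 / 2 ^ 0) w)"
    "expectation (\<lambda>w. Y (real (Suc 0) / 2 ^ 0) w - Y (real 0 / 2 ^ 0) w) > 0"
  proof -
    have eq: "Y (real (Suc 0) / 2 ^ 0) w - Y (real 0 / 2 ^ 0) w = Y 1 w" if "w \<in> space M" for w
      using Y0[OF that] by simp
    show "integrable M (\<lambda>w. Y (real (Suc 0) / 2 ^ 0) w - Y (real 0 / 2 ^ 0) w)"
      using int by (subst Bochner_Integration.integrable_cong[OF refl eq])
    show "expectation (\<lambda>w. Y (real (Suc 0) / 2 ^ 0) w - Y (real 0 / 2 ^ 0) w) > 0"
      using pos by (subst Bochner_Integration.integral_cong[OF refl eq])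
  qed
  have int_bdd: "AE w in M. \<exists>c. \<forall>k. c \<le> Y (real k) w"
    using AE_partial_sums_bounded_below[OF iid first] AE_space
  proof eventually_elim
    case (elim w)
    show ?case using elim(1) unfolding psum[OF elim(2)] by simp
  qed
  \<comment> \<open>These events increase to the whole space, so some \<open>l\<close> gives
    probability above one half for all grids at once.\<close>
  define E where "E l = {w \<in> space M. \<forall>n i. i \<le> 2 ^ n \<longrightarrow> Y (real i / 2 ^ n) w \<le> real l}" for l :: nat
  have E [measurable]: "E l \<in> sets M" for l unfolding E_def by measurable
  have "incseq E" by (rule incseq_SucI) (force simp: E_def intro: order_trans)
  moreover have "(\<Union>l. E l) = space M"
  proof (intro equalityI subsetI)
    fix w assume w: "w \<in> space M"
    obtain L where L: "\<forall>t\<in>{0..1}. Y t w \<le> L" using bounded[OF w] by blast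
    obtain l :: nat where "L \<le> real l" using real_arch_simple by blast
    then have "w \<in> E l"
      using w L by (auto simp: E_def field_simps intro!: order_trans[OF L[rule_format]] simp flip: of_nat_power)
    then show "w \<in> (\<Union>l. E l)" by blast
  qed (auto simp: E_def)
  ultimately have "(\<lambda>l. prob (E l)) \<longlonglongrightarrow> 1"
    using finite_Lim_measure_incseq[of E] prob_space E by (auto simp: image_subset_iff)
  then have "\<forall>\<^sub>F l in sequentially. 1 / 2 < prob (E l)" by (rule order_tendstoD) simp
  then obtain l where l: "1 / 2 < prob (E l)" by (auto simp: eventually_sequentially)
  define J where "J c = {w \<in> space M. \<exists>k. Y (real k) w < c}" for c
  define D where "D c n = {w \<in> space M. \<exists>i. Y (real i / 2 ^ n) w < c}" for c n
  have [measurable]: "J c \<in> sets M" "D c n \<in> sets M" for c n unfolding J_def D_def by measurable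
  have DJ: "emeasure M (D c n) \<le> 2 * emeasure M (J (c + real l))" for c n
  proof -
    have "emeasure M {w \<in> space M. \<exists>k. (\<Sum>i<k. Y (real (Suc i) / 2 ^ n) w - Y (real i / 2 ^ n) w) < c} \<le>
      2 * emeasure M {w \<in> space M. \<exists>k. (\<Sum>i<k * 2 ^ n. Y (real (Suc i) / 2 ^ n) w - Y (real i / 2 ^ n) w) < c + real l}"
    proof (rule ottaviani[OF iid])
      fix j :: nat assume j: "j \<le> 2 ^ n"
      have "ennreal (1/2) \<le> emeasure M (E l)" 
        unfolding emeasure_eq_measure using l by (intro ennreal_leI) simp
      also have "\<dots> \<le> emeasure M {w \<in> space M. (\<Sum>i<j. Y (real (Suc i) / 2 ^ n) w - Y (real i / 2 ^ n) w) \<le> real l}"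
        by (rule emeasure_mono) (use j psum in \<open>auto simp: E_def\<close>)
      finally show "ennreal (1/2) \<le> emeasure M {w \<in> space M. (\<Sum>i<j. Y (real (Suc i) / 2 ^ n) w - Y (real i / 2 ^ n) w) \<le> real l}" .
    qed simp
    also have "{w \<in> space M. \<exists>k. (\<Sum>i<k. Y (real (Suc i) / 2 ^ n) w - Y (real i / 2 ^ n) w) < c} = D c n"
      unfolding D_def using psum by (intro Collect_cong conj_cong refl) simp
    also have "{w \<in> space M. \<exists>k. (\<Sum>i<k * 2 ^ n. Y (real (Suc i) / 2 ^ n) w - Y (real i / 2 ^ n) w) < c + real l} = J (c + real l)"
      unfolding J_def using psum by (intro Collect_cong conj_cong refl) simp
    finally show ?thesis .
  qed
  \<comment> \<open>Dyadic grids are nested, so the bound passes to the union over all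
    levels.\<close>
  have incD: "incseq (D c)" for c
  proof (rule incseq_SucI, safe)
    fix n w assume "w \<in> D c n"
    then obtain i where "w \<in> space M" "Y (real i / 2 ^ n) w < c" by (auto simp: D_def)
    moreover have "real i / 2 ^ n = real (2 * i) / 2 ^ Suc n" by simp
    ultimately show "w \<in> D c (Suc n)" unfolding D_def by (metis (mono_tags, lifting) mem_Collect_eq)
  qed
  have UDJ: "emeasure M (\<Union>n. D c n) \<le> 2 * emeasure M (J (c + real l))" for c
  proof -
    have "emeasure M (\<Union>n. D c n) = (SUP n. emeasure M (D c n))"
      by (rule SUP_emeasure_incseq[symmetric]) (use incD in auto)
    also have "\<dots> \<le> 2 * emeasure M (J (c + real l))" by (rule SUP_least) (rule DJ)
    finally show ?thesis .
  qed
  have "(\<lambda>j. emeasure M (J (- real j + real l))) \<longlonglongrightarrow> emeasure M (\<Inter>j. J (- real j + real l))"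
  proof (rule Lim_emeasure_decseq)
    have "J a \<subseteq> J b" if "a \<le> b" for a b
      unfolding J_def using that by (auto intro: order_less_le_trans)
    then show "decseq (\<lambda>j. J (- real j + real l))" by (simp add: decseq_def)
  qed (auto simp: emeasure_eq_measure)
  also have "emeasure M (\<Inter>j. J (- real j + real l)) = 0"
  proof -
    have ae: "AE w in M. w \<notin> (\<Inter>j. J (- real j + real l))"
      using int_bdd
    proof eventually_elim
      case (elim w)
      then obtain c where c: "\<And>k. c \<le> Y (real k) w" by blast
      obtain j :: nat where "real l - c \<le> real j" using real_arch_simple by blast
      then have "\<not> Y (real k) w < - real j + real l" for k using c[of k] by linarith
      then have "w \<notin> J (- real j + real l)" unfolding J_def by blast
      then show ?case by blast
    qed
    have m1: "(\<Inter>j. J (- real j + real l)) \<in> sets M" by measurable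
    have m2: "{w \<in> space M. \<not> w \<notin> (\<Inter>j. J (- real j + real l))} = (\<Inter>j. J (- real j + real l))"
      by (auto simp: J_def)
    show ?thesis using iffD1[OF AE_iff_measurable[OF m1 m2] ae] .
  qed
  finally have "(\<lambda>j. 2 * emeasure M (J (- real j + real l))) \<longlonglongrightarrow> 2 * 0"
    by (intro tendsto_mult_ennreal tendsto_const) auto
  then have lim: "(\<lambda>j. 2 * emeasure M (J (- real j + real l))) \<longlonglongrightarrow> 0" by simp
  have "emeasure M (\<Inter>j. \<Union>n. D (- real j) n) \<le> 0"
  proof (rule LIMSEQ_le_const[OF lim], intro exI allI impI)
    fix j
    have "emeasure M (\<Inter>j. \<Union>n. D (- real j) n) \<le> emeasure M (\<Union>n. D (- real j) n)"
      by (rule emeasure_mono) auto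
    also have "\<dots> \<le> 2 * emeasure M (J (- real j + real l))" by (rule UDJ)
    finally show "emeasure M (\<Inter>j. \<Union>n. D (- real j) n) \<le> 2 * emeasure M (J (- real j + real l))" .
  qed
  then have "emeasure M (\<Inter>j. \<Union>n. D (- real j) n) = 0" by simp
  then have "AE w in M. w \<notin> (\<Inter>j. \<Union>n. D (- real j) n)"
    by (intro AE_not_in) (auto simp: null_sets_def)
  then show ?thesis
    using AE_space
  proof eventually_elim
    case (elim w)
    then obtain j where "\<And>n. w \<notin> D (- real j) n" by blast
    then show ?case using elim(2) by (intro exI[of _ "- real j"]) (auto simp: D_def not_less)
  qed
qed

section \<open>Splitting a closed set at a point\<close>

lemma measurable_closed_sets_avoidanceI:
  assumes cl: "\<And>w. w \<in> space M \<Longrightarrow> closed (f w)"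
    and av: "\<And>c. test_function c \<Longrightarrow> (\<lambda>w. avoidance c (f w)) \<in> borel_measurable M"
  shows "f \<in> measurable M closed_sets"
proof (rule measurable_closed_setsI[OF cl])
  fix a b :: real
  obtain c where c: "\<And>k. test_function (c k)"
    "\<And>S. (\<lambda>k. avoidance (c k) S) \<longlonglongrightarrow> (if S \<inter> {a<..<b} = {} then 1 else 0)"
    using test_functions_separate_open[of "{a<..<b}"] by auto
  have [measurable]: "(\<lambda>w. if f w \<inter> {a<..<b} = {} then 1 else 0 :: real) \<in> borel_measurable M"
    by (rule borel_measurable_LIMSEQ_real[where u = "\<lambda>k w. avoidance (c k) (f w)"])
      (use c av in auto)
  have "{w \<in> space M. f w \<inter> {a<..<b} \<noteq> {}} =
    {w \<in> space M. (if f w \<inter> {a<..<b} = {} then 1 else 0 :: real) < 1 / 2}" by auto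
  also have "\<dots> \<in> sets M" by measurable
  finally show "{w \<in> space M. f w \<inter> {a<..<b} \<noteq> {}} \<in> sets M" .
qed

text \<open>For the misses: \<open>K\<close> moved by \<open>- u\<close> is compact and has positive
  distance from the closed set \<open>T\<close>. Thickening it by half that distance keeps it
  compact and disjoint from \<open>T\<close>, and absorbs the error \<open>v i - u\<close>.\<close>

lemma fell_tendsto_translate:
  assumes ST: "fell_tendsto S T F" and "closed T" and v: "(v \<longlongrightarrow> u) F"
  shows "fell_tendsto (\<lambda>i. (+) (v i) ` S i) ((+) u ` T) F"
  unfolding fell_tendsto_def
proof (intro conjI allI impI)
  fix U assume U: "open U" and "(+) u ` T \<inter> U \<noteq> {}"
  then obtain z where z: "z \<in> T" "u + z \<in> U" by blast
  obtain e where e: "e > 0" "ball (u + z) e \<subseteq> U" using U z(2) by (meson open_contains_ball)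
  have "\<forall>\<^sub>F i in F. S i \<inter> ball z (e / 2) \<noteq> {}"
    using z(1) e(1) by (intro fell_tendsto_hit[OF ST]) (auto intro!: exI[of _ z])
  moreover have "\<forall>\<^sub>F i in F. dist (v i) u < e / 2" using tendstoD[OF v half_gt_zero[OF e(1)]] .
  ultimately show "\<forall>\<^sub>F i in F. (+) (v i) ` S i \<inter> U \<noteq> {}"
  proof eventually_elim
    case (elim i)
    then obtain x where x: "x \<in> S i" "dist z x < e / 2" by auto
    then have "v i + x \<in> ball (u + z) e"
      using elim(2) x(2) unfolding dist_real_def mem_ball by linarith
    then show ?case using x(1) e(2) by blast
  qed
next
  fix K :: "real set" assume K: "compact K" and TK: "(+) u ` T \<inter> K = {}"
  have K': "compact ((+) (- u) ` K)" using compact_translation[OF K] .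
  moreover have "(+) (- u) ` K \<inter> T = {}"
  proof (rule ccontr)
    assume "(+) (- u) ` K \<inter> T \<noteq> {}"
    then obtain k where "k \<in> K" "- u + k \<in> T" by blast
    then have "u + (- u + k) \<in> (+) u ` T" by blast
    then have "k \<in> (+) u ` T \<inter> K" using \<open>k \<in> K\<close> by simp
    then show False using TK by blast
  qed
  ultimately obtain d where d: "d > 0" "\<And>x y. x \<in> (+) (- u) ` K \<Longrightarrow> y \<in> T \<Longrightarrow> d \<le> dist x y"
    using separate_compact_closed[OF _ \<open>closed T\<close>] by metis
  define L where "L = (\<Union>x\<in>(+) (- u) ` K. \<Union>y\<in>cball 0 (d / 2). {x + y})"
  have "compact L" unfolding L_def by (intro compact_sums' K' compact_cball)
  moreover have "T \<inter> L = {}"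
  proof (rule ccontr)
    assume "T \<inter> L \<noteq> {}"
    then obtain x y where xy: "x \<in> (+) (- u) ` K" "y \<in> cball 0 (d / 2)" "x + y \<in> T"
      unfolding L_def by blast
    then have "d \<le> dist x (x + y)" using d(2) by blast
    then show False using xy(2) d(1) by (simp add: dist_real_def)
  qed
  ultimately have "\<forall>\<^sub>F i in F. S i \<inter> L = {}" by (rule fell_tendsto_miss[OF ST])
  moreover have "\<forall>\<^sub>F i in F. dist (v i) u < d / 2" using tendstoD[OF v half_gt_zero[OF d(1)]] .
  ultimately show "\<forall>\<^sub>F i in F. (+) (v i) ` S i \<inter> K = {}"
  proof eventually_elim
    case (elim i)
    show ?case
    proof (rule ccontr)
      assume "(+) (v i) ` S i \<inter> K \<noteq> {}"
      then obtain x where x: "x \<in> S i" "v i + x \<in> K" by blast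
      have "x = (- u + (v i + x)) + (u - v i)" by simp
      moreover have "- u + (v i + x) \<in> (+) (- u) ` K" using x(2) by blast
      moreover have "u - v i \<in> cball 0 (d / 2)" using elim(2) by (simp add: dist_real_def abs_minus_commute)
      ultimately have "x \<in> L" unfolding L_def by blast
      then show False using elim(1) x(1) by blast
    qed
  qed
qed

definition past_at :: "real \<Rightarrow> real set \<Rightarrow> real set" where
  "past_at x S = S \<inter> {..x}"

definition future_at :: "real \<Rightarrow> real set \<Rightarrow> real set" where
  "future_at x S = (+) (- x) ` S \<inter> {0..}"

lemma mem_future_at: "y \<in> future_at x S \<longleftrightarrow> 0 \<le> y \<and> x + y \<in> S"
  by (auto simp: future_at_def image_iff intro!: bexI[of _ "x + y"])

lemma closed_past_at: "closed S \<Longrightarrow> closed (past_at x S)"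
  unfolding past_at_def by (intro closed_Int) auto

lemma closed_future_at: "closed S \<Longrightarrow> closed (future_at x S)"
  unfolding future_at_def by (intro closed_Int closed_translation) auto

text \<open>Intersecting with a closed set is not Fell continuous: a limit point on the boundary may
  be approached from outside. Here the only possible boundary point is 0, which the approximating
  sets eventually contain.\<close>

lemma fell_tendsto_half_line:
  assumes ST: "fell_tendsto S T F" and 0: "0 \<in> T" "\<forall>\<^sub>F i in F. 0 \<in> S i"
    and H: "closed H" "\<And>z :: real. z \<in> H \<Longrightarrow> z = 0 \<or> z \<in> interior H" "0 \<in> H"
  shows "fell_tendsto (\<lambda>i. S i \<inter> H) (T \<inter> H) F"
  unfolding fell_tendsto_def
proof (intro conjI allI impI)
  fix U :: "real set" assume U: "open U" and "T \<inter> H \<inter> U \<noteq> {}"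
  then obtain z where z: "z \<in> T" "z \<in> H" "z \<in> U" by blast
  show "\<forall>\<^sub>F i in F. S i \<inter> H \<inter> U \<noteq> {}"
  proof (cases "z = 0")
    case True
    show ?thesis using 0(2) by eventually_elim (use z True in blast)
  next
    case False
    then have "z \<in> interior H" using H(2) z(2) by blast
    then have "\<forall>\<^sub>F i in F. S i \<inter> (interior H \<inter> U) \<noteq> {}"
      using U z by (intro fell_tendsto_hit[OF ST]) auto
    then show ?thesis by eventually_elim (use interior_subset in blast)
  qed
next
  fix K :: "real set" assume K: "compact K" "T \<inter> H \<inter> K = {}"
  have "\<forall>\<^sub>F i in F. S i \<inter> (H \<inter> K) = {}"
    using K H(1) by (intro fell_tendsto_miss[OF ST] closed_Int_compact) auto
  then show "\<forall>\<^sub>F i in F. S i \<inter> H \<inter> K = {}" by eventually_elim blast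
qed

lemma fell_tendsto_future_at:
  assumes ST: "fell_tendsto S T F" "closed T" and x: "(x \<longlongrightarrow> y) F" "y \<in> T" "\<forall>\<^sub>F i in F. x i \<in> S i"
  shows "fell_tendsto (\<lambda>i. future_at (x i) (S i)) (future_at y T) F"
  unfolding future_at_def
proof (rule fell_tendsto_half_line)
  show "fell_tendsto (\<lambda>i. (+) (- x i) ` S i) ((+) (- y) ` T) F"
    by (intro fell_tendsto_translate ST tendsto_minus x)
  show "0 \<in> (+) (- y) ` T" using x(2) by force
  show "\<forall>\<^sub>F i in F. 0 \<in> (+) (- x i) ` S i" using x(3) by eventually_elim force
qed (auto simp: interior_real_atLeast)

text \<open>Recentring at the cut fixes the half-line, so that a moving cut reduces to a moving
  translation.\<close>

lemma past_at_alt: "past_at x S = (+) x ` ((+) (- x) ` S \<inter> {..0})"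
  by (force simp: past_at_def image_iff)

lemma fell_tendsto_past_at:
  assumes ST: "fell_tendsto S T F" "closed T" and x: "(x \<longlongrightarrow> y) F" "y \<in> T" "\<forall>\<^sub>F i in F. x i \<in> S i"
  shows "fell_tendsto (\<lambda>i. past_at (x i) (S i)) (past_at y T) F"
  unfolding past_at_alt
proof (rule fell_tendsto_translate[OF fell_tendsto_half_line _ x(1)])
  show "fell_tendsto (\<lambda>i. (+) (- x i) ` S i) ((+) (- y) ` T) F"
    by (intro fell_tendsto_translate ST tendsto_minus x)
  show "0 \<in> (+) (- y) ` T" using x(2) by force
  show "\<forall>\<^sub>F i in F. 0 \<in> (+) (- x i) ` S i" using x(3) by eventually_elim force
  show "closed ((+) (- y) ` T \<inter> {..0})" by (intro closed_Int closed_translation ST) auto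
qed (auto simp: interior_real_atMost)

section \<open>Measurability of cuts and of first points\<close>

definition first_from :: "real \<Rightarrow> real set \<Rightarrow> real" where
  "first_from t S = Inf (S \<inter> {t..})"

lemma first_from:
  assumes "closed S" "S \<inter> {t..} \<noteq> {}"
  shows "first_from t S \<in> S" "t \<le> first_from t S" "\<And>s. s \<in> S \<Longrightarrow> t \<le> s \<Longrightarrow> first_from t S \<le> s"
proof -
  have bdd: "bdd_below (S \<inter> {t..})" by (rule bdd_belowI[of _ t]) auto
  have "first_from t S \<in> S \<inter> {t..}"
    unfolding first_from_def using assms by (intro closed_contains_Inf bdd closed_Int) auto
  then show "first_from t S \<in> S" "t \<le> first_from t S" by auto
  show "first_from t S \<le> s" if "s \<in> S" "t \<le> s" for s
    unfolding first_from_def using that by (intro cInf_lower bdd) auto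
qed

lemma measurable_id_closed_sets: "(\<lambda>S. S) \<in> measurable closed_sets closed_sets"
  by (rule measurable_ident_sets) simp

text \<open>Random end points are replaced by rational ones squeezed between them and a point of the
  set.\<close>

lemma pred_hit_moving_interval:
  assumes S: "S \<in> measurable M closed_sets"
    and x [measurable]: "x \<in> borel_measurable M" and y [measurable]: "y \<in> borel_measurable M"
  shows "{w \<in> space M. S w \<inter> {x w<..<y w :: real} \<noteq> {}} \<in> sets M"
proof -
  have hit: "{w \<in> space M. S w \<inter> {p<..<q} \<noteq> {}} \<in> sets M" for p q
  proof -
    have "S -` {S. closed S \<and> S \<inter> {p<..<q} \<noteq> {}} \<inter> space M \<in> sets M"
      using S hit_interval_in_closed_sets by (rule measurable_sets)
    also have "S -` {S. closed S \<and> S \<inter> {p<..<q} \<noteq> {}} \<inter> space M = {w \<in> space M. S w \<inter> {p<..<q} \<noteq> {}}"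
      using measurable_space[OF S] by auto
    finally show ?thesis .
  qed
  have "{w \<in> space M. S w \<inter> {x w<..<y w} \<noteq> {}} =
    (\<Union>p\<in>\<rat>. \<Union>q\<in>\<rat>. {w \<in> space M. S w \<inter> {p<..<q} \<noteq> {}} \<inter> {w \<in> space M. x w \<le> p \<and> q \<le> y w})"
  proof (intro equalityI subsetI)
    fix w assume "w \<in> {w \<in> space M. S w \<inter> {x w<..<y w} \<noteq> {}}"
    then obtain s where s: "w \<in> space M" "s \<in> S w" "x w < s" "s < y w" by auto
    obtain p where p: "p \<in> \<rat>" "x w < p" "p < s" using Rats_dense_in_real[OF s(3)] by blast
    obtain q where q: "q \<in> \<rat>" "s < q" "q < y w" using Rats_dense_in_real[OF s(4)] by blast
    show "w \<in> (\<Union>p\<in>\<rat>. \<Union>q\<in>\<rat>. {w \<in> space M. S w \<inter> {p<..<q} \<noteq> {}} \<inter> {w \<in> space M. x w \<le> p \<and> q \<le> y w})"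
      using s p q by (intro UN_I[of p] UN_I[of q]) auto
  next
    fix w assume "w \<in> (\<Union>p\<in>\<rat>. \<Union>q\<in>\<rat>. {w \<in> space M. S w \<inter> {p<..<q} \<noteq> {}} \<inter> {w \<in> space M. x w \<le> p \<and> q \<le> y w})"
    then obtain p q where pq: "w \<in> space M" "S w \<inter> {p<..<q} \<noteq> {}" "x w \<le> p" "q \<le> y w" by blast
    then obtain s where "s \<in> S w" "p < s" "s < q" by auto
    then have "s \<in> S w \<inter> {x w<..<y w}" using pq by auto
    then show "w \<in> {w \<in> space M. S w \<inter> {x w<..<y w} \<noteq> {}}" using pq(1) by blast
  qed
  also have "\<dots> \<in> sets M"
    by (intro sets.countable_UN'' countable_rat sets.Int hit) measurable
  finally show ?thesis .
qed

lemma measurable_translate: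
  assumes f: "f \<in> measurable M closed_sets"
  shows "(\<lambda>w. (+) (u :: real) ` f w) \<in> measurable M closed_sets"
proof (rule measurable_closed_setsI)
  fix a b :: real
  have "{w \<in> space M. (+) u ` f w \<inter> {a<..<b} \<noteq> {}} = {w \<in> space M. f w \<inter> {a - u<..<b - u} \<noteq> {}}"
  proof (intro Collect_cong conj_cong refl)
    fix w
    show "(+) u ` f w \<inter> {a<..<b} \<noteq> {} \<longleftrightarrow> f w \<inter> {a - u<..<b - u} \<noteq> {}"
    proof
      assume "f w \<inter> {a - u<..<b - u} \<noteq> {}"
      then obtain s where "s \<in> f w" "a - u < s" "s < b - u" by auto
      then have "u + s \<in> (+) u ` f w \<inter> {a<..<b}" by auto
      then show "(+) u ` f w \<inter> {a<..<b} \<noteq> {}" by blast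
    qed force
  qed
  also have "\<dots> \<in> sets M" using f by (intro pred_hit_moving_interval) auto
  finally show "{w \<in> space M. (+) u ` f w \<inter> {a<..<b} \<noteq> {}} \<in> sets M" .
qed (use measurable_space[OF f] in \<open>auto intro!: closed_translation\<close>)

lemma pred_mem_closed_set:
  assumes S: "S \<in> measurable M closed_sets" and x [measurable]: "x \<in> borel_measurable M"
  shows "{w \<in> space M. x w \<in> S w} \<in> sets M"
proof -
  have "{w \<in> space M. x w \<in> S w} =
    {w \<in> space M. \<forall>n. S w \<inter> {x w - 1 / Suc n<..<x w + 1 / Suc n} \<noteq> {}}" (is "?L = ?R")
  proof (intro equalityI subsetI)
    fix w assume "w \<in> ?L"
    then show "w \<in> ?R" by (auto intro!: exI[of _ "x w"])
  next
    fix w assume w: "w \<in> ?R"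
    then have "w \<in> space M" by blast
    then have cl: "closed (S w)" using measurable_space[OF S] by simp
    have "\<exists>s\<in>S w. dist s (x w) < e" if e: "e > 0" for e
    proof -
      obtain n where n: "1 / real (Suc n) < e" using nat_approx_posE[OF e] by metis
      have "S w \<inter> {x w - 1 / Suc n<..<x w + 1 / Suc n} \<noteq> {}" using w by blast
      then obtain s where "s \<in> S w" "x w - 1 / Suc n < s" "s < x w + 1 / Suc n" by auto
      then show ?thesis using n by (intro bexI[of _ s]) (auto simp: dist_real_def)
    qed
    then show "w \<in> ?L" using closed_approachable[OF cl] \<open>w \<in> space M\<close> by blast
  qed
  also have "\<dots> \<in> sets M"
    by (intro sets.sets_Collect_countable_All pred_hit_moving_interval S) measurable
  finally show ?thesis .
qed

lemma measurable_past_at: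
  assumes S: "S \<in> measurable M closed_sets" and x [measurable]: "x \<in> borel_measurable M"
  shows "(\<lambda>w. past_at (x w) (S w)) \<in> measurable M closed_sets"
proof (rule measurable_closed_setsI)
  fix a b :: real
  \<comment> \<open>The cut itself belongs to the past but to no open interval ending there, hence
    the separate first event.\<close>
  have "{w \<in> space M. past_at (x w) (S w) \<inter> {a<..<b} \<noteq> {}} =
    ({w \<in> space M. x w \<in> S w} \<inter> {w \<in> space M. a < x w \<and> x w < b}) \<union>
    {w \<in> space M. S w \<inter> {a<..<min b (x w)} \<noteq> {}}" (is "?L = ?R")
  proof (intro equalityI subsetI)
    fix w assume "w \<in> ?L"
    then obtain s where "w \<in> space M" "s \<in> S w" "s \<le> x w" "a < s" "s < b" by (auto simp: past_at_def)
    then show "w \<in> ?R" by (cases "s = x w") auto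
  qed (auto simp: past_at_def)
  also have "\<dots> \<in> sets M"
    by (intro sets.Un sets.Int pred_mem_closed_set pred_hit_moving_interval S) measurable
  finally show "{w \<in> space M. past_at (x w) (S w) \<inter> {a<..<b} \<noteq> {}} \<in> sets M" .
qed (use measurable_space[OF S] closed_past_at in auto)

lemma measurable_future_at:
  assumes S: "S \<in> measurable M closed_sets" and x [measurable]: "x \<in> borel_measurable M"
  shows "(\<lambda>w. future_at (x w) (S w)) \<in> measurable M closed_sets"
proof (rule measurable_closed_setsI)
  fix a b :: real
  have "{w \<in> space M. future_at (x w) (S w) \<inter> {a<..<b} \<noteq> {}} =
    ({w \<in> space M. x w \<in> S w} \<inter> {w \<in> space M. a < 0 \<and> 0 < b}) \<union>
    {w \<in> space M. S w \<inter> {x w + max a 0<..<x w + b} \<noteq> {}}" (is "?L = ?R")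
  proof (intro equalityI subsetI)
    fix w assume "w \<in> ?L"
    then obtain y where "w \<in> space M" "x w + y \<in> S w" "0 \<le> y" "a < y" "y < b" by (auto simp: mem_future_at)
    then show "w \<in> ?R" by (cases "y = 0") (auto intro!: exI[of _ "x w + y"])
  next
    fix w assume "w \<in> ?R"
    then consider "w \<in> space M" "x w \<in> S w" "a < 0" "0 < b"
      | s where "w \<in> space M" "s \<in> S w" "x w + max a 0 < s" "s < x w + b" by auto
    then show "w \<in> ?L"
    proof cases
      case 1
      then have "0 \<in> future_at (x w) (S w) \<inter> {a<..<b}" by (auto simp: mem_future_at)
      then show ?thesis using 1 by blast
    next
      case (2 s)
      then have "s - x w \<in> future_at (x w) (S w) \<inter> {a<..<b}" by (auto simp: mem_future_at)
      then show ?thesis using 2 by blast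
    qed
  qed
  also have "\<dots> \<in> sets M"
    by (intro sets.Un sets.Int pred_mem_closed_set pred_hit_moving_interval S) measurable
  finally show "{w \<in> space M. future_at (x w) (S w) \<inter> {a<..<b} \<noteq> {}} \<in> sets M" .
qed (use measurable_space[OF S] closed_future_at in auto)

lemma mem_shifted_future_base:
  fixes S :: "real set"
  shows "{s - t | s. s \<in> S \<and> s > t} = {y. 0 < y \<and> t + y \<in> S}"
proof (intro set_eqI iffI)
  fix y assume "y \<in> {y. 0 < y \<and> t + y \<in> S}"
  then show "y \<in> {s - t | s. s \<in> S \<and> s > t}" by (intro CollectI exI[of _ "t + y"]) auto
qed auto

text \<open>The closure makes no difference to hitting an open interval.\<close>

lemma measurable_shifted_future:
  assumes S: "S \<in> measurable M closed_sets" and x [measurable]: "x \<in> borel_measurable M"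
  shows "(\<lambda>w. shifted_future (x w) (S w)) \<in> measurable M closed_sets"
proof (rule measurable_closed_setsI)
  fix a b :: real
  have "{w \<in> space M. shifted_future (x w) (S w) \<inter> {a<..<b} \<noteq> {}} =
    {w \<in> space M. S w \<inter> {x w + max a 0<..<x w + b} \<noteq> {}}"
  proof (intro Collect_cong conj_cong refl)
    fix w
    have "shifted_future (x w) (S w) \<inter> {a<..<b} \<noteq> {} \<longleftrightarrow> {y. 0 < y \<and> x w + y \<in> S w} \<inter> {a<..<b} \<noteq> {}"
      unfolding shifted_future_def mem_shifted_future_base
      using open_Int_closure_eq_empty[of "{a<..<b}"] by (metis Int_commute open_greaterThanLessThan)
    also have "\<dots> \<longleftrightarrow> S w \<inter> {x w + max a 0<..<x w + b} \<noteq> {}"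
    proof
      assume "{y. 0 < y \<and> x w + y \<in> S w} \<inter> {a<..<b} \<noteq> {}"
      then obtain y where "0 < y" "x w + y \<in> S w" "a < y" "y < b" by auto
      then have "x w + y \<in> S w \<inter> {x w + max a 0<..<x w + b}" by auto
      then show "S w \<inter> {x w + max a 0<..<x w + b} \<noteq> {}" by blast
    next
      assume "S w \<inter> {x w + max a 0<..<x w + b} \<noteq> {}"
      then obtain s where "s \<in> S w" "x w + max a 0 < s" "s < x w + b" by auto
      then have "s - x w \<in> {y. 0 < y \<and> x w + y \<in> S w} \<inter> {a<..<b}" by auto
      then show "{y. 0 < y \<and> x w + y \<in> S w} \<inter> {a<..<b} \<noteq> {}" by blast
    qed
    finally show "shifted_future (x w) (S w) \<inter> {a<..<b} \<noteq> {} \<longleftrightarrow> S w \<inter> {x w + max a 0<..<x w + b} \<noteq> {}" .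
  qed
  also have "\<dots> \<in> sets M" by (intro pred_hit_moving_interval S) measurable
  finally show "{w \<in> space M. shifted_future (x w) (S w) \<inter> {a<..<b} \<noteq> {}} \<in> sets M" .
qed (simp add: shifted_future_def)

text \<open>The limit argument keeps the cut point in the future part, whereas regeneration looks
  only at points strictly after it. This identity leads from one to the other.\<close>

lemma shifted_future_future_at: "shifted_future 0 (future_at x S) = shifted_future x S"
  unfolding shifted_future_def mem_shifted_future_base mem_future_at
  by (rule arg_cong[where f = closure]) auto

lemma pred_nonempty_from:
  assumes S: "S \<in> measurable M closed_sets"
  shows "{w \<in> space M. S w \<inter> {t..} \<noteq> {}} \<in> sets M"
proof -
  have "{w \<in> space M. S w \<inter> {t..} \<noteq> {}} =
    {w \<in> space M. t \<in> S w} \<union> (\<Union>n. {w \<in> space M. S w \<inter> {t<..<t + real n} \<noteq> {}})" (is "?L = ?R")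
  proof (intro equalityI subsetI)
    fix w assume "w \<in> ?L"
    then obtain s where s: "w \<in> space M" "s \<in> S w" "t \<le> s" by auto
    obtain n :: nat where "s - t < n" using reals_Archimedean2 by blast
    then have "s = t \<or> s \<in> S w \<inter> {t<..<t + real n}" using s by auto
    then show "w \<in> ?R" using s by blast
  qed force
  also have "\<dots> \<in> sets M"
    by (intro sets.Un sets.countable_UN pred_mem_closed_set pred_hit_moving_interval S image_subsetI) measurable
  finally show ?thesis .
qed

lemma measurable_first_from:
  assumes S: "S \<in> measurable M closed_sets"
  shows "(\<lambda>w. first_from t (S w)) \<in> borel_measurable M"
  unfolding borel_measurable_iff_less
proof
  fix e
  \<comment> \<open>On the event without a point from \<open>t\<close> on, \<open>first_from\<close>
    takes the default value \<open>Inf {}\<close>.\<close>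
  have "{w \<in> space M. first_from t (S w) < e} =
    ({w \<in> space M. S w \<inter> {t..} \<noteq> {}} \<inter> ({w \<in> space M. t \<in> S w \<and> t < e} \<union> {w \<in> space M. S w \<inter> {t<..<e} \<noteq> {}})) \<union>
    ((space M - {w \<in> space M. S w \<inter> {t..} \<noteq> {}}) \<inter> {w \<in> space M. Inf {} < e})" (is "?L = ?R")
  proof (intro set_eqI)
    fix w
    show "w \<in> ?L \<longleftrightarrow> w \<in> ?R"
    proof (cases "S w \<inter> {t..} = {}")
      case True
      then show ?thesis by (auto simp: first_from_def)
    next
      case False
      show ?thesis
      proof (cases "w \<in> space M")
        case True
        then have "closed (S w)" using measurable_space[OF S] by simp
        note ff = first_from[OF this False]
        have "first_from t (S w) < e \<longleftrightarrow> (t \<in> S w \<and> t < e) \<or> S w \<inter> {t<..<e} \<noteq> {}"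
        proof
          assume "first_from t (S w) < e"
          then show "(t \<in> S w \<and> t < e) \<or> S w \<inter> {t<..<e} \<noteq> {}"
            using ff(1,2) by (cases "first_from t (S w) = t") auto
        next
          assume "(t \<in> S w \<and> t < e) \<or> S w \<inter> {t<..<e} \<noteq> {}"
          then obtain s where "s \<in> S w" "t \<le> s" "s < e" by force
          then show "first_from t (S w) < e" using ff(3) by fastforce
        qed
        then show ?thesis using False True by blast
      qed auto
    qed
  qed
  also have "\<dots> \<in> sets M"
  proof -
    have "{w \<in> space M. t \<in> S w \<and> t < e} = {w \<in> space M. t \<in> S w} \<inter> {w \<in> space M. t < e}" by auto
    also have "\<dots> \<in> sets M" by (intro sets.Int pred_mem_closed_set S) measurable
    finally have 1: "{w \<in> space M. t \<in> S w \<and> t < e} \<in> sets M" .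
    have "{w \<in> space M. S w \<inter> {t<..<e} \<noteq> {}} \<in> sets M" by (intro pred_hit_moving_interval S) measurable
    moreover have "{w \<in> space M. Inf {} < e} \<in> sets M" by measurable
    ultimately show ?thesis
      using 1 pred_nonempty_from[OF S, of t] by blast
  qed
  finally show "{w \<in> space M. first_from t (S w) < e} \<in> sets M" .
qed

lemma next_point_eq_wait: "next_point t S = wait t S + ereal t"
  by (cases "next_point t S") (auto simp: wait_def)

lemma measurable_next_point:
  assumes S: "S \<in> measurable M closed_sets"
  shows "(\<lambda>w. next_point t (S w)) \<in> borel_measurable M"
proof -
  have "wait t \<in> borel_measurable closed_sets"
  proof (rule measurableI)
    fix B :: "ereal set" assume "B \<in> sets borel"
    then have "{S. closed S \<and> wait t S \<in> B} \<in> sets closed_sets"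
      unfolding sets_closed_sets by (intro sigma_sets.Basic) blast
    also have "{S. closed S \<and> wait t S \<in> B} = wait t -` B \<inter> space closed_sets" by auto
    finally show "wait t -` B \<inter> space closed_sets \<in> sets closed_sets" .
  qed simp
  from measurable_compose[OF S this] show ?thesis
    unfolding next_point_eq_wait by measurable
qed

text \<open>Only \<open>t \<le> d\<close> holds in general: if points of \<open>S\<close> accumulate
  at \<open>t\<close> from the right, the next point is \<open>t\<close> itself. The last clause
  covers both cases.\<close>

lemma next_point_real:
  assumes "closed S" "S \<inter> {t<..} \<noteq> {}"
  defines "d \<equiv> real_of_ereal (next_point t S)"
  shows "next_point t S = ereal d" "d \<in> S" "t \<le> d" "\<And>s. s \<in> S \<Longrightarrow> t < s \<Longrightarrow> d \<le> s"
    "\<And>e. d < e \<Longrightarrow> \<exists>s\<in>S. t < s \<and> s < e"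
proof -
  obtain s0 where s0: "s0 \<in> S" "t < s0" using assms(2) by auto
  have "next_point t S \<le> ereal s0"
    unfolding next_point_def using s0 by (intro Inf_lower) auto
  moreover have "ereal t \<le> next_point t S"
    unfolding next_point_def by (rule Inf_greatest) auto
  ultimately show d: "next_point t S = ereal d"
    unfolding d_def by (cases "next_point t S") auto
  show "t \<le> d" using \<open>ereal t \<le> next_point t S\<close> d by simp
  show le: "d \<le> s" if "s \<in> S" "t < s" for s
  proof -
    have "next_point t S \<le> ereal s" unfolding next_point_def using that by (intro Inf_lower) auto
    then show ?thesis by (simp add: d)
  qed
  show ex: "\<exists>s\<in>S. t < s \<and> s < e" if "d < e" for e
    using next_point_less_iff[of t S "ereal e"] that by (auto simp: d)
  have "\<exists>s\<in>S. dist s d < e" if "e > 0" for e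
    using ex[of "d + e"] le that by (force simp: dist_real_def)
  then show "d \<in> S" using closed_approachable[OF assms(1)] by blast
qed

section \<open>Increments of two-sided Levy processes\<close>

text \<open>One-sided limits bound the path near each time, and finitely many such neighbourhoods
  cover the interval.\<close>

lemma cadlag_bounded:
  assumes f: "cadlag f"
  shows "\<exists>L. \<forall>t\<in>{a..b}. \<bar>f t\<bar> \<le> L"
proof -
  have "\<exists>L. \<exists>r>0. \<forall>s\<in>ball t r. \<bar>f s\<bar> \<le> L" for t
  proof -
    define L where "L = max (\<bar>f t\<bar> + 1) (\<bar>left_limit f t\<bar> + 1)"
    have "\<forall>\<^sub>F s in at_right t. \<bar>f s\<bar> < L"
      by (rule order_tendstoD(2)[OF tendsto_rabs[OF cadlag_tendsto_right[OF f]]]) (simp add: L_def)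
    moreover have "\<forall>\<^sub>F s in at_left t. \<bar>f s\<bar> < L"
      by (rule order_tendstoD(2)[OF tendsto_rabs[OF cadlag_tendsto_left[OF f]]]) (simp add: L_def)
    ultimately have "\<forall>\<^sub>F s in nhds t. \<bar>f s\<bar> < L"
      by (auto simp: eventually_nhds_conv_at eventually_at_split L_def)
    then obtain r where "r > 0" "\<And>s. dist s t < r \<Longrightarrow> \<bar>f s\<bar> < L" by (auto simp: eventually_nhds_metric)
    then show ?thesis by (intro exI[of _ L] exI[of _ r]) (auto simp: dist_commute less_imp_le)
  qed
  then obtain L r where Lr: "\<And>t. r t > 0" "\<And>t s. s \<in> ball t (r t) \<Longrightarrow> \<bar>f s\<bar> \<le> L t" by metis
  have "{a..b} \<subseteq> (\<Union>t\<in>{a..b}. ball t (r t))" using Lr(1) by auto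
  then obtain C where C: "C \<subseteq> {a..b}" "finite C" "{a..b} \<subseteq> (\<Union>t\<in>C. ball t (r t))"
    by (rule compactE_image[OF compact_Icc open_ball])
  have "\<bar>f t\<bar> \<le> (\<Sum>t\<in>C. \<bar>L t\<bar>)" if t: "t \<in> {a..b}" for t
  proof -
    obtain c where c: "c \<in> C" "t \<in> ball c (r c)" using C(3) t by blast
    then have "\<bar>f t\<bar> \<le> \<bar>L c\<bar>" using Lr(2)[OF c(2)] by simp
    also have "\<dots> \<le> (\<Sum>t\<in>C. \<bar>L t\<bar>)" using c C(2) by (intro member_le_sum) auto
    finally show ?thesis .
  qed
  then show ?thesis by blast
qed

context two_sided_levy_process
begin

lemmas measurable_X [measurable] = random_variable_X

definition increment :: "real \<Rightarrow> int \<Rightarrow> 'a \<Rightarrow> real" where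
  "increment h i w = X (h * of_int (i + 1)) w - X (h * of_int i) w"

text \<open>The axioms only separate one increment from the past before it. Mutual independence
  follows by induction on the largest index, all other increments of the finite family being past
  for it.\<close>

lemma iid_increment:
  assumes h: "h > 0"
  shows "iid_family P (increment h)"
proof
  have meas: "increment h i \<in> borel_measurable P" for i unfolding increment_def[abs_def] by measurable
  have lt: "h * of_int i < h * of_int (i + 1)" for i using h by simp
  show "distr P borel (increment h i) = distr P borel (increment h j)" for i j
  proof -
    have "distr P borel (increment h i) = distr P borel (X h)" for i
      unfolding increment_def[abs_def]
      using stationary_increments[OF lt[of i]] by (simp add: algebra_simps)
    then show ?thesis by simp
  qed
  define gen where "gen s = {X r -` B \<inter> space P | r B. r \<le> s \<and> B \<in> sets borel}" for s
  define N where "N s = sigma (space P) (gen s)" for s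
  have N: "sets (N s) = sigma_sets (space P) (gen s)" "space (N s) = space P" for s
    unfolding N_def by (auto simp: gen_def sets_measure_of_conv space_measure_of_conv)
  have XN: "X r \<in> borel_measurable (N s)" if "r \<le> s" for r s
  proof (rule measurableI)
    fix B :: "real set" assume "B \<in> sets borel"
    then show "X r -` B \<inter> space (N s) \<in> sets (N s)"
      unfolding N using that by (intro sigma_sets.Basic) (auto simp: gen_def)
  qed simp
  define F where "F i = {increment h i -` A \<inter> space P | A. A \<in> sets borel}" for i
  have FN: "A \<in> sets (N s)" if A: "A \<in> F i" and s: "h * of_int (i + 1) \<le> s" for A i s
  proof -
    obtain B where B: "B \<in> sets borel" "A = increment h i -` B \<inter> space P" using A by (auto simp: F_def)
    have [measurable]: "X (h * of_int (i + 1)) \<in> borel_measurable (N s)" "X (h * of_int i) \<in> borel_measurable (N s)"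
      using s lt[of i] by (auto intro!: XN)
    have "increment h i \<in> borel_measurable (N s)" unfolding increment_def[abs_def] by measurable
    from measurable_sets[OF this B(1)] show ?thesis by (simp add: B N)
  qed
  have "indep_sets F UNIV"
  proof (rule indep_setsI)
    show "F i \<subseteq> events" for i using measurable_sets[OF meas] by (auto simp: F_def)
    fix A and J :: "int set" assume "J \<noteq> {}" "finite J" "\<forall>j\<in>J. A j \<in> F j"
    have "prob (space P \<inter> (\<Inter>j\<in>J. A j)) = (\<Prod>j\<in>J. prob (A j))"
      using \<open>finite J\<close> \<open>\<forall>j\<in>J. A j \<in> F j\<close>
    proof (induction J rule: finite_linorder_max_induct)
      case empty
      then show ?case by (simp add: prob_space)
    next
      case (insert b J)
      define E where "E = space P \<inter> (\<Inter>j\<in>J. A j)"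
      have "A j \<in> sets (N (h * of_int b))" if "j \<in> J" for j
      proof (rule FN)
        show "A j \<in> F j" using insert that by blast
        have "j + 1 \<le> b" using insert that by force
        then show "h * of_int (j + 1) \<le> h * of_int b" using h by (intro mult_left_mono) auto
      qed
      then have "space (N (h * of_int b)) \<inter> (\<Inter>j\<in>J. A j) \<in> sets (N (h * of_int b))"
        using insert(1) by (cases "J = {}") (auto intro!: sets.Int sets.finite_INT)
      then have E: "E \<in> sigma_sets (space P) (gen (h * of_int b))" by (simp add: E_def N)
      have "A b \<in> F b" using insert by blast
      then have Ab: "A b \<in> {(\<lambda>w. X (h * of_int (b + 1)) w - X (h * of_int b) w) -` B \<inter> space P | B. B \<in> sets borel}"
        unfolding F_def increment_def[abs_def] .
      have "space P \<inter> (\<Inter>j\<in>insert b J. A j) = A b \<inter> E"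
        using \<open>A b \<in> F b\<close> by (auto simp: E_def F_def)
      then have "prob (space P \<inter> (\<Inter>j\<in>insert b J. A j)) = prob (A b) * prob E"
        using indep_setD[OF indep_increments[OF lt[of b]] Ab] E by (simp add: gen_def)
      also have "prob E = (\<Prod>j\<in>J. prob (A j))" unfolding E_def using insert by blast
      also have "prob (A b) * (\<Prod>j\<in>J. prob (A j)) = (\<Prod>j\<in>insert b J. prob (A j))"
        using insert by (subst prod.insert) auto
      finally show ?case .
    qed
    moreover have "space P \<inter> (\<Inter>j\<in>J. A j) = (\<Inter>j\<in>J. A j)"
      using \<open>J \<noteq> {}\<close> \<open>\<forall>j\<in>J. A j \<in> F j\<close> by (auto simp: F_def)
    ultimately show "prob (\<Inter>j\<in>J. A j) = (\<Prod>j\<in>J. prob (A j))" by simp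
  qed
  then show "indep_vars (\<lambda>_. borel) (increment h) UNIV"
    unfolding indep_vars_def2 F_def[abs_def] using meas by simp
qed

lemma X_eq_psum:
  assumes "w \<in> space P"
  shows "X (h * of_int k) w = psum (\<lambda>i. increment h i w) k"
  by (rule psum_unique[where y = "\<lambda>k. X (h * of_int k) w"])
    (use X_zero[OF assms] in \<open>auto simp: increment_def\<close>)

text \<open>The drift \<open>a\<close> gives a positive mean in both time directions, so the
  one-sided result applies to each half-line.\<close>

lemma dyadic_bounded_below:
  assumes "integrable P (X 1)" "\<bar>expectation (X 1)\<bar> < a"
  shows "AE w in P. \<exists>c. \<forall>n i. c \<le> X (of_int i / 2 ^ n) w + a * \<bar>of_int i / 2 ^ n\<bar>"
proof -
  define F where "F t w = X t w + a * t" for t w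
  define B where "B t w = X (- t) w + a * t" for t w
  have "AE w in P. \<exists>c. \<forall>n i. c \<le> F (real i / 2 ^ n) w"
  proof (rule AE_dyadic_bounded_below)
    fix n :: nat
    have "iid_family P (\<lambda>i w. increment (1 / 2 ^ n) (int i) w + a / 2 ^ n)"
      by (rule iid_family.iid_family_reindex[OF iid_increment, where g = "\<lambda>x. x + a / 2 ^ n"]) auto
    also have "(\<lambda>i w. increment (1 / 2 ^ n) (int i) w + a / 2 ^ n) =
        (\<lambda>i w. F (real (Suc i) / 2 ^ n) w - F (real i / 2 ^ n) w)"
      by (simp add: fun_eq_iff F_def increment_def add_divide_distrib distrib_left add.commute)
    finally show "iid_family P (\<lambda>i w. F (real (Suc i) / 2 ^ n) w - F (real i / 2 ^ n) w)" .
  next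
    fix w assume w: "w \<in> space P"
    show "F 0 w = 0" using X_zero[OF w] by (simp add: F_def)
    obtain L where L: "\<forall>t\<in>{0..1}. \<bar>X t w\<bar> \<le> L" using cadlag_bounded[OF cadlag_paths[OF w]] by blast
    have "F t w \<le> L + \<bar>a\<bar>" if "t \<in> {0..1}" for t
    proof -
      have "a * t \<le> \<bar>a\<bar> * 1" using that assms(2) by (intro mult_mono) auto
      then show ?thesis using L that by (force simp: F_def)
    qed
    then show "\<exists>L. \<forall>t\<in>{0..1}. F t w \<le> L" by blast
  next
    show "F t \<in> borel_measurable P" for t unfolding F_def[abs_def] by measurable
    show "integrable P (F 1)" unfolding F_def[abs_def] using assms(1) by simp
    show "0 < expectation (F 1)" unfolding F_def[abs_def] using assms by (simp add: prob_space)
  qed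
  moreover have "AE w in P. \<exists>c. \<forall>n i. c \<le> B (real i / 2 ^ n) w"
  proof (rule AE_dyadic_bounded_below)
    fix n :: nat
    \<comment> \<open>Time reversal: step \<open>i\<close> of \<open>B\<close> runs backwards over
      the increment with index \<open>- (i + 1)\<close>.\<close>
    have "iid_family P (\<lambda>i w. - increment (1 / 2 ^ n) (- (int i + 1)) w + a / 2 ^ n)"
      by (rule iid_family.iid_family_reindex[OF iid_increment, where g = "\<lambda>x. - x + a / 2 ^ n"])
        (auto simp: inj_def)
    also have "(\<lambda>i w. - increment (1 / 2 ^ n) (- (int i + 1)) w + a / 2 ^ n) =
        (\<lambda>i w. B (real (Suc i) / 2 ^ n) w - B (real i / 2 ^ n) w)"
      by (simp add: fun_eq_iff B_def increment_def add_divide_distrib diff_divide_distrib distrib_left add.commute)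
    finally show "iid_family P (\<lambda>i w. B (real (Suc i) / 2 ^ n) w - B (real i / 2 ^ n) w)" .
  next
    fix w assume w: "w \<in> space P"
    show "B 0 w = 0" using X_zero[OF w] by (simp add: B_def)
    obtain L where L: "\<forall>t\<in>{-1..0}. \<bar>X t w\<bar> \<le> L" using cadlag_bounded[OF cadlag_paths[OF w]] by blast
    have "B t w \<le> L + \<bar>a\<bar>" if "t \<in> {0..1}" for t
    proof -
      have "a * t \<le> \<bar>a\<bar> * 1" using that assms(2) by (intro mult_mono) auto
      moreover have "\<bar>X (- t) w\<bar> \<le> L" using L that by auto
      ultimately show ?thesis by (auto simp: B_def)
    qed
    then show "\<exists>L. \<forall>t\<in>{0..1}. B t w \<le> L" by blast
  next
    interpret I: iid_family P "increment 1" by (rule iid_increment) simp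
    have eq: "increment 1 0 w = X 1 w" "increment 1 (- 1) w = - X (- 1) w" if "w \<in> space P" for w
      using X_zero[OF that] by (auto simp: increment_def)
    have int0: "integrable P (increment 1 0)"
      using assms(1) by (subst Bochner_Integration.integrable_cong[OF refl eq(1)])
    have int1: "integrable P (increment 1 (- 1))" by (rule I.integrable_ident[OF int0])
    have ex: "expectation (increment 1 (- 1)) = expectation (X 1)"
    proof -
      have "expectation (increment 1 i) = integral\<^sup>L (distr P borel (increment 1 i)) (\<lambda>x. x)" for i
        by (subst integral_distr) auto
      then have "expectation (increment 1 (- 1)) = expectation (increment 1 0)" using I.ident by metis
      also have "\<dots> = expectation (X 1)" by (rule Bochner_Integration.integral_cong[OF refl eq(1)])
      finally show ?thesis .
    qed
    show "B t \<in> borel_measurable P" for t unfolding B_def[abs_def] by measurable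
    \<comment> \<open>\<open>- X (- 1)\<close> is also a unit increment and has the mean of
      \<open>X 1\<close>, so the mean of \<open>B 1\<close> is \<open>a\<close> minus that of
      \<open>X 1\<close>.\<close>
    have B1: "B 1 w = a - increment 1 (- 1) w" if "w \<in> space P" for w using eq(2)[OF that] by (simp add: B_def)
    show "integrable P (B 1)"
      using int1 by (subst Bochner_Integration.integrable_cong[OF refl B1]) auto
    show "0 < expectation (B 1)"
      using int1 ex assms by (subst Bochner_Integration.integral_cong[OF refl B1]) (auto simp: prob_space)
  qed
  ultimately show ?thesis
  proof eventually_elim
    case (elim w)
    then obtain c d where cd: "\<And>n i. c \<le> F (real i / 2 ^ n) w" "\<And>n i. d \<le> B (real i / 2 ^ n) w" by blast
    have "min c d \<le> X (of_int i / 2 ^ n) w + a * \<bar>of_int i / 2 ^ n\<bar>" for n and i :: int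
    proof (cases "0 \<le> i")
      case True
      then show ?thesis using cd(1)[of "nat i" n] by (simp add: F_def min.coboundedI1)
    next
      case False
      then show ?thesis using cd(2)[of "nat (- i)" n] by (simp add: B_def min.coboundedI2)
    qed
    then show ?case by blast
  qed
qed

text \<open>Choosing \<open>a\<close> strictly between the absolute mean and \<open>\<alpha>\<close>
  leaves the gap needed for coercivity. Right continuity extends the dyadic bound to all
  times.\<close>

lemma AE_touch_set_nonempty:
  assumes "integrable P (X 1)" "\<bar>expectation (X 1)\<bar> < \<alpha>"
  shows "AE w in P. touch_set \<alpha> (\<lambda>t. X t w) \<noteq> {}"
proof -
  obtain a where a: "\<bar>expectation (X 1)\<bar> < a" "a < \<alpha>" using dense[OF assms(2)] by blast
  show ?thesis
    using dyadic_bounded_below[OF assms(1) a(1)] AE_space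
  proof eventually_elim
    case (elim w)
    then obtain c where c: "\<And>n i. c \<le> X (of_int i / 2 ^ n) w + a * \<bar>of_int i / 2 ^ n\<bar>" by blast
    note f = cadlag_paths[OF elim(2)]
    have "c \<le> X u w + a * \<bar>u\<bar>" for u
    proof (rule ccontr)
      assume "\<not> c \<le> X u w + a * \<bar>u\<bar>"
      \<comment> \<open>Half the deficit pays for the path value at a dyadic point after
        \<open>u\<close>, the other half for the change of the cone over one mesh.\<close>
      define d where "d = (c - (X u w + a * \<bar>u\<bar>)) / 2"
      have d: "d > 0" "c = X u w + a * \<bar>u\<bar> + 2 * d" using \<open>\<not> _\<close> by (auto simp: d_def field_simps)
      have "((\<lambda>n. (1 / 2) ^ n) \<longlongrightarrow> (0::real)) sequentially" by (intro LIMSEQ_power_zero) auto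
      then have "filterlim (\<lambda>n. (1 / 2) ^ n :: real) (at_right 0) sequentially"
        by (auto simp: filterlim_at)
      then have h: "filterlim (\<lambda>n. 1 / 2 ^ n :: real) (at_right 0) sequentially"
        by (simp add: power_one_over)
      have "\<forall>\<^sub>F h in at_right (0::real). 0 < h \<and> h \<le> d / a"
        using d a by (intro eventually_at_right_0_le) auto
      moreover have "\<forall>\<^sub>F h in at_right 0. \<exists>k::int. u < h * of_int k \<and> h * of_int k \<le> u + h \<and> X (h * of_int k) w < X u w + d"
        using eventually_grid_right[OF f, of u "X u w + d"] d by simp
      ultimately have "\<forall>\<^sub>F h in at_right 0. (0 < h \<and> h \<le> d / a) \<and> (\<exists>k::int. u < h * of_int k \<and> h * of_int k \<le> u + h \<and> X (h * of_int k) w < X u w + d)"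
        by (rule eventually_conj)
      from eventually_compose_filterlim[OF this h] obtain n and k :: int where
        n: "1 / 2 ^ n \<le> d / a" and k: "u < 1 / 2 ^ n * of_int k" "1 / 2 ^ n * of_int k \<le> u + 1 / 2 ^ n"
          "X (1 / 2 ^ n * of_int k) w < X u w + d"
        using eventually_happens[of _ sequentially] by force
      have "a * \<bar>1 / 2 ^ n * of_int k\<bar> \<le> a * (\<bar>u\<bar> + d / a)"
        using a k n by (intro mult_left_mono) linarith+
      also have "\<dots> = a * \<bar>u\<bar> + d" using a by (simp add: field_simps)
      finally show False using c[of k n] k(3) d(2) by simp
    qed
    then show ?case using a by (intro touch_set_nonempty[OF f, of a \<alpha> c]) auto
  qed
qed

end

section \<open>From a product formula to regeneration\<close>

lemma sets_closed_sets_past: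
  "sets (closed_sets_past t) = sigma_sets {S. closed S} {{S. closed S \<and> wait s S \<in> B} | s B. s \<le> t \<and> B \<in> sets borel}"
  unfolding closed_sets_past_def by (rule sets_measure_of) auto

lemma space_closed_sets_past: "space (closed_sets_past t) = {S. closed S}"
  unfolding closed_sets_past_def by (rule space_measure_of) auto

lemma sets_closed_sets_past_subset: "sets (closed_sets_past t) \<subseteq> sets closed_sets"
  unfolding sets_closed_sets sets_closed_sets_past by (rule sigma_sets_mono') auto

lemma space_closed_sets_past_right: "space (closed_sets_past_right t) = {S. closed S}"
proof -
  have "(\<Inter>s\<in>{t<..}. sets (closed_sets_past s)) \<subseteq> sets (closed_sets_past (t + 1))"
    by (rule INF_lower) simp
  also have "\<dots> \<subseteq> Pow {S. closed S}"
    using sets.space_closed[of "closed_sets_past (t + 1)"] by (simp add: space_closed_sets_past)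
  finally show ?thesis unfolding closed_sets_past_right_def by (rule space_measure_of)
qed

lemma sets_closed_sets_past_right_subset:
  assumes "t < s"
  shows "sets (closed_sets_past_right t) \<subseteq> sets (closed_sets_past s)"
proof -
  let ?G = "\<Inter>s\<in>{t<..}. sets (closed_sets_past s)"
  have sub: "?G \<subseteq> sets (closed_sets_past s)" using assms by (intro INF_lower) simp
  also have "\<dots> \<subseteq> Pow {S. closed S}"
    using sets.space_closed[of "closed_sets_past s"] by (simp add: space_closed_sets_past)
  finally have "sets (closed_sets_past_right t) = sigma_sets {S. closed S} ?G"
    unfolding closed_sets_past_right_def by (rule sets_measure_of)
  also have "\<dots> \<subseteq> sets (closed_sets_past s)"
    using sets.sigma_sets_subset[OF sub] by (simp add: space_closed_sets_past)
  finally show ?thesis .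
qed

text \<open>Any witness beyond the cut can be replaced by the cut \<open>x\<close> itself, which
  lies in \<open>S\<close> and comes no later.\<close>

lemma wait_past_at:
  assumes "x \<in> S" "v < x"
  shows "wait v (past_at x S) = wait v S"
proof -
  have "wait v (past_at x S) < e \<longleftrightarrow> wait v S < e" for e
  proof
    assume "wait v S < e"
    then obtain s where s: "s \<in> S" "v < s" "ereal (s - v) < e" by (auto simp: wait_less_iff)
    have "ereal (min s x - v) \<le> ereal (s - v)" by simp
    then have "ereal (min s x - v) < e" using s(3) by (rule order_le_less_trans)
    moreover have "min s x \<in> past_at x S" "v < min s x"
      using s assms by (auto simp: past_at_def min_def)
    ultimately show "wait v (past_at x S) < e" unfolding wait_less_iff by blast
  qed (auto simp: wait_less_iff past_at_def)
  then show ?thesis by (metis less_irrefl neqE)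
qed

text \<open>The part of a closed set up to its first point after \<open>s\<close> carries all the information on the
  past strictly before \<open>s\<close>; the strict inequality is what the right limits in
  \<open>closed_sets_past_right\<close> leave room for.\<close>

lemma closed_sets_past_determined:
  assumes A: "A \<in> sets (closed_sets_past s')" and "s' < s" and S: "closed S" "S \<inter> {s..} \<noteq> {}"
  shows "past_at (first_from s S) S \<in> A \<longleftrightarrow> S \<in> A"
  using A[unfolded sets_closed_sets_past]
proof induction
  case (Basic B)
  then obtain v C where "B = {S. closed S \<and> wait v S \<in> C}" "v \<le> s'" by auto
  moreover have "wait v (past_at (first_from s S) S) = wait v S"
    using first_from[OF S] \<open>v \<le> s'\<close> \<open>s' < s\<close> by (intro wait_past_at) auto
  ultimately show ?case using S closed_past_at by simp
next
  case (Compl B)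
  then show ?case using S closed_past_at by simp
qed auto

text \<open>The weights are absorbed as densities; the image measures then agree because their
  expected avoidances do. This extends an identity for test functions to all events.\<close>

lemma integral_eq_on_closed_sets:
  fixes g1 g2 :: "'w \<Rightarrow> real"
  assumes M: "prob_space M"
    and W: "W1 \<in> measurable M closed_sets" "W2 \<in> measurable M closed_sets"
    and g [measurable]: "g1 \<in> borel_measurable M" "g2 \<in> borel_measurable M"
    and bnd: "\<And>w. 0 \<le> g1 w \<and> g1 w \<le> 1" "\<And>w. 0 \<le> g2 w \<and> g2 w \<le> 1"
    and eq: "\<And>c. test_function c \<Longrightarrow> (\<integral>w. g1 w * avoidance c (W1 w) \<partial>M) = (\<integral>w. g2 w * avoidance c (W2 w) \<partial>M)"
    and G: "G \<in> sets closed_sets"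
  shows "(\<integral>w. g1 w * indicator G (W1 w) \<partial>M) = (\<integral>w. g2 w * indicator G (W2 w) \<partial>M)"
proof -
  interpret prob_space M by fact
  define D where "D g W = distr (density M (\<lambda>w. ennreal (g w))) closed_sets W" for g W
  have int: "(\<integral>S. f S \<partial>D g W) = (\<integral>w. g w * f (W w) \<partial>M)"
    if g: "g \<in> borel_measurable M" "\<And>w. 0 \<le> g w \<and> g w \<le> (1::real)" and W: "W \<in> measurable M closed_sets"
      and f: "f \<in> borel_measurable closed_sets" for g W and f :: "real set \<Rightarrow> real"
  proof -
    have "(\<integral>S. f S \<partial>D g W) = (\<integral>w. f (W w) \<partial>density M (\<lambda>w. ennreal (g w)))"
      unfolding D_def using W f by (intro integral_distr) auto
    also have "\<dots> = (\<integral>w. g w * f (W w) \<partial>M)"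
      using g measurable_compose[OF W f] by (intro integral_real_density) auto
    finally show ?thesis .
  qed
  have fin: "finite_measure (D g W)"
    if g: "g \<in> borel_measurable M" "\<And>w. 0 \<le> g w \<and> g w \<le> (1::real)" and W: "W \<in> measurable M closed_sets" for g W
  proof -
    have "emeasure (density M (\<lambda>w. ennreal (g w))) (space M) = (\<integral>\<^sup>+w. ennreal (g w) \<partial>M)"
      using g by (subst emeasure_density) (auto intro!: nn_integral_cong)
    also have "\<dots> \<le> (\<integral>\<^sup>+w. 1 \<partial>M)" using g(2) by (intro nn_integral_mono) auto
    also have "\<dots> = 1" by (simp add: emeasure_space_1)
    finally have "finite_measure (density M (\<lambda>w. ennreal (g w)))"
      by (intro finite_measureI) (auto simp: top_unique)
    then show ?thesis unfolding D_def using W by (intro finite_measure.finite_measure_distr) auto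
  qed
  have "D g1 W1 = D g2 W2"
  proof (rule closed_sets_measure_eqI)
    fix c assume c: "test_function c"
    show "(\<integral>S. avoidance c S \<partial>D g1 W1) = (\<integral>S. avoidance c S \<partial>D g2 W2)"
      using eq[OF c] int[OF g(1) bnd(1) W(1) measurable_avoidance[OF c]]
        int[OF g(2) bnd(2) W(2) measurable_avoidance[OF c]] by simp
  qed (use fin g bnd W in \<open>auto simp: D_def\<close>)
  then show ?thesis
    using int[OF g(1) bnd(1) W(1), of "indicator G"] int[OF g(2) bnd(2) W(2), of "indicator G"] G by simp
qed

text \<open>The future factor on the right starts its search at 0, whatever \<open>t\<close> is: the
  formula says at once that past and future are independent and that the law of the future is always
  the same. It is stated for test functions, for which it passes to the limit.\<close>

locale regenerating_law = prob_space Q for Q :: "real set measure" +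
  assumes sets_Q: "sets Q = sets closed_sets"
    and AE_future: "\<And>t. AE S in Q. S \<inter> {t<..} \<noteq> {}"
    and product: "\<And>t c c'. test_function c \<Longrightarrow> test_function c' \<Longrightarrow>
      (\<integral>S. avoidance c (past_at (first_from t S) S) * avoidance c' (future_at (first_from t S) S) \<partial>Q) =
      (\<integral>S. avoidance c (past_at (first_from t S) S) \<partial>Q) * (\<integral>S. avoidance c' (future_at (first_from 0 S) S) \<partial>Q)"
begin

lemma space_Q: "space Q = {S. closed S}"
  using sets_eq_imp_space_eq[OF sets_Q] by simp

lemma measurable_Q: "f \<in> measurable closed_sets N \<Longrightarrow> f \<in> measurable Q N"
  using measurable_cong_sets[OF sets_Q refl] by blast

lemma measurable_parts:
  "(\<lambda>S. past_at (first_from t S) S) \<in> measurable Q closed_sets"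
  "(\<lambda>S. future_at (first_from t S) S) \<in> measurable Q closed_sets"
  "(\<lambda>S. shifted_future (first_from t S) S) \<in> measurable Q closed_sets"
  "(\<lambda>S. future_at (real_of_ereal (next_point t S)) S) \<in> measurable Q closed_sets"
  "(\<lambda>S. shifted_future (real_of_ereal (next_point t S)) S) \<in> measurable Q closed_sets"
  using measurable_id_closed_sets measurable_first_from[OF measurable_id_closed_sets]
    borel_measurable_real_of_ereal[OF measurable_next_point[OF measurable_id_closed_sets]]
  by (auto intro!: measurable_Q measurable_past_at measurable_future_at measurable_shifted_future)

abbreviation renewal_mean :: "(real \<Rightarrow> real) \<Rightarrow> real" where
  "renewal_mean c \<equiv> \<integral>S. avoidance c (future_at (first_from 0 S) S) \<partial>Q"

lemma measurable_avoidance_parts: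
  assumes "test_function c"
  shows "(\<lambda>S. avoidance c (past_at (first_from t S) S)) \<in> borel_measurable Q"
    "(\<lambda>S. avoidance c (future_at (first_from t S) S)) \<in> borel_measurable Q"
    "(\<lambda>S. avoidance c (future_at (real_of_ereal (next_point t S)) S)) \<in> borel_measurable Q"
  by (rule measurable_compose[OF measurable_parts(1) measurable_avoidance[OF assms]]
      measurable_compose[OF measurable_parts(2) measurable_avoidance[OF assms]]
      measurable_compose[OF measurable_parts(4) measurable_avoidance[OF assms]])+

lemma renewal_mean_bounds:
  assumes "test_function c"
  shows "0 \<le> renewal_mean c" "renewal_mean c \<le> 1"
proof -
  show "0 \<le> renewal_mean c" using avoidance_nonneg[OF assms] by (intro integral_nonneg_AE) auto
  have "renewal_mean c \<le> (\<integral>S. 1 \<partial>Q)"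
    using measurable_avoidance_parts[OF assms] avoidance_nonneg[OF assms] avoidance_le_1[OF assms]
    by (intro integral_mono integrable_const_bound[of _ 1]) auto
  then show "renewal_mean c \<le> 1" by (simp add: prob_space)
qed

lemma integral_past_future:
  assumes c: "test_function c" and G: "G \<in> sets closed_sets"
  shows "(\<integral>S. avoidance c (future_at (first_from t S) S) * indicator G (past_at (first_from t S) S) \<partial>Q) =
    (\<integral>S. renewal_mean c * indicator G (past_at (first_from t S) S) \<partial>Q)"
proof (rule integral_eq_on_closed_sets[OF prob_space_axioms measurable_parts(1) measurable_parts(1) _ _ _ _ _ G])
  fix c' assume c': "test_function c'"
  show "(\<integral>S. avoidance c (future_at (first_from t S) S) * avoidance c' (past_at (first_from t S) S) \<partial>Q) =
      (\<integral>S. renewal_mean c * avoidance c' (past_at (first_from t S) S) \<partial>Q)"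
    using product[OF c' c, of t] by (simp add: mult.commute)
qed (use measurable_avoidance_parts[OF c] renewal_mean_bounds[OF c] avoidance_nonneg[OF c] avoidance_le_1[OF c] in auto)

lemma AE_closed_future: "AE S in Q. closed S \<and> S \<inter> {t<..} \<noteq> {}"
  using AE_future[of t] AE_space by eventually_elim (simp add: space_Q)

text \<open>An event of the right-continuous past at \<open>t\<close> belongs to the past at some
  time strictly before \<open>s\<close>, hence is decided by the part of \<open>S\<close> up to its
  first point from \<open>s\<close> on.\<close>

lemma integral_strict_past:
  assumes c: "test_function c" and A: "A \<in> sets (closed_sets_past_right t)" and s: "t < s"
  shows "(\<integral>S. indicator A S * avoidance c (future_at (first_from s S) S) \<partial>Q) = renewal_mean c * prob A"
proof -
  obtain s' where s': "t < s'" "s' < s" using dense[OF s] by blast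
  have As': "A \<in> sets (closed_sets_past s')" using sets_closed_sets_past_right_subset[OF s'(1)] A by blast
  then have A': "A \<in> sets closed_sets" using sets_closed_sets_past_subset by blast
  then have [measurable]: "A \<in> sets Q" by (simp add: sets_Q)
  have ind: "AE S in Q. indicator A (past_at (first_from s S) S) = (indicator A S :: real)"
    using AE_closed_future[of s]
  proof eventually_elim
    case (elim S)
    then have "S \<inter> {s..} \<noteq> {}" by force
    from closed_sets_past_determined[OF As' s'(2) elim[THEN conjunct1] this] show ?case
      by (simp add: indicator_def)
  qed
  have [measurable]: "(\<lambda>S. indicator A (past_at (first_from s S) S) :: real) \<in> borel_measurable Q"
    using A' by (intro measurable_compose[OF measurable_parts(1)]) simp
  note [measurable] = measurable_avoidance_parts[OF c]
  have "(\<integral>S. indicator A S * avoidance c (future_at (first_from s S) S) \<partial>Q) =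
    (\<integral>S. avoidance c (future_at (first_from s S) S) * indicator A (past_at (first_from s S) S) \<partial>Q)"
    by (rule integral_cong_AE) (use ind in \<open>auto simp: mult.commute\<close>)
  also have "\<dots> = (\<integral>S. renewal_mean c * indicator A (past_at (first_from s S) S) \<partial>Q)"
    by (rule integral_past_future[OF c A'])
  also have "\<dots> = (\<integral>S. renewal_mean c * indicator A S \<partial>Q)"
    by (rule integral_cong_AE) (use ind in auto)
  also have "\<dots> = renewal_mean c * prob A" by simp
  finally show ?thesis .
qed

text \<open>Searching from \<open>t + 1 / Suc n\<close> excludes \<open>t\<close> itself. The points
  found converge to the next point after \<open>t\<close>, even when that is \<open>t\<close> as an
  accumulation point, and cutting is continuous along points of \<open>S\<close>.\<close>

lemma tendsto_future_at_next_point: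
  assumes S: "closed S" "S \<inter> {t<..} \<noteq> {}" and c: "test_function c"
  shows "(\<lambda>n. avoidance c (future_at (first_from (t + 1 / Suc n) S) S)) \<longlonglongrightarrow>
    avoidance c (future_at (real_of_ereal (next_point t S)) S)"
proof -
  define d where "d = real_of_ereal (next_point t S)"
  note np = next_point_real[OF S, folded d_def]
  have ev: "\<forall>\<^sub>F n in sequentially. first_from (t + 1 / Suc n) S \<in> S \<and>
      d \<le> first_from (t + 1 / Suc n) S \<and> first_from (t + 1 / Suc n) S < e" if e: "d < e" for e
  proof -
    obtain s where s: "s \<in> S" "t < s" "s < e" using np(5)[OF e] by blast
    have "\<forall>\<^sub>F n in sequentially. 1 / real (Suc n) < s - t"
      using order_tendstoD(2)[OF LIMSEQ_Suc[OF lim_1_over_n], of "s - t"] s(2) by simp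
    then show ?thesis
    proof eventually_elim
      case (elim n)
      then have *: "t + 1 / Suc n \<le> s" by linarith
      then have "S \<inter> {t + 1 / Suc n..} \<noteq> {}" using s(1) by auto
      note ff = first_from[OF S(1) this]
      have "t < first_from (t + 1 / Suc n) S"
        by (rule less_le_trans[OF _ ff(2)]) simp
      then show ?case using ff(1) ff(3)[OF s(1) *] np(4)[OF ff(1)] s(3) by auto
    qed
  qed
  have "(\<lambda>n. first_from (t + 1 / Suc n) S) \<longlonglongrightarrow> d"
  proof (rule order_tendstoI)
    fix a assume "a < d"
    show "\<forall>\<^sub>F n in sequentially. a < first_from (t + 1 / Suc n) S"
      using ev[of "d + 1"] by (auto elim!: eventually_mono intro: less_le_trans[OF \<open>a < d\<close>])
  next
    fix a assume "d < a"
    from ev[OF this] show "\<forall>\<^sub>F n in sequentially. first_from (t + 1 / Suc n) S < a"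
      by (auto elim!: eventually_mono)
  qed
  moreover have "\<forall>\<^sub>F n in sequentially. first_from (t + 1 / Suc n) S \<in> S"
    using ev[of "d + 1"] by (auto elim!: eventually_mono)
  moreover have "fell_tendsto (\<lambda>_::nat. S) S sequentially" by (auto simp: fell_tendsto_def)
  ultimately show ?thesis
    unfolding d_def[symmetric] by (intro tendsto_avoidance[OF c] fell_tendsto_future_at S np)
qed

lemma integral_past_right:
  assumes c: "test_function c" and A: "A \<in> sets (closed_sets_past_right t)"
  shows "(\<integral>S. indicator A S * avoidance c (future_at (real_of_ereal (next_point t S)) S) \<partial>Q) =
    renewal_mean c * prob A"
proof -
  have "A \<in> sets closed_sets"
    using A sets_closed_sets_past_right_subset[of t "t + 1"] sets_closed_sets_past_subset by force
  then have [measurable]: "A \<in> sets Q" by (simp add: sets_Q)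
  note [measurable] = measurable_avoidance_parts[OF c]
  have "(\<lambda>n. \<integral>S. indicator A S * avoidance c (future_at (first_from (t + 1 / Suc n) S) S) \<partial>Q) \<longlonglongrightarrow>
    (\<integral>S. indicator A S * avoidance c (future_at (real_of_ereal (next_point t S)) S) \<partial>Q)"
  proof (rule integral_dominated_convergence[where w = "\<lambda>_. 1"])
    show "AE S in Q. (\<lambda>n. indicator A S * avoidance c (future_at (first_from (t + 1 / Suc n) S) S)) \<longlonglongrightarrow>
        indicator A S * avoidance c (future_at (real_of_ereal (next_point t S)) S)"
      using AE_closed_future[of t]
      by eventually_elim (intro tendsto_mult tendsto_const tendsto_future_at_next_point c; simp)
    show "AE S in Q. norm (indicator A S * avoidance c (future_at (first_from (t + 1 / Suc n) S) S)) \<le> 1" for n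
      using avoidance_nonneg[OF c] avoidance_le_1[OF c] by (auto simp: indicator_def)
  qed auto
  moreover have "(\<integral>S. indicator A S * avoidance c (future_at (first_from (t + 1 / Suc n) S) S) \<partial>Q) =
      renewal_mean c * prob A" for n
    by (rule integral_strict_past[OF c A]) simp
  ultimately show ?thesis by (simp add: LIMSEQ_const_iff)
qed

text \<open>By the product formula any other starting time would give the same law.
  \<open>shifted_future\<close> matches the shift in the regeneration property, which drops the cut
  unless points accumulate there from the right.\<close>

definition renewal_law :: "real set measure" where
  "renewal_law = distr Q closed_sets (\<lambda>S. shifted_future (first_from 0 S) S)"

lemma emeasure_past_right:
  assumes A: "A \<in> sets (closed_sets_past_right t)" and C: "C \<in> sets closed_sets"
  shows "emeasure Q (A \<inter> ((\<lambda>S. shifted_future (real_of_ereal (next_point t S)) S) -` C \<inter> space Q)) =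
    emeasure Q A * emeasure renewal_law C"
proof -
  have "A \<in> sets closed_sets"
    using A sets_closed_sets_past_right_subset[of t "t + 1"] sets_closed_sets_past_subset by force
  then have AQ [measurable]: "A \<in> sets Q" by (simp add: sets_Q)
  have sf: "shifted_future 0 \<in> measurable closed_sets closed_sets"
    using measurable_shifted_future[OF measurable_id_closed_sets, of "\<lambda>_. 0"] by simp
  \<comment> \<open>Pulling \<open>C\<close> back along \<open>shifted_future 0\<close> turns an
    event of the shifted future into one of the future that keeps the cut, where the product formula
    applies.\<close>
  define C' where "C' = shifted_future 0 -` C \<inter> space closed_sets"
  have C': "C' \<in> sets closed_sets" unfolding C'_def using sf C by (rule measurable_sets)
  have memC': "future_at x S \<in> C' \<longleftrightarrow> shifted_future x S \<in> C" if "closed S" for x S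
    using closed_future_at[OF that] by (simp add: C'_def shifted_future_future_at)
  have sets: "(\<lambda>S. shifted_future (real_of_ereal (next_point t S)) S) -` C \<inter> space Q \<in> sets Q"
    "(\<lambda>S. shifted_future (first_from 0 S) S) -` C \<inter> space Q \<in> sets Q"
    using measurable_parts(3,5) C by (auto intro: measurable_sets)
  have "prob (A \<inter> ((\<lambda>S. shifted_future (real_of_ereal (next_point t S)) S) -` C \<inter> space Q)) =
    (\<integral>S. indicator (A \<inter> ((\<lambda>S. shifted_future (real_of_ereal (next_point t S)) S) -` C \<inter> space Q)) S \<partial>Q)"
    using sets by simp
  also have "\<dots> = (\<integral>S. indicator A S * indicator C' (future_at (real_of_ereal (next_point t S)) S) \<partial>Q)"
    by (rule Bochner_Integration.integral_cong) (auto simp: memC' space_Q indicator_def)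
  also have "\<dots> = (\<integral>S. prob A * indicator C' (future_at (first_from 0 S) S) \<partial>Q)"
  proof (rule integral_eq_on_closed_sets[OF prob_space_axioms measurable_parts(4,2) _ _ _ _ _ C'])
    fix c assume c: "test_function c"
    show "(\<integral>S. indicator A S * avoidance c (future_at (real_of_ereal (next_point t S)) S) \<partial>Q) =
        (\<integral>S. prob A * avoidance c (future_at (first_from 0 S) S) \<partial>Q)"
      using integral_past_right[OF c A] by (simp add: mult.commute)
  qed auto
  also have "\<dots> = prob A * (\<integral>S. indicator ((\<lambda>S. shifted_future (first_from 0 S) S) -` C \<inter> space Q) S \<partial>Q)"
    by (subst integral_mult_right_zero[symmetric], rule Bochner_Integration.integral_cong)
      (auto simp: memC' space_Q indicator_def)
  also have "\<dots> = prob A * prob ((\<lambda>S. shifted_future (first_from 0 S) S) -` C \<inter> space Q)"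
    using sets by simp
  finally show ?thesis
    unfolding renewal_law_def using measurable_parts(3) C
    by (simp add: emeasure_eq_measure emeasure_distr ennreal_mult)
qed

lemma regenerative: "regenerative_with Q renewal_law"
  unfolding regenerative_with_def
proof (intro conjI allI impI)
  show "prob_space Q" by (rule prob_space_axioms)
  show "sets Q = sets closed_sets" by (rule sets_Q)
  show prob0: "prob_space renewal_law" unfolding renewal_law_def using measurable_parts(3) by (rule prob_space_distr)
  show "sets renewal_law = sets closed_sets" by (simp add: renewal_law_def)
  fix t
  show "emeasure Q {S \<in> space Q. next_point t S = \<infinity>} = 0"
  proof -
    have "AE S in Q. next_point t S \<noteq> \<infinity>"
      using AE_closed_future[of t] by eventually_elim (auto dest!: next_point_real(1))
    moreover have "{S \<in> space Q. next_point t S = \<infinity>} \<in> sets Q"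
      using measurable_Q[OF measurable_next_point[OF measurable_id_closed_sets]] by measurable
    ultimately show ?thesis by (subst (asm) AE_iff_measurable) auto
  qed
  fix F :: "real set \<Rightarrow> ennreal" assume F: "F \<in> borel_measurable closed_sets"
  define \<tau> where "\<tau> = (\<lambda>S. shifted_future (real_of_ereal (next_point t S)) S)"
  have \<tau>: "\<tau> \<in> measurable Q closed_sets" unfolding \<tau>_def by (rule measurable_parts(5))
  have sub: "subalgebra Q (closed_sets_past_right t)"
    using sets_closed_sets_past_right_subset[of t "t + 1"] sets_closed_sets_past_subset[of "t + 1"]
    by (auto simp: subalgebra_def space_Q space_closed_sets_past_right sets_Q)
  interpret finite_measure_subalgebra Q "closed_sets_past_right t"
    by unfold_locales (rule sub)
  have "AE S in Q. (\<integral>\<^sup>+ S. F S \<partial>renewal_law) = nn_cond_exp Q (closed_sets_past_right t) (\<lambda>S. F (\<tau> S)) S"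
  proof (rule nn_cond_exp_charact)
    fix A assume A: "A \<in> sets (closed_sets_past_right t)"
    then have AQ [measurable]: "A \<in> sets Q" using sub by (auto simp: subalgebra_def)
    \<comment> \<open>Equality of these measures collects the identity for all \<open>C\<close>, so
      that it can be integrated against any nonnegative \<open>F\<close>.\<close>
    have "distr (density Q (indicator A)) closed_sets \<tau> = scale_measure (emeasure Q A) renewal_law"
    proof (rule measure_eqI)
      fix C assume "C \<in> sets (distr (density Q (indicator A)) closed_sets \<tau>)"
      then have C: "C \<in> sets closed_sets" by simp
      have "emeasure (distr (density Q (indicator A)) closed_sets \<tau>) C =
        (\<integral>\<^sup>+S. indicator A S * indicator (\<tau> -` C \<inter> space Q) S \<partial>Q)"
        using \<tau> C by (subst emeasure_distr) (auto simp: emeasure_density measurable_sets)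
      also have "\<dots> = emeasure Q (A \<inter> (\<tau> -` C \<inter> space Q))"
        using measurable_sets[OF \<tau> C] by (simp add: indicator_inter_arith[symmetric])
      finally show "emeasure (distr (density Q (indicator A)) closed_sets \<tau>) C =
          emeasure (scale_measure (emeasure Q A) renewal_law) C"
        using emeasure_past_right[OF A C] by (simp add: \<tau>_def)
    qed (simp add: renewal_law_def)
    then have "(\<integral>\<^sup>+S. F S \<partial>distr (density Q (indicator A)) closed_sets \<tau>) =
        (\<integral>\<^sup>+S. F S \<partial>scale_measure (emeasure Q A) renewal_law)" by simp
    also have "(\<integral>\<^sup>+S. F S \<partial>distr (density Q (indicator A)) closed_sets \<tau>) = (\<integral>\<^sup>+S. indicator A S * F (\<tau> S) \<partial>Q)"
      using \<tau> F measurable_compose[OF \<tau> F] by (subst nn_integral_distr) (auto simp: nn_integral_density)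
    also have "(\<integral>\<^sup>+S. F S \<partial>scale_measure (emeasure Q A) renewal_law) = emeasure Q A * (\<integral>\<^sup>+S. F S \<partial>renewal_law)"
      using F by (intro nn_integral_scale_measure) (simp add: renewal_law_def)
    finally show "(\<integral>\<^sup>+S\<in>A. F (\<tau> S) \<partial>Q) = (\<integral>\<^sup>+S\<in>A. (\<integral>\<^sup>+ S. F S \<partial>renewal_law) \<partial>Q)"
      using nn_integral_cmult_indicator[OF AQ, of "\<integral>\<^sup>+ S. F S \<partial>renewal_law"]
      by (simp add: mult.commute)
  qed (use measurable_compose[OF \<tau> F] in auto)
  then show "AE S in Q. nn_cond_exp Q (closed_sets_past_right t)
      (\<lambda>S. F (shifted_future (real_of_ereal (next_point t S)) S)) S = (\<integral>\<^sup>+ S. F S \<partial>renewal_law)"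
    unfolding \<tau>_def by eventually_elim simp
qed

end

section \<open>Passage to the limit\<close>

lemma measurable_avoidance_image:
  fixes K :: "'w \<Rightarrow> int set"
  assumes c: "test_function c" and K: "\<And>k. Measurable.pred M (\<lambda>w. k \<in> K w)"
  shows "(\<lambda>w. avoidance c (g ` K w)) \<in> borel_measurable M"
  unfolding borel_measurable_iff_less
proof
  fix a
  note [measurable] = K
  have "{w \<in> space M. avoidance c (g ` K w) < a} = {w \<in> space M. 1 < a \<or> (\<exists>k. k \<in> K w \<and> c (g k) < a)}"
    unfolding avoidance_less_iff[OF c] by blast
  also have "\<dots> \<in> sets M" by measurable
  finally show "{w \<in> space M. avoidance c (g ` K w) < a} \<in> sets M" .
qed

lemma int_set_measurable_avoidance:
  assumes "test_function c"
  shows "int_set_measurable (\<lambda>K. ennreal (avoidance c (g ` K)))"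
  unfolding int_set_measurable_def
  by (intro measurable_compose[OF measurable_avoidance_image[OF assms] measurable_ennreal]) simp

lemma avoidance_one [simp]: "avoidance (\<lambda>_. 1) S = 1"
proof -
  have "insert 1 ((\<lambda>_. 1) ` S) = {1 :: real}" by auto
  then show ?thesis by (simp only: avoidance_def cInf_singleton)
qed

lemma test_function_one: "test_function (\<lambda>_. 1)"
  by (simp add: test_function_def)

section \<open>Measurability and stationarity of the contact set\<close>

context two_sided_levy_process
begin

definition sample_path :: "'a \<Rightarrow> real \<Rightarrow> real" where
  "sample_path w t = X t w"

lemma cadlag_sample_path: "w \<in> space P \<Longrightarrow> cadlag (sample_path w)"
  using cadlag_paths unfolding sample_path_def .

lemma measurable_sample_path [measurable]: "(\<lambda>w. sample_path w t) \<in> borel_measurable P"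
  unfolding sample_path_def by measurable

definition contacts :: "real \<Rightarrow> real \<Rightarrow> 'a \<Rightarrow> int set" where
  "contacts a h w = grid_contacts (a * h) (\<lambda>k. sample_path w (h * of_int k))"

lemma grid_set_contacts: "grid_set a h (sample_path w) = (\<lambda>k. h * of_int k) ` contacts a h w"
  by (simp add: grid_set_def contacts_def)

lemma contacts_psum: "w \<in> space P \<Longrightarrow> contacts a h w = grid_contacts (a * h) (psum (\<lambda>i. increment h i w))"
  unfolding contacts_def sample_path_def by (simp only: X_eq_psum)

lemma pred_contacts [measurable]: "Measurable.pred P (\<lambda>w. k \<in> contacts a h w)"
  unfolding contacts_def grid_contacts_def mem_Collect_eq by measurable

lemma measurable_avoidance_grid_set:
  "test_function c \<Longrightarrow> (\<lambda>w. avoidance c (grid_set a h (sample_path w))) \<in> borel_measurable P"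
  unfolding grid_set_contacts by (rule measurable_avoidance_image) simp_all

lemma tendsto_avoidance_grid_set:
  assumes "w \<in> space P" "a \<ge> 0" "test_function c"
  shows "((\<lambda>(m, n). avoidance c (grid_set (a + 1 / Suc m) (1 / Suc n) (sample_path w))) \<longlongrightarrow>
    avoidance c (touch_set a (sample_path w))) iterated_sequentially"
  using tendsto_avoidance[OF assms(3) fell_tendsto_grid_set[OF cadlag_sample_path[OF assms(1)] assms(2)]]
  by (simp add: case_prod_unfold)

lemma measurable_touch_set:
  assumes "a \<ge> 0"
  shows "(\<lambda>w. touch_set a (sample_path w)) \<in> measurable P closed_sets"
proof (rule measurable_closed_sets_avoidanceI)
  fix c assume c: "test_function c"
  show "(\<lambda>w. avoidance c (touch_set a (sample_path w))) \<in> borel_measurable P"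
    by (rule measurable_iterated_limit[OF measurable_avoidance_grid_set[OF c] tendsto_avoidance_grid_set])
      (use assms c in auto)
qed (rule closed_touch_set[OF cadlag_sample_path])

text \<open>The cone condition depends on differences only, so relabelling the increments by
  \<open>k\<close> moves the contacts by \<open>k\<close> steps; the law of the increments does not
  notice.\<close>

lemma expectation_grid_set_shift:
  assumes h: "h > 0" and c: "test_function c"
  shows "expectation (\<lambda>w. avoidance c ((+) (h * of_int k) ` grid_set a h (sample_path w))) =
    expectation (\<lambda>w. avoidance c (grid_set a h (sample_path w)))"
proof -
  interpret I: iid_family P "increment h" by (rule iid_increment[OF h])
  define \<Psi> where "\<Psi> x = avoidance c ((\<lambda>j. h * of_int (j + k)) ` grid_contacts (a * h) (psum x))" for x
  have \<Psi>: "\<Psi> \<in> borel_measurable (PiM UNIV (\<lambda>_. borel))"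
    unfolding \<Psi>_def[abs_def] by (rule measurable_avoidance_image[OF c pred_grid_contacts_psum])
  have "expectation (\<lambda>w. avoidance c ((+) (h * of_int k) ` grid_set a h (sample_path w))) =
    expectation (\<lambda>w. \<Psi> (\<lambda>i. increment h (id i) w))"
    by (rule Bochner_Integration.integral_cong)
      (simp_all add: \<Psi>_def grid_set_contacts contacts_psum image_image algebra_simps)
  also have "\<dots> = expectation (\<lambda>w. \<Psi> (\<lambda>i. increment h (i + k) w))"
    by (rule I.integral_reindex[OF _ _ \<Psi>]) (auto simp: inj_def)
  also have "\<dots> = expectation (\<lambda>w. avoidance c (grid_set a h (sample_path w)))"
  proof (rule Bochner_Integration.integral_cong[OF refl])
    fix w assume w: "w \<in> space P"
    have mem: "j \<in> grid_contacts (a * h) (psum (\<lambda>i. increment h (i + k) w)) \<longleftrightarrow> j + k \<in> contacts a h w" for j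
    proof -
      have "psum (\<lambda>i. increment h (i + k) w) =
          (\<lambda>j. psum (\<lambda>i. increment h i w) (j + k) - psum (\<lambda>i. increment h i w) k)"
        by (rule ext) (rule psum_shift)
      then show ?thesis unfolding contacts_psum[OF w] by (simp only: grid_contacts_shift)
    qed
    have "(\<lambda>j. h * of_int (j + k)) ` grid_contacts (a * h) (psum (\<lambda>i. increment h (i + k) w)) =
      (\<lambda>k. h * of_int k) ` contacts a h w"
    proof (intro equalityI subsetI)
      fix x assume "x \<in> (\<lambda>k. h * of_int k) ` contacts a h w"
      then obtain i where "x = h * of_int i" "i \<in> contacts a h w" by auto
      then show "x \<in> (\<lambda>j. h * of_int (j + k)) ` grid_contacts (a * h) (psum (\<lambda>i. increment h (i + k) w))"
        using mem[of "i - k"] by (intro image_eqI[of _ _ "i - k"]) auto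
    next
      fix x assume "x \<in> (\<lambda>j. h * of_int (j + k)) ` grid_contacts (a * h) (psum (\<lambda>i. increment h (i + k) w))"
      then obtain j where "x = h * of_int (j + k)" "j + k \<in> contacts a h w" using mem by blast
      then show "x \<in> (\<lambda>k. h * of_int k) ` contacts a h w" by blast
    qed
    then show "\<Psi> (\<lambda>i. increment h (i + k) w) = avoidance c (grid_set a h (sample_path w))"
      by (simp add: \<Psi>_def grid_set_contacts)
  qed
  finally show ?thesis .
qed

text \<open>The law on the grid is invariant under multiples of the mesh only, so \<open>u\<close>
  is approximated by such multiples, and the translations converge together with the sets.\<close>

lemma stationary_touch_set:
  assumes a: "a \<ge> 0"
  shows "distr P closed_sets (\<lambda>w. (+) u ` touch_set a (sample_path w)) = distr P closed_sets (\<lambda>w. touch_set a (sample_path w))"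
proof -
  note meas = measurable_touch_set[OF a] measurable_translate[OF measurable_touch_set[OF a], of u]
  show ?thesis
  proof (rule closed_sets_measure_eqI)
    fix c assume c: "test_function c"
    define v where "v n = 1 / real (Suc n) * of_int \<lfloor>u * real (Suc n)\<rfloor>" for n
    have "v \<longlonglongrightarrow> u"
    proof (rule real_tendsto_sandwich[of "\<lambda>n. u - 1 / real (Suc n)" _ _ "\<lambda>_. u"])
      have "u - 1 / real (Suc n) \<le> v n \<and> v n \<le> u" for n
      proof -
        have "u * real (Suc n) - 1 \<le> of_int \<lfloor>u * real (Suc n)\<rfloor>" "of_int \<lfloor>u * real (Suc n)\<rfloor> \<le> u * real (Suc n)"
          by linarith+
        then have "(u * real (Suc n) - 1) / real (Suc n) \<le> of_int \<lfloor>u * real (Suc n)\<rfloor> / real (Suc n)"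
          "of_int \<lfloor>u * real (Suc n)\<rfloor> / real (Suc n) \<le> u * real (Suc n) / real (Suc n)"
          by (intro divide_right_mono; simp)+
        then show ?thesis by (simp add: v_def diff_divide_distrib del: of_nat_Suc)
      qed
      then show "\<forall>\<^sub>F n in sequentially. u - 1 / real (Suc n) \<le> v n" "\<forall>\<^sub>F n in sequentially. v n \<le> u" by auto
      show "(\<lambda>n. u - 1 / real (Suc n)) \<longlonglongrightarrow> u"
        using tendsto_diff[OF tendsto_const LIMSEQ_Suc[OF lim_1_over_n[where 'a = real]], of u] by simp
    qed auto
    then have v: "((\<lambda>(m, n). v n) \<longlongrightarrow> u) iterated_sequentially"
      using filterlim_compose[OF _ filterlim_snd_iterated] by (simp add: case_prod_unfold)
    have "((\<lambda>(m, n). expectation (\<lambda>w. avoidance c ((+) (v n) ` grid_set (a + 1 / Suc m) (1 / Suc n) (sample_path w)))) \<longlongrightarrow>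
      expectation (\<lambda>w. avoidance c ((+) u ` touch_set a (sample_path w)))) iterated_sequentially"
    proof (rule iterated_bounded_convergence[of _ _ 1])
      show "(\<lambda>w. avoidance c ((+) (v n) ` grid_set (a + 1 / Suc m) (1 / Suc n) (sample_path w))) \<in> borel_measurable P" for m n
        unfolding grid_set_contacts image_image by (rule measurable_avoidance_image[OF c]) simp
      show "(\<lambda>w. avoidance c ((+) u ` touch_set a (sample_path w))) \<in> borel_measurable P"
        using measurable_compose[OF meas(2) measurable_avoidance[OF c]] .
      show "AE w in P. ((\<lambda>(m, n). avoidance c ((+) (v n) ` grid_set (a + 1 / Suc m) (1 / Suc n) (sample_path w))) \<longlongrightarrow>
          avoidance c ((+) u ` touch_set a (sample_path w))) iterated_sequentially"
      proof (rule AE_I2)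
        fix w assume w: "w \<in> space P"
        show "((\<lambda>(m, n). avoidance c ((+) (v n) ` grid_set (a + 1 / Suc m) (1 / Suc n) (sample_path w))) \<longlongrightarrow>
          avoidance c ((+) u ` touch_set a (sample_path w))) iterated_sequentially"
          using tendsto_avoidance[OF c fell_tendsto_translate[OF
            fell_tendsto_grid_set[OF cadlag_sample_path[OF w] a] closed_touch_set[OF cadlag_sample_path[OF w]] v]]
          by (simp add: case_prod_unfold)
      qed
    qed (use avoidance_nonneg[OF c] avoidance_le_1[OF c] in auto)
    also have "(\<lambda>(m, n). expectation (\<lambda>w. avoidance c ((+) (v n) ` grid_set (a + 1 / Suc m) (1 / Suc n) (sample_path w)))) =
      (\<lambda>(m, n). expectation (\<lambda>w. avoidance c (grid_set (a + 1 / Suc m) (1 / Suc n) (sample_path w))))"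
      unfolding v_def
      by (intro ext, clarify, intro expectation_grid_set_shift[OF _ c]) simp
    finally have 1: "((\<lambda>(m, n). expectation (\<lambda>w. avoidance c (grid_set (a + 1 / Suc m) (1 / Suc n) (sample_path w)))) \<longlongrightarrow>
      expectation (\<lambda>w. avoidance c ((+) u ` touch_set a (sample_path w)))) iterated_sequentially" .
    have 2: "((\<lambda>(m, n). expectation (\<lambda>w. avoidance c (grid_set (a + 1 / Suc m) (1 / Suc n) (sample_path w)))) \<longlongrightarrow>
      expectation (\<lambda>w. avoidance c (touch_set a (sample_path w)))) iterated_sequentially"
    proof (rule iterated_bounded_convergence[of _ _ 1])
      show "(\<lambda>w. avoidance c (touch_set a (sample_path w))) \<in> borel_measurable P"
        using measurable_compose[OF meas(1) measurable_avoidance[OF c]] .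
    qed (use avoidance_nonneg[OF c] avoidance_le_1[OF c] measurable_avoidance_grid_set[OF c]
        tendsto_avoidance_grid_set[OF _ a c] in auto)
    show "(\<integral>S. avoidance c S \<partial>distr P closed_sets (\<lambda>w. (+) u ` touch_set a (sample_path w))) =
      (\<integral>S. avoidance c S \<partial>distr P closed_sets (\<lambda>w. touch_set a (sample_path w)))"
      using tendsto_unique[OF _ 1 2] meas measurable_avoidance[OF c] by (simp add: integral_distr)
  qed (use meas in \<open>auto intro!: finite_measure_distr\<close>)
qed

text \<open>By stationarity the probability of a contact after \<open>s\<close> does not depend on
  \<open>s\<close>. As \<open>s\<close> decreases to minus infinity it tends to the probability of
  any contact at all, which is 1.\<close>

lemma AE_touch_set_future:
  assumes "integrable P (X 1)" "\<bar>expectation (X 1)\<bar> < a"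
  shows "AE w in P. touch_set a (sample_path w) \<inter> {t<..} \<noteq> {}"
proof -
  have a: "a \<ge> 0" using assms(2) by linarith
  note Z = measurable_touch_set[OF a]
  define H where "H s = {w \<in> space P. touch_set a (sample_path w) \<inter> {s<..} \<noteq> {}}" for s
  have hit: "{S. closed S \<and> S \<inter> {s<..} \<noteq> {}} \<in> sets closed_sets" for s :: real
    by (rule hit_open_in_closed_sets) simp
  have H_eq: "H s = (\<lambda>w. touch_set a (sample_path w)) -` {S. closed S \<and> S \<inter> {s<..} \<noteq> {}} \<inter> space P" for s
    using measurable_space[OF Z] by (auto simp: H_def)
  have H [measurable]: "H s \<in> sets P" for s unfolding H_eq using Z hit by (rule measurable_sets)
  have shift: "prob (H (t - u)) = prob (H t)" for u
  proof -
    have "H (t - u) = (\<lambda>w. (+) u ` touch_set a (sample_path w)) -` {S. closed S \<and> S \<inter> {t<..} \<noteq> {}} \<inter> space P"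
    proof (intro set_eqI)
      fix w
      have "touch_set a (sample_path w) \<inter> {t - u<..} \<noteq> {} \<longleftrightarrow> (+) u ` touch_set a (sample_path w) \<inter> {t<..} \<noteq> {}"
      proof
        assume "touch_set a (sample_path w) \<inter> {t - u<..} \<noteq> {}"
        then obtain s where "s \<in> touch_set a (sample_path w)" "t - u < s" by auto
        then have "u + s \<in> (+) u ` touch_set a (sample_path w) \<inter> {t<..}" by auto
        then show "(+) u ` touch_set a (sample_path w) \<inter> {t<..} \<noteq> {}" by blast
      qed force
      then show "w \<in> H (t - u) \<longleftrightarrow> w \<in> (\<lambda>w. (+) u ` touch_set a (sample_path w)) -` {S. closed S \<and> S \<inter> {t<..} \<noteq> {}} \<inter> space P"
        using closed_translation[OF closed_touch_set[OF cadlag_sample_path]] by (auto simp: H_def)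
    qed
    then have "prob (H (t - u)) = measure (distr P closed_sets (\<lambda>w. (+) u ` touch_set a (sample_path w))) {S. closed S \<and> S \<inter> {t<..} \<noteq> {}}"
      using measurable_translate[OF Z] hit by (simp add: measure_distr)
    also have "\<dots> = measure (distr P closed_sets (\<lambda>w. touch_set a (sample_path w))) {S. closed S \<and> S \<inter> {t<..} \<noteq> {}}"
      by (simp only: stationary_touch_set[OF a])
    also have "\<dots> = prob (H t)" using Z hit by (simp add: measure_distr H_eq)
    finally show ?thesis .
  qed
  have "(\<lambda>n. prob (H (t - real n))) \<longlonglongrightarrow> prob (\<Union>n. H (t - real n))"
  proof (rule finite_Lim_measure_incseq)
    show "incseq (\<lambda>n. H (t - real n))"
      by (rule incseq_SucI) (force simp: H_def)
  qed auto
  moreover have "prob (\<Union>n. H (t - real n)) = 1"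
  proof -
    have "AE w in P. w \<in> (\<Union>n. H (t - real n))"
      using AE_touch_set_nonempty[OF assms] AE_space
    proof eventually_elim
      case (elim w)
      then obtain s where s: "s \<in> touch_set a (sample_path w)" unfolding sample_path_def by blast
      obtain n :: nat where "t - s < real n" using reals_Archimedean2 by blast
      then have "t - real n < s" by linarith
      then have "w \<in> H (t - real n)" unfolding H_def using s elim by blast
      then show ?case by blast
    qed
    then show ?thesis by (subst prob_eq_1) auto
  qed
  ultimately have "prob (H t) = 1" by (simp add: shift LIMSEQ_const_iff)
  then have "AE w in P. w \<in> H t" by (subst (asm) prob_eq_1) auto
  then show ?thesis by eventually_elim (simp add: H_def)
qed

end

section \<open>The product formula in the limit\<close>

lemma measurable_split_at_first:
  assumes f: "int_set_measurable f" and g: "int_set_measurable g"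
    and K [measurable]: "\<And>k. Measurable.pred M (\<lambda>w. k \<in> K w)"
  shows "(\<lambda>w. split_at_first k0 f g (K w)) \<in> borel_measurable M"
  unfolding split_at_first_def
proof (rule borel_measurable_suminf_order)
  fix i
  have [measurable]: "Measurable.pred M (\<lambda>w. first_contact k0 (K w) (k0 + int i))"
    unfolding first_contact_def Ball_def by measurable
  have [measurable]: "(\<lambda>w. f {j \<in> K w. j \<le> k0 + int i}) \<in> borel_measurable M"
    by (rule int_set_measurableD[OF f]) simp
  have [measurable]: "(\<lambda>w. g {j. 0 \<le> j \<and> j + (k0 + int i) \<in> K w}) \<in> borel_measurable M"
    by (rule int_set_measurableD[OF g]) simp
  show "(\<lambda>w. if first_contact k0 (K w) (k0 + int i)
      then f {j \<in> K w. j \<le> k0 + int i} * g {j. 0 \<le> j \<and> j + (k0 + int i) \<in> K w} else 0) \<in> borel_measurable M"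
    by measurable
qed

definition scaled_avoidance :: "real \<Rightarrow> (real \<Rightarrow> real) \<Rightarrow> int set \<Rightarrow> ennreal" where
  "scaled_avoidance h c K = ennreal (avoidance c ((\<lambda>k. h * of_int k) ` K))"

lemma scaled_avoidance_one: "scaled_avoidance h (\<lambda>_. 1) = (\<lambda>_. 1)"
  by (simp add: scaled_avoidance_def fun_eq_iff)

lemma int_set_measurable_scaled_avoidance: "test_function c \<Longrightarrow> int_set_measurable (scaled_avoidance h c)"
  unfolding scaled_avoidance_def[abs_def] by (rule int_set_measurable_avoidance)

lemma split_at_first_scaled:
  assumes k: "first_contact k0 K k" and h: "h > 0" and c: "test_function c" "test_function c'"
  defines "G \<equiv> (\<lambda>k. h * of_int k) ` K"
  shows "split_at_first k0 (scaled_avoidance h c) (scaled_avoidance h c') K =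
    ennreal (avoidance c (past_at (h * of_int k) G) * avoidance c' (future_at (h * of_int k) G))"
proof -
  have past: "(\<lambda>k. h * of_int k) ` {j \<in> K. j \<le> k} = past_at (h * of_int k) G"
    using h by (auto simp: past_at_def G_def)
  have future: "(\<lambda>k. h * of_int k) ` {j. 0 \<le> j \<and> j + k \<in> K} = future_at (h * of_int k) G"
  proof (intro set_eqI iffI)
    fix y assume "y \<in> (\<lambda>k. h * of_int k) ` {j. 0 \<le> j \<and> j + k \<in> K}"
    then obtain j where j: "y = h * of_int j" "0 \<le> j" "j + k \<in> K" by blast
    have "h * of_int k + y = h * of_int (j + k)" using j(1) by (simp add: algebra_simps)
    then have "h * of_int k + y \<in> G" unfolding G_def using j(3) by blast
    then show "y \<in> future_at (h * of_int k) G" using j h by (simp add: mem_future_at)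
  next
    fix y assume "y \<in> future_at (h * of_int k) G"
    then obtain i where i: "0 \<le> y" "h * of_int k + y = h * of_int i" "i \<in> K"
      by (auto simp: mem_future_at G_def)
    have y: "y = h * of_int (i - k)" using i(2) by (simp add: algebra_simps)
    have "0 \<le> i - k" using i(1) h unfolding y by (simp add: zero_le_mult_iff)
    then show "y \<in> (\<lambda>k. h * of_int k) ` {j. 0 \<le> j \<and> j + k \<in> K}"
      using y i(3) by (intro image_eqI[of _ _ "i - k"]) auto
  qed
  show ?thesis
    unfolding split_at_first_eq[OF k] scaled_avoidance_def past future
    using avoidance_nonneg c by (intro ennreal_mult[symmetric]) auto
qed

lemma split_at_first_le_1:
  assumes "h > 0" "test_function c" "test_function c'"
  shows "split_at_first k0 (scaled_avoidance h c) (scaled_avoidance h c') K \<le> 1"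
proof (cases "\<exists>k. first_contact k0 K k")
  case True
  then obtain k where k: "first_contact k0 K k" by blast
  show ?thesis
    unfolding split_at_first_scaled[OF k assms]
    using avoidance_nonneg avoidance_le_1 assms(2,3) by (auto intro!: mult_le_one simp: ennreal_le_1)
qed (simp add: split_at_first_none)

context two_sided_levy_process
begin

text \<open>The search on the grid starts at \<open>t - 1 / Suc m\<close> because the grid contacts approximating a contact at
  \<open>t\<close> itself may lie to its left.\<close>

definition grid_product :: "real \<Rightarrow> real \<Rightarrow> (real \<Rightarrow> real) \<Rightarrow> (real \<Rightarrow> real) \<Rightarrow> nat \<Rightarrow> nat \<Rightarrow> 'a \<Rightarrow> real" where
  "grid_product a t c c' m n w = enn2real (split_at_first \<lceil>(t - 1 / Suc m) * Suc n\<rceil>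
     (scaled_avoidance (1 / Suc n) c) (scaled_avoidance (1 / Suc n) c') (contacts (a + 1 / Suc m) (1 / Suc n) w))"

lemma grid_product_bounds:
  assumes "test_function c" "test_function c'"
  shows "0 \<le> grid_product a t c c' m n w" "grid_product a t c c' m n w \<le> 1"
    "ennreal (grid_product a t c c' m n w) = split_at_first \<lceil>(t - 1 / Suc m) * Suc n\<rceil>
     (scaled_avoidance (1 / Suc n) c) (scaled_avoidance (1 / Suc n) c') (contacts (a + 1 / Suc m) (1 / Suc n) w)"
proof -
  show "0 \<le> grid_product a t c c' m n w" by (simp add: grid_product_def)
  have le: "split_at_first \<lceil>(t - 1 / Suc m) * Suc n\<rceil>
     (scaled_avoidance (1 / Suc n) c) (scaled_avoidance (1 / Suc n) c') (contacts (a + 1 / Suc m) (1 / Suc n) w) \<le> 1"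
    by (rule split_at_first_le_1) (use assms in auto)
  then have "split_at_first \<lceil>(t - 1 / Suc m) * Suc n\<rceil>
     (scaled_avoidance (1 / Suc n) c) (scaled_avoidance (1 / Suc n) c') (contacts (a + 1 / Suc m) (1 / Suc n) w) < top"
    by (rule le_less_trans) simp
  then show eq: "ennreal (grid_product a t c c' m n w) = split_at_first \<lceil>(t - 1 / Suc m) * Suc n\<rceil>
     (scaled_avoidance (1 / Suc n) c) (scaled_avoidance (1 / Suc n) c') (contacts (a + 1 / Suc m) (1 / Suc n) w)"
    unfolding grid_product_def by (rule ennreal_enn2real)
  show "grid_product a t c c' m n w \<le> 1"
    using le unfolding eq[symmetric] by (simp add: ennreal_le_1)
qed

lemma measurable_grid_product:
  assumes "test_function c" "test_function c'"
  shows "grid_product a t c c' m n \<in> borel_measurable P"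
  unfolding grid_product_def[abs_def]
  by (intro borel_measurable_enn2real measurable_split_at_first int_set_measurable_scaled_avoidance assms pred_contacts)

lemma expectation_grid_product:
  assumes c: "test_function c" "test_function c'"
  shows "expectation (grid_product a t c c' m n) * expectation (grid_product a 0 (\<lambda>_. 1) (\<lambda>_. 1) m n) =
    expectation (grid_product a t c (\<lambda>_. 1) m n) * expectation (grid_product a 0 (\<lambda>_. 1) c' m n)"
proof -
  let ?I = "\<lambda>k f g. \<integral>\<^sup>+w. split_at_first k f g (grid_contacts ((a + 1 / Suc m) * (1 / Suc n))
    (psum (\<lambda>i. increment (1 / Suc n) i w))) \<partial>P"
  have E: "expectation (grid_product a s d d' m n) =
      enn2real (?I \<lceil>(s - 1 / Suc m) * Suc n\<rceil> (scaled_avoidance (1 / Suc n) d) (scaled_avoidance (1 / Suc n) d'))"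
    if d: "test_function d" "test_function d'" for s d d'
  proof -
    have "expectation (grid_product a s d d' m n) = enn2real (\<integral>\<^sup>+w. ennreal (grid_product a s d d' m n w) \<partial>P)"
      using measurable_grid_product[OF d] grid_product_bounds(1)[OF d] by (intro integral_eq_nn_integral) auto
    also have "(\<integral>\<^sup>+w. ennreal (grid_product a s d d' m n w) \<partial>P) =
        ?I \<lceil>(s - 1 / Suc m) * Suc n\<rceil> (scaled_avoidance (1 / Suc n) d) (scaled_avoidance (1 / Suc n) d')"
      unfolding grid_product_bounds(3)[OF d] by (rule nn_integral_cong) (simp only: contacts_psum)
    finally show ?thesis .
  qed
  have "iid_family P (increment (1 / Suc n))" by (rule iid_increment) simp
  note * = discrete_regeneration[OF this int_set_measurable_scaled_avoidance[OF c(1), of "1 / Suc n"]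
      int_set_measurable_scaled_avoidance[OF c(2), of "1 / Suc n"]]
  show ?thesis
    unfolding E[OF c] E[OF test_function_one test_function_one] E[OF c(1) test_function_one]
      E[OF test_function_one c(2)] scaled_avoidance_one enn2real_mult[symmetric] * ..
qed

text \<open>Since cutting is continuous along convergent cuts in the sets, it remains to show that
  the grid cut tends to the first contact. From above: grid contacts near it lie within the search
  range. From below: the contact set misses an interval reaching to the left of \<open>t\<close>,
  and so do the grid sets eventually.\<close>

lemma tendsto_grid_product:
  assumes w: "w \<in> space P" and a: "a \<ge> 0" and c: "test_function c" "test_function c'"
    and ne: "touch_set a (sample_path w) \<inter> {t..} \<noteq> {}"
  defines "Z \<equiv> touch_set a (sample_path w)"
  shows "((\<lambda>(m, n). grid_product a t c c' m n w) \<longlongrightarrow>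
    avoidance c (past_at (first_from t Z) Z) * avoidance c' (future_at (first_from t Z) Z)) iterated_sequentially"
proof -
  note f = cadlag_sample_path[OF w]
  have clZ: "closed Z" unfolding Z_def by (rule closed_touch_set[OF f])
  define T where "T = first_from t Z"
  note T = first_from[OF clZ ne[folded Z_def], folded T_def]
  define k0 where "k0 p = (case p of (m, n) \<Rightarrow> \<lceil>(t - 1 / real (Suc m)) * real (Suc n)\<rceil>)" for p :: "nat \<times> nat"
  define K where "K p = (case p of (m, n) \<Rightarrow> contacts (a + 1 / Suc m) (1 / Suc n) w)" for p :: "nat \<times> nat"
  define h where "h p = (case p of (m, n) \<Rightarrow> 1 / real (Suc n))" for p :: "nat \<times> nat"
  define G where "G p = (\<lambda>k. h p * of_int k) ` K p" for p
  \<comment> \<open>Eventually a first grid contact exists, and the choice is that contact.\<close>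
  define \<tau> where "\<tau> p = h p * of_int (SOME k. first_contact (k0 p) (K p) k)" for p
  have G_eq: "G (m, n) = grid_set (a + 1 / Suc m) (1 / Suc n) (sample_path w)" for m n
    unfolding G_def K_def h_def by (simp add: grid_set_contacts)
  have fell: "fell_tendsto G Z iterated_sequentially"
  proof -
    have "G = (\<lambda>(m, n). grid_set (a + 1 / Suc m) (1 / Suc n) (sample_path w))" by (auto simp: fun_eq_iff G_eq)
    then show ?thesis using fell_tendsto_grid_set[OF f a] by (simp add: Z_def)
  qed
  have k0: "k0 (m, n) \<le> k \<longleftrightarrow> t - 1 / real (Suc m) \<le> h (m, n) * of_int k" for m n k
  proof -
    have "k0 (m, n) \<le> k \<longleftrightarrow> (t - 1 / real (Suc m)) * real (Suc n) \<le> of_int k" by (simp add: k0_def ceiling_le_iff)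
    also have "\<dots> \<longleftrightarrow> t - 1 / real (Suc m) \<le> h (m, n) * of_int k"
      by (simp add: h_def pos_le_divide_eq del: of_nat_Suc)
    finally show ?thesis .
  qed
  have upper: "\<forall>\<^sub>F p in iterated_sequentially. (\<exists>k. first_contact (k0 p) (K p) k) \<and> \<tau> p < e" if e: "T < e" for e
    unfolding eventually_iterated_sequentially
  proof (rule always_eventually, rule allI)
    fix m
    \<comment> \<open>A grid contact closer than \<open>1 / Suc m\<close> to the first contact,
      which is at least \<open>t\<close>, cannot precede the start of the search.\<close>
    define d where "d = min (e - T) (1 / real (Suc m))"
    have d: "d > 0" using e by (simp add: d_def)
    have "\<forall>\<^sub>F n in sequentially. \<exists>v\<in>grid_set (a + 1 / Suc m) (1 / Suc n) (sample_path w). \<bar>v - T\<bar> < d"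
      by (rule eventually_compose_filterlim[OF eventually_grid_set_near[OF f _ a _ d] filterlim_inverse_Suc])
        (use T(1) in \<open>auto simp: Z_def\<close>)
    then show "\<forall>\<^sub>F n in sequentially. (\<exists>k. first_contact (k0 (m, n)) (K (m, n)) k) \<and> \<tau> (m, n) < e"
    proof eventually_elim
      case (elim n)
      then obtain k where k: "k \<in> K (m, n)" "\<bar>h (m, n) * of_int k - T\<bar> < d"
        unfolding G_eq[symmetric] G_def by blast
      then have "k0 (m, n) \<le> k" unfolding k0 using T(2) by (auto simp: d_def)
      then have ex: "\<exists>k. first_contact (k0 (m, n)) (K (m, n)) k" using k(1) ex_first_contact by blast
      then have "first_contact (k0 (m, n)) (K (m, n)) (SOME k. first_contact (k0 (m, n)) (K (m, n)) k)"
        by (rule someI_ex)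
      then have "(SOME k. first_contact (k0 (m, n)) (K (m, n)) k) \<le> k"
        using k(1) \<open>k0 (m, n) \<le> k\<close> by (simp add: first_contact_def)
      then have "\<tau> (m, n) \<le> h (m, n) * of_int k"
        unfolding \<tau>_def by (intro mult_left_mono) (auto simp: h_def)
      also have "\<dots> < e" using k(2) by (auto simp: d_def)
      finally show ?case using ex by blast
    qed
  qed
  have ev: "\<forall>\<^sub>F p in iterated_sequentially. \<exists>k. first_contact (k0 p) (K p) k"
    using upper[of "T + 1"] by (auto elim: eventually_mono)
  then have first: "\<forall>\<^sub>F p in iterated_sequentially.
      first_contact (k0 p) (K p) (SOME k. first_contact (k0 p) (K p) k)"
    by eventually_elim (rule someI_ex)
  have \<tau>_mem: "\<forall>\<^sub>F p in iterated_sequentially. \<tau> p \<in> G p"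
    using first by eventually_elim (auto simp: \<tau>_def G_def first_contact_def)
  have \<tau>_ge: "\<forall>\<^sub>F p in iterated_sequentially. t - 1 / real (Suc (fst p)) \<le> \<tau> p"
    using first
  proof eventually_elim
    case (elim p)
    then show ?case using k0[of "fst p" "snd p"] by (simp add: \<tau>_def first_contact_def)
  qed
  have "(\<tau> \<longlongrightarrow> T) iterated_sequentially"
  proof (rule order_tendstoI)
    fix e assume "T < e"
    from upper[OF this] show "\<forall>\<^sub>F p in iterated_sequentially. \<tau> p < e" by (auto elim: eventually_mono)
  next
    fix e assume e: "e < T"
    \<comment> \<open>The search starts before \<open>t\<close>, so some times to the left of
      \<open>t\<close> must be free of contacts too. If \<open>e < t\<close> the interval is empty;
      otherwise \<open>t\<close> is no contact, and closedness provides \<open>d\<close>.\<close>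
    obtain d where d: "d > 0" "Z \<inter> {t - d..e} = {}"
    proof (cases "e < t")
      case True
      then show ?thesis by (intro that[of "(t - e) / 2"]) (auto simp: field_simps)
    next
      case False
      then have "t \<notin> Z" using T(3)[of t] e by auto
      then obtain r where r: "r > 0" "ball t r \<subseteq> - Z"
        using clZ open_contains_ball[of "- Z"] by (auto simp: closed_def)
      have "z \<notin> Z" if "z \<in> {t - r / 2..e}" for z
      proof (cases "z < t")
        case True
        then have "z \<in> ball t r" using that r(1) by (auto simp: dist_real_def)
        then show ?thesis using r(2) by blast
      qed (use that T(3)[of z] e in auto)
      then show ?thesis using r(1) by (intro that[of "r / 2"]) auto
    qed
    have "\<forall>\<^sub>F p in iterated_sequentially. G p \<inter> {t - d..e} = {}"
      by (rule fell_tendsto_miss[OF fell _ d(2)]) simp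
    moreover have "\<forall>\<^sub>F p in iterated_sequentially. 1 / real (Suc (fst p)) < d"
      by (rule eventually_compose_filterlim[OF _ filterlim_fst_iterated])
        (use order_tendstoD(2)[OF LIMSEQ_Suc[OF lim_1_over_n], of d] d(1) in simp)
    ultimately show "\<forall>\<^sub>F p in iterated_sequentially. e < \<tau> p"
      using \<tau>_mem \<tau>_ge
    proof eventually_elim
      case (elim p)
      then have "t - d \<le> \<tau> p" by linarith
      show ?case
      proof (rule ccontr)
        assume "\<not> e < \<tau> p"
        then have "\<tau> p \<in> G p \<inter> {t - d..e}" using \<open>t - d \<le> \<tau> p\<close> elim(3) by simp
        with elim(1) show False by blast
      qed
    qed
  qed
  note lim = fell_tendsto_past_at[OF fell clZ this T(1) \<tau>_mem] fell_tendsto_future_at[OF fell clZ this T(1) \<tau>_mem]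
  have "((\<lambda>p. avoidance c (past_at (\<tau> p) (G p)) * avoidance c' (future_at (\<tau> p) (G p))) \<longlongrightarrow>
      avoidance c (past_at T Z) * avoidance c' (future_at T Z)) iterated_sequentially"
    by (intro tendsto_mult tendsto_avoidance c lim)
  moreover have "\<forall>\<^sub>F p in iterated_sequentially.
      avoidance c (past_at (\<tau> p) (G p)) * avoidance c' (future_at (\<tau> p) (G p)) = (case p of (m, n) \<Rightarrow> grid_product a t c c' m n w)"
    using first
  proof eventually_elim
    case (elim p)
    have h: "h p > 0" by (cases p) (simp add: h_def)
    have "(case p of (m, n) \<Rightarrow> grid_product a t c c' m n w) =
      enn2real (split_at_first (k0 p) (scaled_avoidance (h p) c) (scaled_avoidance (h p) c') (K p))"
      by (cases p) (simp add: grid_product_def k0_def K_def h_def)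
    also have "\<dots> = avoidance c (past_at (\<tau> p) (G p)) * avoidance c' (future_at (\<tau> p) (G p))"
      unfolding split_at_first_scaled[OF elim h c] \<tau>_def G_def
      using avoidance_nonneg c by (intro enn2real_ennreal mult_nonneg_nonneg) auto
    finally show ?case by simp
  qed
  ultimately show ?thesis unfolding T_def by (rule Lim_transform_eventually)
qed

lemma regenerating_law_touch_set:
  assumes "integrable P (X 1)" "\<bar>expectation (X 1)\<bar> < a"
  shows "regenerating_law (distr P closed_sets (\<lambda>w. touch_set a (sample_path w)))"
proof -
  have a: "a \<ge> 0" using assms(2) by linarith
  note Z = measurable_touch_set[OF a]
  define Q where "Q = distr P closed_sets (\<lambda>w. touch_set a (sample_path w))"
  interpret Q: prob_space Q unfolding Q_def by (rule prob_space_distr[OF Z])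
  define A where "A t c c' w = avoidance c (past_at (first_from t (touch_set a (sample_path w))) (touch_set a (sample_path w))) *
    avoidance c' (future_at (first_from t (touch_set a (sample_path w))) (touch_set a (sample_path w)))" for t c c' w
  have meas: "(\<lambda>S. avoidance c (past_at (first_from t S) S)) \<in> borel_measurable closed_sets"
    "(\<lambda>S. avoidance c (future_at (first_from t S) S)) \<in> borel_measurable closed_sets"
    if c: "test_function c" for c t
    using measurable_id_closed_sets measurable_first_from[OF measurable_id_closed_sets]
    by (auto intro!: measurable_compose[OF _ measurable_avoidance[OF c]] measurable_past_at measurable_future_at)
  have A_meas: "A t c c' \<in> borel_measurable P" if c: "test_function c" "test_function c'" for t c c'
    unfolding A_def[abs_def]
    using measurable_compose[OF Z meas(1)[OF c(1)]] measurable_compose[OF Z meas(2)[OF c(2)]] by measurable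
  have lim: "((\<lambda>(m, n). expectation (grid_product a t c c' m n)) \<longlongrightarrow> expectation (A t c c')) iterated_sequentially"
    if c: "test_function c" "test_function c'" for t c c'
  proof (rule iterated_bounded_convergence[of _ _ 1])
    show "AE w in P. ((\<lambda>(m, n). grid_product a t c c' m n w) \<longlongrightarrow> A t c c' w) iterated_sequentially"
      using AE_touch_set_future[OF assms, of t] AE_space
    proof eventually_elim
      case (elim w)
      then have "touch_set a (sample_path w) \<inter> {t..} \<noteq> {}" by force
      from tendsto_grid_product[OF elim(2) a c this] show ?case by (simp add: A_def)
    qed
    show "\<bar>A t c c' w\<bar> \<le> 1" for w
      unfolding A_def using avoidance_nonneg avoidance_le_1 c by (auto simp: abs_mult intro!: mult_le_one)
    show "\<bar>grid_product a t c c' m n w\<bar> \<le> 1" for m n w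
      using grid_product_bounds(1,2)[OF c, of a t m n w] by simp
  qed (use measurable_grid_product A_meas c in auto)
  have product: "expectation (A t c c') = expectation (A t c (\<lambda>_. 1)) * expectation (A 0 (\<lambda>_. 1) c')"
    if c: "test_function c" "test_function c'" for t c c'
  proof -
    have "((\<lambda>(m, n). expectation (grid_product a t c c' m n) * expectation (grid_product a 0 (\<lambda>_. 1) (\<lambda>_. 1) m n)) \<longlongrightarrow>
      expectation (A t c c') * expectation (A 0 (\<lambda>_. 1) (\<lambda>_. 1))) iterated_sequentially"
      using tendsto_mult[OF lim[OF c] lim[OF test_function_one test_function_one]] by (simp add: case_prod_unfold)
    moreover have "((\<lambda>(m, n). expectation (grid_product a t c c' m n) * expectation (grid_product a 0 (\<lambda>_. 1) (\<lambda>_. 1) m n)) \<longlongrightarrow>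
      expectation (A t c (\<lambda>_. 1)) * expectation (A 0 (\<lambda>_. 1) c')) iterated_sequentially"
      unfolding expectation_grid_product[OF c]
      using tendsto_mult[OF lim[OF c(1) test_function_one] lim[OF test_function_one c(2)]]
      by (simp add: case_prod_unfold)
    ultimately have "expectation (A t c c') * expectation (A 0 (\<lambda>_. 1) (\<lambda>_. 1)) =
        expectation (A t c (\<lambda>_. 1)) * expectation (A 0 (\<lambda>_. 1) c')"
      by (rule tendsto_unique[rotated]) simp
    \<comment> \<open>With constant test functions the grid factor is the probability that the
      search succeeds. Its limit is 1, almost sure existence of a contact having entered through
      \<open>lim\<close>, so no normalisation remains.\<close>
    moreover have "expectation (A 0 (\<lambda>_. 1) (\<lambda>_. 1)) = 1" by (simp add: A_def[abs_def] prob_space)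
    ultimately show ?thesis by simp
  qed
  have "regenerating_law Q"
  proof
    show "sets Q = sets closed_sets" by (simp add: Q_def)
    show "AE S in Q. S \<inter> {t<..} \<noteq> {}" for t
    proof -
      have "{S \<in> space closed_sets. S \<inter> {t<..} \<noteq> {}} \<in> sets closed_sets"
        using hit_open_in_closed_sets[of "{t<..}"] by simp
      then show ?thesis unfolding Q_def
        using AE_touch_set_future[OF assms, of t] by (simp add: AE_distr_iff[OF Z])
    qed
    fix t c c' assume c: "test_function c" "test_function c'"
    show "(\<integral>S. avoidance c (past_at (first_from t S) S) * avoidance c' (future_at (first_from t S) S) \<partial>Q) =
      (\<integral>S. avoidance c (past_at (first_from t S) S) \<partial>Q) * (\<integral>S. avoidance c' (future_at (first_from 0 S) S) \<partial>Q)"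
      unfolding Q_def using product[OF c, of t] meas c Z
      by (simp add: integral_distr A_def[abs_def])
  qed
  then show ?thesis by (simp add: Q_def)
qed

end

theorem theorem2p6:
  fixes P :: "'a measure" and X :: "real \<Rightarrow> 'a \<Rightarrow> real" and \<alpha> :: real
    and Z :: "'a \<Rightarrow> real set"
  assumes "\<alpha> > 0"
    and "two_sided_levy_process P X"
    and "\<And>t. t \<noteq> 0 \<Longrightarrow> \<not> (\<exists>c. AE w in P. X t w = c)"
    and "integrable P (X 1)"
    and "\<bar>integral\<^sup>L P (X 1)\<bar> < \<alpha>"
  defines "Z \<equiv> \<lambda>w. contact_set \<alpha> (\<lambda>t. X t w)"
  shows "random_set P Z \<and> stationary_random_set P Z \<and> regenerative_random_set P Z"
proof -
  interpret two_sided_levy_process P X by fact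
  have Z: "Z w = touch_set \<alpha> (sample_path w)" if "w \<in> space P" for w
    unfolding Z_def sample_path_def using contact_set_eq_touch_set[OF cadlag_paths[OF that]] assms(1) by simp
  have distr_Z: "distr P closed_sets (\<lambda>w. g (Z w)) = distr P closed_sets (\<lambda>w. g (touch_set \<alpha> (sample_path w)))" for g
    by (rule distr_cong) (simp_all add: Z)
  have "random_set P Z"
    unfolding random_set_def using measurable_touch_set[of \<alpha>] assms(1) measurable_cong[of P Z, OF Z] by simp
  moreover have "distr P closed_sets (\<lambda>w. (\<lambda>s. u + s) ` Z w) = distr P closed_sets Z" for u
    using distr_Z[of "image ((+) u)"] distr_Z[of "\<lambda>S. S"] stationary_touch_set[of \<alpha> u] assms(1) by simp
  moreover have "regenerative_with (distr P closed_sets Z)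
      (regenerating_law.renewal_law (distr P closed_sets (\<lambda>w. touch_set \<alpha> (sample_path w))))"
    using regenerating_law.regenerative[OF regenerating_law_touch_set[OF assms(4,5)]] distr_Z[of "\<lambda>S. S"] by simp
  ultimately show ?thesis
    unfolding stationary_random_set_def regenerative_random_set_def by blast
qed

end
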